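(* Let $L$ and $K$ be non-trivial compactly generated elementary groups, and let $K$ act on a non-empty countable set $X$ with compact open point stabilizers (the action need not be faithful). Suppose $U$ is a compact open subgroup of $L$ with $\langle\!\langle U\rangle\!\rangle_L=L$, and suppose there exists a collection $\{K_{[\alpha+1]}\}_{\alpha<\mathrm{h}_K(K)}$ witnessing the rank of $K$ such that $K_{[1]}$ has an infinite orbit $Y_1\subset X$. Then $$\mathrm{r}(L\wr_U(K,X))=\mathrm{r}(L)-1+\mathrm{r}(K).$$ If $\mathrm{r}(K)>\omega$, then the same conclusion holds for any $K$ having a collection witnessing its rank, without the requirement that $K_{[1]}$ has an infinite orbit in $X$.
   Context: All groups are totally disconnected, locally compact, second countable (t.d.l.c.s.c.) topological groups. A topological group is compactly generated if it is generated by a compact subset. The class of elementary groups is the smallest class of t.d.l.c.s.c. groups containing all second countable profinite groups and all countable discrete groups, and closed under group extensions, closed subgroups, quotients by closed normal subgroups, and countable increasing unions of open subgroups. $\langle\!\langle H\rangle\!\rangle_G$ denotes the normal closure of $H$ in $G$ (intersection of all normal subgroups of $G$ containing $H$). Ordinal arithmetic is used; for a successor ordinal $\beta+1$, $(\beta+1)-1$ means $\beta$. Wreath product. $\bigoplus_X(L,U)$ is the group of functions $f:X\to L$ with $f(x)\in U$ for all but finitely many $x$, with the group topology in which $U^X$ (product topology) is an open subgroup. $K$ acts on it by moving the coordinate $x$ to the coordinate $k.x$, and $L\wr_U(K,X)=\bigoplus_X(L,U)\rtimes K$ with the product topology. Residual order, height, rank. $\mathcal{K}(G)$ is the set of closed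 compactly generated subgroups of $G$. For $K\leq G$, $\mathrm{Res}_G(K)$ is the intersection of all open subgroups $O\leq G$ with $kOk^{-1}=O$ for all $k\in K$. For $K_1,K_2\in\mathcal{K}(G)$ write $K_1\prec K_2$ if $K_1\leq\mathrm{Res}_G(K_2)$ and $K_1\neq K_2$. Define recursively: $\mathcal{K}_0(G)=\{\{1\}\}$; $\mathcal{K}_1(G)=\{K\in\mathcal{K}(G):\mathrm{Res}_G(K)=\{1\}\}$; for $1\leq\gamma<\omega_1$, $\mathcal{K}_{\gamma+1}(G)$ is the set of $K\in\mathcal{K}(G)$ such that every $L\prec K$ lies in $\mathcal{K}_\beta(G)$ for some $\beta\leq\gamma$; for limit $\lambda$, $\mathcal{K}_\lambda(G)=\bigcup_{\beta<\lambda}\mathcal{K}_\beta(G)$. Put $\mathcal{K}_{\omega_1}(G)=\bigcup_{\alpha<\omega_1}\mathcal{K}_\alpha(G)$. For $K\in\mathcal{K}_{\omega_1}(G)$ the residual height is $\mathrm{h}_G(K)=\min\{\alpha<\omega_1: K\in\mathcal{K}_\alpha(G)\}$. The residual rank of $G$ is well-defined if $\mathcal{K}(G)=\mathcal{K}_{\omega_1}(G)$, and then $\mathrm{r}(G)=\sup^+_{K\in\mathcal{K}(G)}(\mathrm{h}_G(K)+1)$, where $\sup^+$ is the supremum if it is a successor ordinal and the supremum plus one otherwise. For elementary groups the residual rank is well-defined. Witnessing collections. Let $G$ be non-trivial with well-defined residual rank. A collection $\{G_{[\beta+1]}\}_{\beta<\alpha}$ of closed compactly generated subgroups of $G$ witnesses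 that the rank of $G$ is at least $\alpha+1$ if $G_{[1]}\neq\{1\}$, $\mathrm{h}_G(G_{[\beta+1]})=\beta+1$ for every $\beta<\alpha$, and $G_{[\beta+1]}\prec G_{[\beta'+1]}$ whenever $\beta<\beta'<\alpha$. If moreover $\mathrm{r}(G)=\alpha+1$, the collection witnesses the rank of $G$. *)

theory Defs
  imports
    "HOL-Analysis.Analysis"
    "HOL-Algebra.Group_Action"
    "HOL-Algebra.Product_Groups"
    "HOL-Algebra.Generated_Groups"
begin

section \<open>Ordinals\<close>

text \<open>
  The library has no type of ordinals.  The type below consists of the order types of
  well-orders whose field is a set of sets of natural numbers, that is, of all ordinals of
  cardinality at most the continuum.  It contains \<open>\<omega>\<^sub>1\<close>, is closed under ordinal addition, and
  suffices for residual heights and ranks, which never exceed \<open>\<omega>\<^sub>1 + 1\<close>.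
\<close>

quotient_type ordinal =
  "nat set rel" / partial: "\<lambda>r s. Well_order r \<and> Well_order s \<and> (r, s) \<in> ordIso"
proof (rule part_equivpI)
  show "\<exists>r::nat set rel. Well_order r \<and> Well_order r \<and> (r, r) \<in> ordIso"
    by (intro exI[of _ "{}"] conjI ordIso_reflexive) (simp_all add: well_order_on_empty)
  show "symp (\<lambda>r s::nat set rel. Well_order r \<and> Well_order s \<and> (r, s) \<in> ordIso)"
    by (auto intro!: sympI ordIso_symmetric)
  show "transp (\<lambda>r s::nat set rel. Well_order r \<and> Well_order s \<and> (r, s) \<in> ordIso)"
    by (auto intro!: transpI intro: ordIso_transitive)
qed

text \<open>Codes for the two summands of a disjoint union inside \<^typ>\<open>nat set\<close>.\<close>

definition inl_code :: "nat set \<Rightarrow> nat set" where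
  "inl_code A = Suc ` A"

definition inr_code :: "nat set \<Rightarrow> nat set" where
  "inr_code A = insert 0 (Suc ` A)"

definition sum_rel :: "nat set rel \<Rightarrow> nat set rel \<Rightarrow> nat set rel" where
  "sum_rel r s = map_prod inl_code inl_code ` r \<union> map_prod inr_code inr_code ` s
     \<union> (inl_code ` Field r) \<times> (inr_code ` Field s)"

lemma inl_code_eq [simp]: "inl_code A = inl_code B \<longleftrightarrow> A = B"
  by (simp add: inl_code_def inj_image_eq_iff)

lemma inr_code_eq [simp]: "inr_code A = inr_code B \<longleftrightarrow> A = B"
proof
  assume "inr_code A = inr_code B"
  then have "insert 0 (Suc ` A) - {0} = insert 0 (Suc ` B) - {0}"
    by (simp add: inr_code_def)
  then show "A = B"
    by (simp add: inj_image_eq_iff)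
qed simp

lemma inl_inr_code_neq [simp]: "inl_code A \<noteq> inr_code B" "inr_code B \<noteq> inl_code A"
  by (auto simp: inl_code_def inr_code_def)

lemma sum_rel_simps [simp]:
  "(inl_code a, inl_code b) \<in> sum_rel r s \<longleftrightarrow> (a, b) \<in> r"
  "(inr_code a, inr_code b) \<in> sum_rel r s \<longleftrightarrow> (a, b) \<in> s"
  "(inl_code a, inr_code b) \<in> sum_rel r s \<longleftrightarrow> a \<in> Field r \<and> b \<in> Field s"
  "(inr_code a, inl_code b) \<notin> sum_rel r s"
  by (auto simp: sum_rel_def map_prod_def image_iff split: prod.splits)

lemma Field_sum_rel: "Field (sum_rel r s) = inl_code ` Field r \<union> inr_code ` Field s"
  unfolding sum_rel_def Field_def by (force simp: image_iff)

lemma sum_rel_cases: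
  assumes "x \<in> Field (sum_rel r s)"
  obtains a where "x = inl_code a" "a \<in> Field r" | a where "x = inr_code a" "a \<in> Field s"
  using assms by (auto simp: Field_sum_rel)

lemma Well_order_sum_rel:
  assumes r: "Well_order r" and s: "Well_order s"
  shows "Well_order (sum_rel r s)"
proof -
  have lr: "Linear_order r" and ls: "Linear_order s"
    using r s by (auto simp: well_order_on_def)
  have "Refl (sum_rel r s)"
    using lr ls by (auto simp: order_on_defs refl_on_def elim!: sum_rel_cases)
  moreover have "trans (sum_rel r s)"
  proof (rule transI)
    fix x y z assume xy: "(x, y) \<in> sum_rel r s" and yz: "(y, z) \<in> sum_rel r s"
    have t: "trans r" "trans s"
      using lr ls by (auto simp: order_on_defs)
    have "x \<in> Field (sum_rel r s)" "y \<in> Field (sum_rel r s)" "z \<in> Field (sum_rel r s)"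
      using xy yz by (auto intro: FieldI1 FieldI2)
    then show "(x, z) \<in> sum_rel r s"
      using xy yz by (elim sum_rel_cases) (auto intro: t[THEN transD] FieldI1 FieldI2)
  qed
  moreover have "antisym (sum_rel r s)"
  proof (rule antisymI)
    fix x y assume xy: "(x, y) \<in> sum_rel r s" and yx: "(y, x) \<in> sum_rel r s"
    have t: "antisym r" "antisym s"
      using lr ls by (auto simp: order_on_defs)
    have "x \<in> Field (sum_rel r s)" "y \<in> Field (sum_rel r s)"
      using xy by (auto intro: FieldI1 FieldI2)
    then show "x = y"
      using xy yx t by (elim sum_rel_cases) (auto dest: antisymD)
  qed
  moreover
  have tot: "\<And>a b. a \<in> Field r \<Longrightarrow> b \<in> Field r \<Longrightarrow> a \<noteq> b \<Longrightarrow> (a, b) \<in> r \<or> (b, a) \<in> r"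
    "\<And>a b. a \<in> Field s \<Longrightarrow> b \<in> Field s \<Longrightarrow> a \<noteq> b \<Longrightarrow> (a, b) \<in> s \<or> (b, a) \<in> s"
    using lr ls by (simp_all add: order_on_defs total_on_def)
  have "Total (sum_rel r s)"
    unfolding total_on_def
  proof (intro ballI impI)
    fix x y assume x: "x \<in> Field (sum_rel r s)" and y: "y \<in> Field (sum_rel r s)" and "x \<noteq> y"
    then show "(x, y) \<in> sum_rel r s \<or> (y, x) \<in> sum_rel r s"
      using tot by (elim sum_rel_cases) auto
  qed
  moreover have "sum_rel r s \<subseteq> Field (sum_rel r s) \<times> Field (sum_rel r s)"
    by (auto intro: FieldI1 FieldI2)
  ultimately have lin: "Linear_order (sum_rel r s)"
    by (simp add: order_on_defs)
  show ?thesis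
    unfolding Linear_order_Well_order_iff[OF lin]
  proof (intro allI impI)
    fix A assume A: "A \<subseteq> Field (sum_rel r s)" "A \<noteq> {}"
    show "\<exists>a\<in>A. \<forall>a'\<in>A. (a, a') \<in> sum_rel r s"
    proof (cases "inl_code -` A = {}")
      case False
      moreover have "inl_code -` A \<subseteq> Field r"
        using A(1) by (auto simp: Field_sum_rel)
      ultimately obtain a where a: "a \<in> inl_code -` A" "\<forall>a'\<in>inl_code -` A. (a, a') \<in> r"
        using r Linear_order_Well_order_iff[OF lr] by blast
      have "(inl_code a, x) \<in> sum_rel r s" if "x \<in> A" for x
      proof -
        from that A(1) have "x \<in> Field (sum_rel r s)" by blast
        then show ?thesis
          using that a by (elim sum_rel_cases) (auto intro: FieldI1)
      qed
      with a(1) show ?thesis by blast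
    next
      case True
      have sub: "inr_code -` A \<subseteq> Field s"
        using A by (auto simp: Field_sum_rel)
      have "inr_code -` A \<noteq> {}"
        using A True unfolding Field_sum_rel by blast
      with sub obtain a where a: "a \<in> inr_code -` A" "\<forall>a'\<in>inr_code -` A. (a, a') \<in> s"
        using s Linear_order_Well_order_iff[OF ls] by blast
      have "(inr_code a, x) \<in> sum_rel r s" if "x \<in> A" for x
      proof -
        from that A(1) have "x \<in> Field (sum_rel r s)" by blast
        then show ?thesis
          using that a True by (elim sum_rel_cases) auto
      qed
      with a(1) show ?thesis by blast
    qed
  qed
qed

lemma ordIso_alt:
  assumes "Well_order r" "Well_order s"
  shows "(r, s) \<in> ordIso \<longleftrightarrow>
    (\<exists>f. bij_betw f (Field r) (Field s) \<and> (\<forall>a\<in>Field r. \<forall>b\<in>Field r. (a, b) \<in> r \<longleftrightarrow> (f a, f b) \<in> s))"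
  using assms by (auto simp: ordIso_def iso_iff2)

lemma sum_rel_cong:
  assumes wo: "Well_order r" "Well_order r'" "Well_order s" "Well_order s'"
    and iso: "(r, r') \<in> ordIso" "(s, s') \<in> ordIso"
  shows "(sum_rel r s, sum_rel r' s') \<in> ordIso"
proof -
  obtain f where f: "bij_betw f (Field r) (Field r')"
    "\<And>a b. a \<in> Field r \<Longrightarrow> b \<in> Field r \<Longrightarrow> (a, b) \<in> r \<longleftrightarrow> (f a, f b) \<in> r'"
    using iso(1) unfolding ordIso_alt[OF wo(1,2)] by blast
  obtain g where g: "bij_betw g (Field s) (Field s')"
    "\<And>a b. a \<in> Field s \<Longrightarrow> b \<in> Field s \<Longrightarrow> (a, b) \<in> s \<longleftrightarrow> (g a, g b) \<in> s'"
    using iso(2) unfolding ordIso_alt[OF wo(3,4)] by blast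
  define h where "h x = (if x \<in> range inl_code then inl_code (f (inv_into UNIV inl_code x))
                         else inr_code (g (inv_into UNIV inr_code x)))" for x
  have inj: "inj inl_code" "inj inr_code"
    by (auto simp: inj_def)
  have h [simp]: "h (inl_code a) = inl_code (f a)" "h (inr_code a) = inr_code (g a)" for a
    by (auto simp: h_def inj)
  have fF: "f a \<in> Field r'" if "a \<in> Field r" for a using f(1) that by (auto simp: bij_betw_def)
  have gF: "g a \<in> Field s'" if "a \<in> Field s" for a using g(1) that by (auto simp: bij_betw_def)
  have "bij_betw h (Field (sum_rel r s)) (Field (sum_rel r' s'))"
    unfolding bij_betw_def
  proof
    show "inj_on h (Field (sum_rel r s))"
      using f(1) g(1) by (auto intro!: inj_onI simp: bij_betw_def inj_on_eq_iff elim!: sum_rel_cases)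
    have "h ` Field (sum_rel r s) = inl_code ` (f ` Field r) \<union> inr_code ` (g ` Field s)"
      by (simp add: Field_sum_rel image_Un image_image)
    then show "h ` Field (sum_rel r s) = Field (sum_rel r' s')"
      using f(1) g(1) by (simp add: Field_sum_rel bij_betw_def)
  qed
  moreover have "\<forall>a\<in>Field (sum_rel r s). \<forall>b\<in>Field (sum_rel r s).
      (a, b) \<in> sum_rel r s \<longleftrightarrow> (h a, h b) \<in> sum_rel r' s'"
  proof (intro ballI)
    fix a b assume "a \<in> Field (sum_rel r s)" "b \<in> Field (sum_rel r s)"
    then show "(a, b) \<in> sum_rel r s \<longleftrightarrow> (h a, h b) \<in> sum_rel r' s'"
      by (elim sum_rel_cases) (simp_all add: f(2) g(2) fF gF)
  qed
  ultimately show ?thesis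
    unfolding ordIso_alt[OF Well_order_sum_rel[OF wo(1,3)] Well_order_sum_rel[OF wo(2,4)]]
    by (intro exI[of _ h] conjI)
qed

lemma Well_order_singleton: "Well_order {(a, a)}"
proof -
  have "Linear_order {(a, a)}"
    by (auto simp: Field_def order_on_defs refl_on_def trans_def antisym_def total_on_def)
  moreover have "{(a, a)} - Id = {}"
    by auto
  ultimately show ?thesis
    by (simp only: well_order_on_def wf_def) simp
qed

instantiation ordinal :: "{zero, one, plus, ord}"
begin

lift_definition zero_ordinal :: ordinal is "{}"
  by (intro conjI ordIso_reflexive) (simp_all add: well_order_on_empty)

lift_definition one_ordinal :: ordinal is "{({}, {})}"
  by (intro conjI Well_order_singleton ordIso_reflexive)

lift_definition plus_ordinal :: "ordinal \<Rightarrow> ordinal \<Rightarrow> ordinal" is sum_rel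
  by (simp add: Well_order_sum_rel sum_rel_cong)

lift_definition less_eq_ordinal :: "ordinal \<Rightarrow> ordinal \<Rightarrow> bool" is "\<lambda>r s. (r, s) \<in> ordLeq"
  by (meson ordIso_ordLeq_trans ordIso_symmetric ordLeq_ordIso_trans)

lift_definition less_ordinal :: "ordinal \<Rightarrow> ordinal \<Rightarrow> bool" is "\<lambda>r s. (r, s) \<in> ordLess"
  by (meson ordIso_ordLess_trans ordIso_symmetric ordLess_ordIso_trans)

instance ..

end

lemma ordinal_cases:
  obtains r where "Well_order r" "x = abs_ordinal r"
proof
  show "Well_order (rep_ordinal x)"
    using Quotient3_rep_reflp[OF Quotient3_ordinal, of x] by simp
  show "x = abs_ordinal (rep_ordinal x)"
    using Quotient3_abs_rep[OF Quotient3_ordinal, of x] by simp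
qed

lemma less_abs_ordinal:
  assumes "Well_order r" "Well_order s"
  shows "abs_ordinal r < abs_ordinal s \<longleftrightarrow> (r, s) \<in> ordLess"
  using assms by (simp add: less_ordinal.abs_eq ordIso_reflexive)

instance ordinal :: wellorder
proof
  fix x y z :: ordinal
  show "x < y \<longleftrightarrow> x \<le> y \<and> \<not> y \<le> x"
    by transfer (auto intro: ordLess_imp_ordLeq simp: not_ordLeq_iff_ordLess)
  show "x \<le> x"
    by transfer (auto intro: ordLeq_reflexive)
  show "x \<le> y \<Longrightarrow> y \<le> z \<Longrightarrow> x \<le> z"
    by transfer (auto intro: ordLeq_transitive)
  show "x \<le> y \<Longrightarrow> y \<le> x \<Longrightarrow> x = y"
    by transfer (auto simp: ordIso_iff_ordLeq)
  show "x \<le> y \<or> y \<le> x"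
    by transfer (meson ordLeq_total)
next
  fix P :: "ordinal \<Rightarrow> bool" and a
  assume step: "\<And>x. (\<And>y. y < x \<Longrightarrow> P y) \<Longrightarrow> P x"
  have "Well_order r \<Longrightarrow> P (abs_ordinal r)" for r
  proof (induction r rule: wf_induct_rule[OF wf_ordLess])
    case (1 r)
    show ?case
    proof (rule step)
      fix y assume y: "y < abs_ordinal r"
      obtain s where s: "Well_order s" "y = abs_ordinal s"
        by (rule ordinal_cases)
      have "(s, r) \<in> ordLess"
        using y s 1(2) by (simp add: less_abs_ordinal)
      then show "P y"
        using 1(1) s by simp
    qed
  qed
  then show "P a"
    using ordinal_cases[of a] by blast
qed


lemma abs_ordinal_eq_iff:
  assumes "Well_order r" "Well_order s"
  shows "abs_ordinal r = abs_ordinal s \<longleftrightarrow> (r, s) \<in> ordIso"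
  using assms Quotient3_rel[OF Quotient3_ordinal, of r s] by (auto simp: ordIso_reflexive)

lemma less_abs_ordinal_iff:
  assumes r: "Well_order r"
  shows "\<gamma> < abs_ordinal r \<longleftrightarrow> (\<exists>a\<in>Field r. \<gamma> = abs_ordinal (Restr r (underS r a)))"
proof -
  obtain t where t: "Well_order t" "\<gamma> = abs_ordinal t"
    by (rule ordinal_cases)
  have "\<gamma> < abs_ordinal r \<longleftrightarrow> (t, r) \<in> ordLess"
    using t r by (simp add: less_abs_ordinal)
  also have "\<dots> \<longleftrightarrow> (\<exists>a\<in>Field r. (t, Restr r (underS r a)) \<in> ordIso)"
    by (rule ordLess_iff_ordIso_Restr[OF r t(1)])
  also have "\<dots> \<longleftrightarrow> (\<exists>a\<in>Field r. \<gamma> = abs_ordinal (Restr r (underS r a)))"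
    using t abs_ordinal_eq_iff[OF t(1) Well_order_Restr[OF r]] by simp
  finally show ?thesis .
qed

lemma Field_Restr_underS:
  assumes "Well_order r"
  shows "Field (Restr r (underS r a)) = underS r a"
  using assms
  by (intro Refl_Field_Restr2) (auto simp: well_order_on_def order_on_defs underS_def intro: FieldI1)

lemma Restr_underS_sum_rel_inl:
  assumes r: "Well_order r" and s: "Well_order s" and a: "a \<in> Field r"
  shows "abs_ordinal (Restr (sum_rel r s) (underS (sum_rel r s) (inl_code a)))
       = abs_ordinal (Restr r (underS r a))" (is "abs_ordinal ?R = abs_ordinal ?S")
proof -
  have wo: "Well_order (sum_rel r s)" "Well_order ?R" "Well_order ?S"
    using r s by (simp_all add: Well_order_sum_rel Well_order_Restr)
  have u: "underS (sum_rel r s) (inl_code a) = inl_code ` underS r a"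
  proof (rule Set.set_eqI)
    fix x show "x \<in> underS (sum_rel r s) (inl_code a) \<longleftrightarrow> x \<in> inl_code ` underS r a"
    proof
      assume x: "x \<in> underS (sum_rel r s) (inl_code a)"
      then have "x \<in> Field (sum_rel r s)"
        by (auto simp: underS_def intro: FieldI1)
      then show "x \<in> inl_code ` underS r a"
        using x by (elim sum_rel_cases) (auto simp: underS_def)
    qed (auto simp: underS_def)
  qed
  have "Field ?R = inl_code ` underS r a"
    using Field_Restr_underS[OF wo(1), of "inl_code a"] u by simp
  then have "bij_betw inl_code (Field ?S) (Field ?R)"
    by (simp add: Field_Restr_underS[OF r] bij_betw_def inj_on_def)
  then have "(?S, ?R) \<in> ordIso"
    unfolding ordIso_alt[OF wo(3,2)] by (intro exI[of _ inl_code]) (auto simp: u Field_Restr_underS[OF r])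
  then show ?thesis
    using abs_ordinal_eq_iff[OF wo(3,2)] by simp
qed

lemma Restr_underS_sum_rel_inr:
  assumes r: "Well_order r" and s: "Well_order s" and b: "b \<in> Field s"
  shows "Restr (sum_rel r s) (underS (sum_rel r s) (inr_code b))
       = sum_rel r (Restr s (underS s b))"
proof -
  have u: "underS (sum_rel r s) (inr_code b) = inl_code ` Field r \<union> inr_code ` underS s b"
  proof (rule Set.set_eqI)
    fix x show "x \<in> underS (sum_rel r s) (inr_code b)
      \<longleftrightarrow> x \<in> inl_code ` Field r \<union> inr_code ` underS s b"
    proof
      assume x: "x \<in> underS (sum_rel r s) (inr_code b)"
      then have "x \<in> Field (sum_rel r s)"
        by (auto simp: underS_def intro: FieldI1)
      then show "x \<in> inl_code ` Field r \<union> inr_code ` underS s b"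
        using x by (elim sum_rel_cases) (auto simp: underS_def)
    qed (use b in \<open>auto simp: underS_def\<close>)
  qed
  show ?thesis
  proof (rule Set.set_eqI, clarify)
    fix x y
    have F: "x \<in> Field (sum_rel r s) \<and> y \<in> Field (sum_rel r s)"
      if "(x, y) \<in> Restr (sum_rel r s) (underS (sum_rel r s) (inr_code b))
        \<or> (x, y) \<in> sum_rel r (Restr s (underS s b))"
    proof -
      have "underS s b \<subseteq> Field s"
        by (auto simp: underS_def intro: FieldI1)
      then have "Field (sum_rel r (Restr s (underS s b))) \<subseteq> Field (sum_rel r s)"
        by (simp only: Field_sum_rel Field_Restr_underS[OF s]) blast
      then show ?thesis
        using that by (auto intro: FieldI1 FieldI2)
    qed
    show "(x, y) \<in> Restr (sum_rel r s) (underS (sum_rel r s) (inr_code b))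
      \<longleftrightarrow> (x, y) \<in> sum_rel r (Restr s (underS s b))" (is "?P \<longleftrightarrow> ?Q")
    proof -
      have "?P \<longleftrightarrow> ?Q" if "x \<in> Field (sum_rel r s)" "y \<in> Field (sum_rel r s)"
        using that
        by (elim sum_rel_cases) (auto simp: u Field_Restr_underS[OF s] intro: FieldI1 FieldI2)
      then show ?thesis
        using F by blast
    qed
  qed
qed

text \<open>
  \<^term>\<open>\<alpha> + \<beta>\<close> is the ordinal whose predecessors are those of \<open>\<alpha>\<close> and the \<^term>\<open>\<alpha> + \<delta>\<close>
  with \<^term>\<open>\<delta> < \<beta>\<close>, so that \<open>+\<close> satisfies the usual recursion for ordinal addition.
\<close>

lemma ordinal_less_add_iff:
  fixes \<alpha> \<beta> \<gamma> :: ordinal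
  shows "\<gamma> < \<alpha> + \<beta> \<longleftrightarrow> \<gamma> < \<alpha> \<or> (\<exists>\<delta><\<beta>. \<gamma> = \<alpha> + \<delta>)"
proof -
  obtain r where r: "Well_order r" "\<alpha> = abs_ordinal r" by (rule ordinal_cases)
  obtain s where s: "Well_order s" "\<beta> = abs_ordinal s" by (rule ordinal_cases)
  have plus: "abs_ordinal r + abs_ordinal t = abs_ordinal (sum_rel r t)" if "Well_order t" for t
    using r(1) that by (simp add: plus_ordinal.abs_eq ordIso_reflexive)
  have "\<gamma> < \<alpha> + \<beta> \<longleftrightarrow> (\<exists>x\<in>Field (sum_rel r s).
      \<gamma> = abs_ordinal (Restr (sum_rel r s) (underS (sum_rel r s) x)))"
    unfolding r(2) s(2) plus[OF s(1)]
    by (rule less_abs_ordinal_iff[OF Well_order_sum_rel[OF r(1) s(1)]])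
  also have "\<dots> \<longleftrightarrow> (\<exists>a\<in>Field r. \<gamma> = abs_ordinal (Restr r (underS r a)))
      \<or> (\<exists>b\<in>Field s. \<gamma> = \<alpha> + abs_ordinal (Restr s (underS s b)))"
    using r s
    by (simp add: Field_sum_rel bex_Un Restr_underS_sum_rel_inl Restr_underS_sum_rel_inr plus
        Well_order_Restr)
  also have "\<dots> \<longleftrightarrow> \<gamma> < \<alpha> \<or> (\<exists>\<delta><\<beta>. \<gamma> = \<alpha> + \<delta>)"
    unfolding r(2) s(2) less_abs_ordinal_iff[OF r(1)] less_abs_ordinal_iff[OF s(1)] by blast
  finally show ?thesis .
qed

lemma ordinal_not_less_zero [simp]: "\<not> \<alpha> < (0::ordinal)"
proof -
  have "(0::ordinal) = abs_ordinal {}"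
    by (simp add: zero_ordinal_def)
  then show ?thesis
    using less_abs_ordinal_iff[of "{}" \<alpha>] by simp
qed

lemma ordinal_add_zero [simp]: "\<alpha> + 0 = (\<alpha>::ordinal)"
  by (rule linorder_cases[of "\<alpha> + 0" \<alpha>]) (use ordinal_less_add_iff[of _ \<alpha> 0] in auto)

lemma ordinal_less_one_iff [simp]: "\<alpha> < (1::ordinal) \<longleftrightarrow> \<alpha> = 0"
proof -
  have wo: "Well_order {({}::nat set, {})}"
    by (rule Well_order_singleton)
  have "Restr {({}::nat set, {})} (underS {({}, {})} {}) = {}"
    by (auto simp: underS_def)
  then show ?thesis
    using less_abs_ordinal_iff[OF wo, of \<alpha>] by (simp add: one_ordinal_def zero_ordinal_def Field_def)
qed

lemma ordinal_less_add_one_iff: "\<beta> < \<alpha> + 1 \<longleftrightarrow> \<beta> \<le> (\<alpha>::ordinal)"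
  by (auto simp: ordinal_less_add_iff)

lemma ex_uncountable_ordinal: "\<exists>\<alpha>::ordinal. uncountable {..<\<alpha>}"
proof -
  obtain r :: "nat set rel" where r: "well_order_on UNIV r"
    using well_order_on by blast
  have F: "Field r = UNIV"
    using well_order_on_Field[OF r] by simp
  then have wo: "Well_order r"
    using r by simp
  define f where "f a = abs_ordinal (Restr r (underS r a))" for a
  have ne: "f a < f b" if ab: "(a, b) \<in> r" "a \<noteq> b" for a b
  proof -
    have wb: "Well_order (Restr r (underS r b))"
      by (rule Well_order_Restr[OF wo])
    have a: "a \<in> underS r b"
      using ab by (simp add: underS_def)
    have tr: "trans r" and as: "antisym r"
      using wo by (auto simp: order_on_defs well_order_on_def)
    have "underS r a \<subseteq> underS r b"
      using a ab as tr by (auto simp: underS_def dest: transD antisymD)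
    then have "underS (Restr r (underS r b)) a = underS r a"
      using a by (auto simp: underS_def)
    moreover have "Restr (Restr r (underS r b)) (underS r a) = Restr r (underS r a)"
      using \<open>underS r a \<subseteq> underS r b\<close> by blast
    ultimately show ?thesis
      unfolding f_def less_abs_ordinal_iff[OF wb]
      using a by (intro bexI[of _ a]) (simp_all add: Field_Restr_underS[OF wo])
  qed
  have "inj f"
  proof (rule injI)
    fix a b assume "f a = f b"
    moreover have "a = b \<or> (a, b) \<in> r \<or> (b, a) \<in> r"
      using wo F by (auto simp: well_order_on_def order_on_defs total_on_def)
    ultimately show "a = b"
      using ne[of a b] ne[of b a] by auto
  qed
  moreover have "uncountable (UNIV :: nat set set)"
    using Cantors_theorem[of "UNIV :: nat set"] uncountable_def[of "UNIV :: nat set set"] by auto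
  ultimately have "uncountable (range f)"
    using countable_image_inj_on by blast
  moreover have "range f \<subseteq> {..<abs_ordinal r}"
    using less_abs_ordinal_iff[OF wo] F by (auto simp: f_def)
  ultimately show ?thesis
    using countable_subset by blast
qed

definition omega :: ordinal where
  "omega = (LEAST \<alpha>. infinite {..<\<alpha>})"

definition omega1 :: ordinal where
  "omega1 = (LEAST \<alpha>. uncountable {..<\<alpha>})"

definition is_limit :: "ordinal \<Rightarrow> bool" where
  "is_limit \<alpha> \<longleftrightarrow> \<alpha> \<noteq> 0 \<and> (\<nexists>\<beta>. \<alpha> = \<beta> + 1)"

text \<open>The ordinal \<open>\<alpha> - 1\<close>, meaningful for successor ordinals \<open>\<alpha>\<close> only.\<close>

definition ord_pred :: "ordinal \<Rightarrow> ordinal" where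
  "ord_pred \<alpha> = (THE \<beta>. \<alpha> = \<beta> + 1)"

definition ord_sup :: "ordinal set \<Rightarrow> ordinal" where
  "ord_sup A = (LEAST \<sigma>. \<forall>\<alpha>\<in>A. \<alpha> \<le> \<sigma>)"

definition ord_sup_plus :: "ordinal set \<Rightarrow> ordinal" where
  "ord_sup_plus A = (if \<exists>\<beta>. ord_sup A = \<beta> + 1 then ord_sup A else ord_sup A + 1)"


section \<open>Topological groups\<close>

text \<open>
  A topological group is a group \<open>G\<close> together with a topology \<open>T\<close> on its carrier; a subgroup
  \<open>H\<close> is turned into the topological group \<open>G\<lparr>carrier := H\<rparr>\<close> with \<open>subtopology T H\<close>.
\<close>

definition topological_group :: "'a monoid \<Rightarrow> 'a topology \<Rightarrow> bool" where
  "topological_group G T \<longleftrightarrow>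
     group G \<and> topspace T = carrier G \<and>
     continuous_map (prod_topology T T) T (\<lambda>(x, y). x \<otimes>\<^bsub>G\<^esub> y) \<and>
     continuous_map T T (\<lambda>x. inv\<^bsub>G\<^esub> x)"

definition totally_disconnected_space :: "'a topology \<Rightarrow> bool" where
  "totally_disconnected_space T \<longleftrightarrow> (\<forall>S. connectedin T S \<longrightarrow> (\<exists>a. S \<subseteq> {a}))"

definition tdlcsc_group :: "'a monoid \<Rightarrow> 'a topology \<Rightarrow> bool" where
  "tdlcsc_group G T \<longleftrightarrow>
     topological_group G T \<and> Hausdorff_space T \<and> totally_disconnected_space T \<and>
     locally_compact_space T \<and> second_countable T"

definition compactly_generated :: "'a monoid \<Rightarrow> 'a topology \<Rightarrow> bool" where
  "compactly_generated G T \<longleftrightarrow> (\<exists>C. compactin T C \<and> generate G C = carrier G)"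

definition normal_closure :: "'a monoid \<Rightarrow> 'a set \<Rightarrow> 'a set" where
  "normal_closure G H = \<Inter>{N. N \<lhd> G \<and> H \<subseteq> N}"

definition topgroup_isomorphic ::
  "'a monoid \<Rightarrow> 'a topology \<Rightarrow> 'b monoid \<Rightarrow> 'b topology \<Rightarrow> bool" where
  "topgroup_isomorphic G T H S \<longleftrightarrow>
     topological_group G T \<and> topological_group H S \<and> (\<exists>f \<in> iso G H. homeomorphic_map T S f)"


section \<open>Elementary groups\<close>

text \<open>
  The class of elementary groups cannot be defined by an induction ranging over all types.
  A second countable Hausdorff space has at most continuum many points, so every t.d.l.c.s.c.
  group is isomorphic to one whose elements are sets of natural numbers.  We therefore generate
  the class among the groups on this type, up to isomorphism, and call an arbitrary group
  elementary if it is isomorphic to one of these.  In the rules \<open>extension\<close> and \<open>quotient\<close>,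
  \<open>S'\<close> is the quotient topology on \<open>G Mod N\<close> and \<open>(Q, S)\<close> is a copy of the quotient group.
\<close>

inductive elementary_coded :: "nat set monoid \<Rightarrow> nat set topology \<Rightarrow> bool" where
  profinite: "elementary_coded G T"
    if "tdlcsc_group G T" "compact_space T"
| discrete: "elementary_coded G T"
    if "tdlcsc_group G T" "countable (carrier G)" "T = discrete_topology (carrier G)"
| isomorphic: "elementary_coded H S"
    if "elementary_coded G T" "topgroup_isomorphic G T H S"
| extension: "elementary_coded G T"
    if "tdlcsc_group G T" "N \<lhd> G" "closedin T N"
       "elementary_coded (G\<lparr>carrier := N\<rparr>) (subtopology T N)"
       "quotient_map T S' (\<lambda>g. N #>\<^bsub>G\<^esub> g)" "topgroup_isomorphic (G Mod N) S' Q S"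
       "elementary_coded Q S"
| closed_subgroup: "elementary_coded (G\<lparr>carrier := H\<rparr>) (subtopology T H)"
    if "elementary_coded G T" "subgroup H G" "closedin T H"
| quotient: "elementary_coded Q S"
    if "elementary_coded G T" "N \<lhd> G" "closedin T N"
       "quotient_map T S' (\<lambda>g. N #>\<^bsub>G\<^esub> g)" "topgroup_isomorphic (G Mod N) S' Q S"
| increasing_union: "elementary_coded G T"
    if "tdlcsc_group G T" "\<And>n. subgroup (H n) G" "\<And>n. openin T (H n)"
       "\<And>n::nat. H n \<subseteq> H (Suc n)" "(\<Union>n. H n) = carrier G"
       "\<And>n. elementary_coded (G\<lparr>carrier := H n\<rparr>) (subtopology T (H n))"

definition elementary_group :: "'a monoid \<Rightarrow> 'a topology \<Rightarrow> bool" where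
  "elementary_group G T \<longleftrightarrow> (\<exists>G' T'. elementary_coded G' T' \<and> topgroup_isomorphic G T G' T')"


section \<open>Residual order, height and rank\<close>

definition cg_subgroups :: "'a monoid \<Rightarrow> 'a topology \<Rightarrow> 'a set set" where
  "cg_subgroups G T =
     {H. subgroup H G \<and> closedin T H \<and> compactly_generated (G\<lparr>carrier := H\<rparr>) (subtopology T H)}"

definition Res :: "'a monoid \<Rightarrow> 'a topology \<Rightarrow> 'a set \<Rightarrow> 'a set" where
  "Res G T K = \<Inter>{V. subgroup V G \<and> openin T V \<and>
                    (\<forall>k\<in>K. (\<lambda>x. k \<otimes>\<^bsub>G\<^esub> x \<otimes>\<^bsub>G\<^esub> inv\<^bsub>G\<^esub> k) ` V = V)}"

definition res_prec :: "'a monoid \<Rightarrow> 'a topology \<Rightarrow> 'a set \<Rightarrow> 'a set \<Rightarrow> bool" where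
  "res_prec G T K\<^sub>1 K\<^sub>2 \<longleftrightarrow> K\<^sub>1 \<subseteq> Res G T K\<^sub>2 \<and> K\<^sub>1 \<noteq> K\<^sub>2"

text \<open>
  \<open>res_class G T \<alpha> K\<close> expresses \<open>K \<in> \<K>\<^sub>\<alpha>(G)\<close>.  Each level refers to strictly smaller levels only,
  so this inductive definition is the transfinite recursion; levels at and above \<open>\<omega>\<^sub>1\<close> are not used.
\<close>

inductive res_class :: "'a monoid \<Rightarrow> 'a topology \<Rightarrow> ordinal \<Rightarrow> 'a set \<Rightarrow> bool"
  for G :: "'a monoid" and T :: "'a topology" where
  zero: "res_class G T 0 {\<one>\<^bsub>G\<^esub>}"
| one: "res_class G T 1 K" if "K \<in> cg_subgroups G T" "Res G T K = {\<one>\<^bsub>G\<^esub>}"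
| succ: "res_class G T (\<gamma> + 1) K"
    if "1 \<le> \<gamma>" "K \<in> cg_subgroups G T"
       "\<And>L. L \<in> cg_subgroups G T \<Longrightarrow> res_prec G T L K \<Longrightarrow> \<exists>\<beta>\<le>\<gamma>. res_class G T \<beta> L"
| limit: "res_class G T \<gamma> K" if "is_limit \<gamma>" "\<beta> < \<gamma>" "res_class G T \<beta> K"

definition residual_height :: "'a monoid \<Rightarrow> 'a topology \<Rightarrow> 'a set \<Rightarrow> ordinal" where
  "residual_height G T K = (LEAST \<alpha>. \<alpha> < omega1 \<and> res_class G T \<alpha> K)"

definition residual_rank_well_defined :: "'a monoid \<Rightarrow> 'a topology \<Rightarrow> bool" where
  "residual_rank_well_defined G T \<longleftrightarrow>
     cg_subgroups G T = {K. \<exists>\<alpha><omega1. res_class G T \<alpha> K}"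

definition residual_rank :: "'a monoid \<Rightarrow> 'a topology \<Rightarrow> ordinal" where
  "residual_rank G T = ord_sup_plus ((\<lambda>K. residual_height G T K + 1) ` cg_subgroups G T)"

text \<open>The collection \<open>{G\<^bsub>[\<beta>+1]\<^esub>}\<^bsub>\<beta><\<alpha>\<^esub>\<close> is given by a function \<open>F\<close> with \<open>F \<beta> = G\<^bsub>[\<beta>+1]\<^esub>\<close>.\<close>

definition witnesses_rank_ge ::
  "'a monoid \<Rightarrow> 'a topology \<Rightarrow> ordinal \<Rightarrow> (ordinal \<Rightarrow> 'a set) \<Rightarrow> bool" where
  "witnesses_rank_ge G T \<alpha> F \<longleftrightarrow>
     carrier G \<noteq> {\<one>\<^bsub>G\<^esub>} \<and> residual_rank_well_defined G T \<and>
     (\<forall>\<beta><\<alpha>. F \<beta> \<in> cg_subgroups G T) \<and>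
     (0 < \<alpha> \<longrightarrow> F 0 \<noteq> {\<one>\<^bsub>G\<^esub>}) \<and>
     (\<forall>\<beta><\<alpha>. residual_height G T (F \<beta>) = \<beta> + 1) \<and>
     (\<forall>\<beta> \<beta>'. \<beta> < \<beta>' \<and> \<beta>' < \<alpha> \<longrightarrow> res_prec G T (F \<beta>) (F \<beta>'))"

definition witnesses_rank ::
  "'a monoid \<Rightarrow> 'a topology \<Rightarrow> ordinal \<Rightarrow> (ordinal \<Rightarrow> 'a set) \<Rightarrow> bool" where
  "witnesses_rank G T \<alpha> F \<longleftrightarrow> witnesses_rank_ge G T \<alpha> F \<and> residual_rank G T = \<alpha> + 1"


section \<open>Wreath products\<close>

definition restricted_sum :: "'x set \<Rightarrow> 'a monoid \<Rightarrow> 'a set \<Rightarrow> ('x \<Rightarrow> 'a) monoid" where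
  "restricted_sum X L U =
     (product_group X (\<lambda>_. L))
       \<lparr>carrier := {f \<in> carrier (product_group X (\<lambda>_. L)). finite {x \<in> X. f x \<notin> U}}\<rparr>"

text \<open>
  The group topology for which \<open>U\<^sup>X\<close> with the product topology is an open subgroup: a set is open
  iff its traces on all cosets \<open>f U\<^sup>X\<close>, translated back to \<open>U\<^sup>X\<close>, are open there.
\<close>

definition restricted_sum_topology ::
  "'x set \<Rightarrow> 'a monoid \<Rightarrow> 'a topology \<Rightarrow> 'a set \<Rightarrow> ('x \<Rightarrow> 'a) topology" where
  "restricted_sum_topology X L T U = topology (\<lambda>S.
     S \<subseteq> carrier (restricted_sum X L U) \<and>
     (\<forall>f \<in> carrier (restricted_sum X L U).
        openin (product_topology (\<lambda>_. subtopology T U) X)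
          {u \<in> topspace (product_topology (\<lambda>_. subtopology T U) X).
             f \<otimes>\<^bsub>restricted_sum X L U\<^esub> u \<in> S}))"

lemma openin_restricted_sum_topology:
  "openin (restricted_sum_topology X L T U) S \<longleftrightarrow>
     S \<subseteq> carrier (restricted_sum X L U) \<and>
     (\<forall>f \<in> carrier (restricted_sum X L U).
        openin (product_topology (\<lambda>_. subtopology T U) X)
          {u \<in> topspace (product_topology (\<lambda>_. subtopology T U) X).
             f \<otimes>\<^bsub>restricted_sum X L U\<^esub> u \<in> S})"
proof -
  define P where "P = product_topology (\<lambda>_. subtopology T U) X"
  define G where "G = restricted_sum X L U"
  have "istopology (\<lambda>S. S \<subseteq> carrier G \<and>
      (\<forall>f \<in> carrier G. openin P {u \<in> topspace P. f \<otimes>\<^bsub>G\<^esub> u \<in> S}))"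
    unfolding istopology_def
  proof (intro conjI allI impI ballI)
    fix S S' f
    assume *: "S \<subseteq> carrier G \<and> (\<forall>f \<in> carrier G. openin P {u \<in> topspace P. f \<otimes>\<^bsub>G\<^esub> u \<in> S})"
      "S' \<subseteq> carrier G \<and> (\<forall>f \<in> carrier G. openin P {u \<in> topspace P. f \<otimes>\<^bsub>G\<^esub> u \<in> S'})"
    show "S \<inter> S' \<subseteq> carrier G"
      using * by blast
    assume f: "f \<in> carrier G"
    have "{u \<in> topspace P. f \<otimes>\<^bsub>G\<^esub> u \<in> S \<inter> S'}
        = {u \<in> topspace P. f \<otimes>\<^bsub>G\<^esub> u \<in> S} \<inter> {u \<in> topspace P. f \<otimes>\<^bsub>G\<^esub> u \<in> S'}"
      by blast
    then show "openin P {u \<in> topspace P. f \<otimes>\<^bsub>G\<^esub> u \<in> S \<inter> S'}"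
      using * f by (simp add: openin_Int)
  next
    fix \<S> f
    assume *: "\<forall>S\<in>\<S>. S \<subseteq> carrier G \<and>
      (\<forall>f \<in> carrier G. openin P {u \<in> topspace P. f \<otimes>\<^bsub>G\<^esub> u \<in> S})"
    show "\<Union>\<S> \<subseteq> carrier G"
      using * by blast
    assume f: "f \<in> carrier G"
    have "{u \<in> topspace P. f \<otimes>\<^bsub>G\<^esub> u \<in> \<Union>\<S>} = (\<Union>S\<in>\<S>. {u \<in> topspace P. f \<otimes>\<^bsub>G\<^esub> u \<in> S})"
      by blast
    also have "openin P \<dots>"
      using * f by (intro openin_Union) auto
    finally show "openin P {u \<in> topspace P. f \<otimes>\<^bsub>G\<^esub> u \<in> \<Union>\<S>}" .
  qed
  then show ?thesis
    unfolding restricted_sum_topology_def P_def G_def by (simp add: topology_inverse')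
qed

definition semidirect_product ::
  "'n monoid \<Rightarrow> 'k monoid \<Rightarrow> ('k \<Rightarrow> 'n \<Rightarrow> 'n) \<Rightarrow> ('n \<times> 'k) monoid" where
  "semidirect_product N K \<theta> =
     \<lparr>carrier = carrier N \<times> carrier K,
      mult = (\<lambda>(a, k) (b, l). (a \<otimes>\<^bsub>N\<^esub> \<theta> k b, k \<otimes>\<^bsub>K\<^esub> l)),
      one = (\<one>\<^bsub>N\<^esub>, \<one>\<^bsub>K\<^esub>)\<rparr>"

text \<open>\<open>(k \<cdot> f)(k.x) = f x\<close>\<close>

definition coordinate_action ::
  "'k monoid \<Rightarrow> 'x set \<Rightarrow> ('k \<Rightarrow> 'x \<Rightarrow> 'x) \<Rightarrow> 'k \<Rightarrow> ('x \<Rightarrow> 'a) \<Rightarrow> 'x \<Rightarrow> 'a" where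
  "coordinate_action K X \<phi> k f = (\<lambda>x\<in>X. f (\<phi> (inv\<^bsub>K\<^esub> k) x))"

definition wreath_product ::
  "'a monoid \<Rightarrow> 'a set \<Rightarrow> 'k monoid \<Rightarrow> 'x set \<Rightarrow> ('k \<Rightarrow> 'x \<Rightarrow> 'x) \<Rightarrow> (('x \<Rightarrow> 'a) \<times> 'k) monoid" where
  "wreath_product L U K X \<phi> =
     semidirect_product (restricted_sum X L U) K (coordinate_action K X \<phi>)"

definition wreath_topology ::
  "'a monoid \<Rightarrow> 'a topology \<Rightarrow> 'a set \<Rightarrow> 'k topology \<Rightarrow> 'x set \<Rightarrow> (('x \<Rightarrow> 'a) \<times> 'k) topology" where
  "wreath_topology L TL U TK X = prod_topology (restricted_sum_topology X L TL U) TK"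

end

theory Submission
  imports Defs
begin

text \<open>
  Write \<open>\<lambda>\<close> and \<open>\<kappa>\<close> for the heights of \<open>L\<close> and \<open>K\<close> in themselves, so that the ranks are
  \<open>\<lambda> + 1\<close> and \<open>\<kappa> + 1\<close>.

  Elementary groups enter only through one property: iterating the passage from a closed subgroup
  to the residual of one of its compactly generated open subgroups always ends at the trivial group.
  This is stable under the operations that generate the class, and it bounds the heights
  because, for \<open>P\<close> closed, compactly generated and normalized by a compact open subgroup of \<open>G\<close>,
  the residual \<open>Res\<^sub>G(P)\<close> lies in the intersection of the open normal subgroups of \<open>P\<close>.
  It also shows that a non-trivial \<open>H\<close> is never contained in \<open>Res\<^sub>G(H)\<close>, so that heights strictly
  decrease along residuals.

  Upper bound: if \<open>H\<close> lies in the base of the wreath product \<open>W\<close>, then \<open>Res\<^sub>W(H)\<close> lies in the base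
  and its coordinates lie in the residuals of the coordinate projections of \<open>H\<close>; all but finitely
  many of these are compact, so the height of \<open>H\<close> is at most \<open>\<lambda>\<close>.  In general the projection to
  \<open>K\<close> respects residuals, and the height of \<open>H\<close> is at most \<open>\<lambda>\<close> plus the height of the closure of
  its projection.

  Lower bound: an open subgroup of \<open>W\<close> contains \<open>U\<close> in almost all coordinates.  If it is
  normalized by \<open>M \<le> K\<close> with infinite orbit \<open>M y\<close> and by the copy of \<open>L\<close> at \<open>y\<close>, it therefore
  contains \<open>U\<close>, hence \<open>\<langle>\<langle>U\<rangle>\<rangle> = L\<close>, at \<open>y\<close>.  Hence replacing each witness \<open>M\<close> by its wreath product
  with \<open>L\<close> over \<open>M y\<close> gives a chain above the copy of \<open>L\<close>.  A closed subgroup of \<open>K\<close> with a finite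
  orbit is compact, so all witnesses except possibly the first have infinite orbits, and the first
  one can be skipped when \<open>\<kappa> > \<omega>\<close>, since \<open>1 + \<kappa> = \<kappa>\<close>.
\<close>

section \<open>Topological groups\<close>

text \<open>Two obstacles shape the proof. Residuals depend on the ambient group: \<open>Res\<close>
  runs over open subgroups of all of \<open>G\<close>, while permanence under subgroups, extensions
  and quotients calls for a residual intrinsic to \<open>P\<close>. The intrinsic version
  \<open>rel_residual\<close> therefore carries a subgroup \<open>N\<close>, so that statements
  about \<open>P/N\<close> become statements about subgroups of one fixed group that contain
  \<open>N\<close>; the core arguments for extensions and quotients stay inside it. Moreover,
  elementary groups are generated inductively, while heights are ordinals tied to an ambient group.
  Hence the induction over the class proves the ordinal-free well-foundedness
  \<open>res_founded\<close>, and ordinals enter only afterwards. They stay countable because the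
  subgroups to be examined at each stage are generated by a fixed compact set and a finite subset of
  a countable set.

  The wreath product is not shown to be elementary. Its levels are computed from the heights of
  \<open>L\<close> and \<open>K\<close>, and the upper bound also yields that its rank is
  well-defined. For this reason the arguments there speak of \<open>res_class\<close> rather than of
  heights.\<close>

lemma (in group) mult_inv_cancel:
  assumes "x \<in> carrier G" "y \<in> carrier G"
  shows "x \<otimes> (inv x \<otimes> y) = y" "inv x \<otimes> (x \<otimes> y) = y"
  using assms by (simp_all flip: m_assoc)

lemmas (in group) word_simps = m_assoc inv_mult_group mult_inv_cancel

lemma set_multI [intro]:
  "x = a \<otimes>\<^bsub>G\<^esub> b \<Longrightarrow> a \<in> A \<Longrightarrow> b \<in> B \<Longrightarrow> x \<in> A <#>\<^bsub>G\<^esub> B"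
  by (auto simp: set_mult_def)

lemma set_multE [elim!]:
  assumes "x \<in> A <#>\<^bsub>G\<^esub> B"
  obtains a b where "a \<in> A" "b \<in> B" "x = a \<otimes>\<^bsub>G\<^esub> b"
  using assms by (auto simp: set_mult_def)

lemma (in group) subset_set_mult:
  assumes "subgroup A G" "subgroup B G"
  shows "A \<subseteq> A <#> B" "B \<subseteq> A <#> B"
proof -
  show "A \<subseteq> A <#> B"
  proof
    fix x assume "x \<in> A"
    then have "x \<otimes> \<one> \<in> A <#> B" using assms by (blast intro: subgroup.one_closed)
    then show "x \<in> A <#> B" using \<open>x \<in> A\<close> assms by (simp add: subgroup.mem_carrier)
  qed
  show "B \<subseteq> A <#> B"
  proof
    fix x assume "x \<in> B"
    then have "\<one> \<otimes> x \<in> A <#> B" using assms by (blast intro: subgroup.one_closed)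
    then show "x \<in> A <#> B" using \<open>x \<in> B\<close> assms by (simp add: subgroup.mem_carrier)
  qed
qed

text \<open>Only one inclusion is demanded. For a subgroup \<open>H\<close> it applies to inverses
  as well and gives the equality required in \<open>Res\<close>; see
  \<open>normalizes_image_eq\<close>.\<close>

definition normalizes :: "('a, 'b) monoid_scheme \<Rightarrow> 'a set \<Rightarrow> 'a set \<Rightarrow> bool" where
  "normalizes G H S \<longleftrightarrow> (\<forall>h\<in>H. \<forall>s\<in>S. h \<otimes>\<^bsub>G\<^esub> s \<otimes>\<^bsub>G\<^esub> inv\<^bsub>G\<^esub> h \<in> S)"

lemma normalizesD: "normalizes G H S \<Longrightarrow> h \<in> H \<Longrightarrow> s \<in> S \<Longrightarrow> h \<otimes>\<^bsub>G\<^esub> s \<otimes>\<^bsub>G\<^esub> inv\<^bsub>G\<^esub> h \<in> S"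
  by (simp add: normalizes_def)

lemma normalizes_mono: "normalizes G H S \<Longrightarrow> H' \<subseteq> H \<Longrightarrow> normalizes G H' S"
  by (auto simp: normalizes_def)

context group
begin

lemma normalizes_self: "subgroup H G \<Longrightarrow> normalizes G H H"
  by (simp add: normalizes_def subgroup.m_closed subgroup.m_inv_closed)

lemma normalizes_Inter: "(\<And>S. S \<in> \<S> \<Longrightarrow> normalizes G H S) \<Longrightarrow> normalizes G H (\<Inter>\<S>)"
  by (auto simp: normalizes_def)

lemma normalizes_Int: "normalizes G H A \<Longrightarrow> normalizes G H B \<Longrightarrow> normalizes G H (A \<inter> B)"
  by (auto simp: normalizes_def)

lemma normalizes_inv:
  assumes "subgroup H G" "normalizes G H S" "h \<in> H" "s \<in> S"
  shows "inv h \<otimes> s \<otimes> h \<in> S"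
proof -
  have "inv h \<in> H" "h \<in> carrier G" using assms by (auto simp: subgroup.m_inv_closed subgroup.mem_carrier)
  then show ?thesis using normalizesD[OF assms(2), of "inv h" s] assms by simp
qed

lemma normalizes_image_eq:
  assumes "subgroup H G" "S \<subseteq> carrier G" "normalizes G H S" "h \<in> H"
  shows "(\<lambda>x. h \<otimes> x \<otimes> inv h) ` S = S"
proof
  show "(\<lambda>x. h \<otimes> x \<otimes> inv h) ` S \<subseteq> S"
    using assms by (auto simp: normalizes_def)
  show "S \<subseteq> (\<lambda>x. h \<otimes> x \<otimes> inv h) ` S"
  proof
    fix s assume s: "s \<in> S"
    have c: "h \<in> carrier G" "s \<in> carrier G" using assms s by (auto simp: subgroup.mem_carrier)
    have "inv h \<otimes> s \<otimes> h \<in> S" using normalizes_inv assms s by blast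
    then show "s \<in> (\<lambda>x. h \<otimes> x \<otimes> inv h) ` S"
      by (rule rev_image_eqI) (use c in \<open>simp add: word_simps\<close>)
  qed
qed

text \<open>The generating set need not be symmetric, hence the two conjugation hypotheses.\<close>

lemma normalizes_generate:
  assumes S: "S \<subseteq> carrier G" and C: "C \<subseteq> carrier G"
    and *: "\<And>c s. c \<in> C \<Longrightarrow> s \<in> S \<Longrightarrow> c \<otimes> s \<otimes> inv c \<in> S"
      "\<And>c s. c \<in> C \<Longrightarrow> s \<in> S \<Longrightarrow> inv c \<otimes> s \<otimes> c \<in> S"
  shows "normalizes G (generate G C) S"
  unfolding normalizes_def
proof
  fix h assume h: "h \<in> generate G C"
  then show "\<forall>s\<in>S. h \<otimes> s \<otimes> inv h \<in> S"
  proof induction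
    case one then show ?case using S by auto
  next
    case (incl h) then show ?case using * by blast
  next
    case (inv h) then show ?case using * C by auto
  next
    case (eng h1 h2)
    have c: "h1 \<in> carrier G" "h2 \<in> carrier G"
      using eng generate_in_carrier[OF C] by auto
    show ?case
    proof
      fix s assume s: "s \<in> S"
      then have "h1 \<otimes> (h2 \<otimes> s \<otimes> inv h2) \<otimes> inv h1 \<in> S" using eng by blast
      moreover have "h1 \<otimes> (h2 \<otimes> s \<otimes> inv h2) \<otimes> inv h1 = h1 \<otimes> h2 \<otimes> s \<otimes> inv (h1 \<otimes> h2)"
        using c s S by (auto simp add: word_simps subset_iff)
      ultimately show "h1 \<otimes> h2 \<otimes> s \<otimes> inv (h1 \<otimes> h2) \<in> S" by simp
    qed
  qed
qed

lemma subgroup_mult_set: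
  assumes A: "subgroup A G" and B: "subgroup B G" and n: "normalizes G A B"
  shows "subgroup (A <#> B) G"
proof (rule subgroupI)
  note c = subgroup.mem_carrier[OF A] subgroup.mem_carrier[OF B]
  show "A <#> B \<subseteq> carrier G" using c by auto
  show "A <#> B \<noteq> {}"
    using subgroup.one_closed[OF A] subgroup.one_closed[OF B] by auto
  fix x assume "x \<in> A <#> B"
  then obtain a b where x: "x = a \<otimes> b" "a \<in> A" "b \<in> B" by auto
  have "inv x = inv a \<otimes> (a \<otimes> inv b \<otimes> inv a)"
    using x c by (simp add: word_simps)
  moreover have "a \<otimes> inv b \<otimes> inv a \<in> B"
    using normalizesD[OF n x(2)] subgroup.m_inv_closed[OF B x(3)] by blast
  ultimately show "inv x \<in> A <#> B"
    using subgroup.m_inv_closed[OF A x(2)] by blast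
  fix y assume "y \<in> A <#> B"
  then obtain a' b' where y: "y = a' \<otimes> b'" "a' \<in> A" "b' \<in> B" by auto
  have "x \<otimes> y = (a \<otimes> a') \<otimes> ((inv a' \<otimes> b \<otimes> a') \<otimes> b')"
    using x y c by (simp add: word_simps)
  moreover have "(inv a' \<otimes> b \<otimes> a') \<otimes> b' \<in> B"
    using normalizes_inv[OF A n y(2) x(3)] y B by (simp add: subgroup.m_closed)
  ultimately show "x \<otimes> y \<in> A <#> B"
    using subgroup.m_closed[OF A x(2) y(2)] by blast
qed

end

lemma (in group_hom) subgroup_preimage:
  assumes "subgroup Q H"
  shows "subgroup {x \<in> carrier G. h x \<in> Q} G"
proof (rule G.subgroupI)
  show "{x \<in> carrier G. h x \<in> Q} \<noteq> {}"
    using subgroup.one_closed[OF assms] by (auto intro!: exI[of _ "\<one>"])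
qed (use assms in \<open>auto simp: subgroup.m_closed subgroup.m_inv_closed\<close>)

section \<open>Neighbourhoods, cosets and closures in a topological group\<close>

locale topgrp = group G for G (structure) +
  fixes T
  assumes topspace_eq: "topspace T = carrier G"
    and mult_cont: "continuous_map (prod_topology T T) T (\<lambda>(x, y). x \<otimes> y)"
    and inv_cont: "continuous_map T T (\<lambda>x. inv x)"

lemma topological_group_iff_topgrp: "topological_group G T \<longleftrightarrow> topgrp G T"
  by (auto simp: topological_group_def topgrp_def topgrp_axioms_def)

context topgrp
begin

lemma openin_carrier: "openin T V \<Longrightarrow> V \<subseteq> carrier G"
  using openin_subset topspace_eq by blast

lemma closedin_carrier: "closedin T V \<Longrightarrow> V \<subseteq> carrier G"
  using closedin_subset topspace_eq by blast

lemma compactin_carrier: "compactin T V \<Longrightarrow> V \<subseteq> carrier G"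
  using compactin_subset_topspace topspace_eq by blast

lemma continuous_map_mult:
  assumes "continuous_map Z T f" "continuous_map Z T g"
  shows "continuous_map Z T (\<lambda>z. f z \<otimes> g z)"
  using continuous_map_compose[OF continuous_map_pairedI[OF assms] mult_cont] by (simp add: o_def)

lemma continuous_map_inv:
  assumes "continuous_map Z T f"
  shows "continuous_map Z T (\<lambda>z. inv (f z))"
  using continuous_map_compose[OF assms inv_cont] by (simp add: o_def)

lemma continuous_map_lmult: "g \<in> carrier G \<Longrightarrow> continuous_map T T (\<lambda>x. g \<otimes> x)"
  by (intro continuous_map_mult) (auto simp: topspace_eq)

lemma openin_lcoset:
  assumes "openin T V" "g \<in> carrier G"
  shows "openin T {x \<in> carrier G. inv g \<otimes> x \<in> V}"
  using openin_continuous_map_preimage[OF continuous_map_lmult[of "inv g"] assms(1)] assms(2)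
  by (simp add: topspace_eq)

lemma openin_mult_right:
  assumes A: "A \<subseteq> carrier G" and V: "openin T V"
  shows "openin T (A <#> V)"
proof -
  have "A <#> V = (\<Union>a\<in>A. {x \<in> carrier G. inv a \<otimes> x \<in> V})"
  proof (intro Set.equalityI subsetI)
    fix x assume "x \<in> A <#> V"
    then obtain a v where "x = a \<otimes> v" "a \<in> A" "v \<in> V" by auto
    moreover have "a \<in> carrier G" "v \<in> carrier G" using calculation A openin_carrier[OF V] by auto
    ultimately show "x \<in> (\<Union>a\<in>A. {x \<in> carrier G. inv a \<otimes> x \<in> V})"
      by (auto simp: word_simps intro!: bexI[of _ a])
  next
    fix x assume "x \<in> (\<Union>a\<in>A. {x \<in> carrier G. inv a \<otimes> x \<in> V})"
    then obtain a where a: "a \<in> A" "x \<in> carrier G" "inv a \<otimes> x \<in> V" by auto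
    moreover have "a \<otimes> (inv a \<otimes> x) = x" using a A by (auto simp: word_simps)
    ultimately show "x \<in> A <#> V" by force
  qed
  moreover have "openin T (\<Union>a\<in>A. {x \<in> carrier G. inv a \<otimes> x \<in> V})"
    using A openin_lcoset[OF V] by blast
  ultimately show ?thesis by simp
qed

lemma subgroup_openin:
  assumes H: "subgroup H G" and V: "openin T V" "\<one> \<in> V" "V \<subseteq> H"
  shows "openin T H"
proof (subst openin_subopen, intro ballI)
  fix h assume h: "h \<in> H"
  have hc: "h \<in> carrier G" using subgroup.mem_carrier[OF H h] .
  show "\<exists>W. openin T W \<and> h \<in> W \<and> W \<subseteq> H"
  proof (intro exI conjI)
    show "openin T {x \<in> carrier G. inv h \<otimes> x \<in> V}" by (rule openin_lcoset[OF V(1) hc])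
    show "h \<in> {x \<in> carrier G. inv h \<otimes> x \<in> V}" using hc V by simp
    show "{x \<in> carrier G. inv h \<otimes> x \<in> V} \<subseteq> H"
    proof clarify
      fix x assume x: "x \<in> carrier G" "inv h \<otimes> x \<in> V"
      then have "h \<otimes> (inv h \<otimes> x) \<in> H" using V H h by (meson subgroup.m_closed subsetD)
      then show "x \<in> H" using x hc by (simp add: word_simps)
    qed
  qed
qed

lemma open_subgroup_closedin:
  assumes H: "subgroup H G" "openin T H"
  shows "closedin T H"
proof -
  have "carrier G - H = (\<Union>g\<in>carrier G - H. {x \<in> carrier G. inv g \<otimes> x \<in> H})"
  proof (intro Set.equalityI subsetI)
    fix x assume "x \<in> carrier G - H"
    then show "x \<in> (\<Union>g\<in>carrier G - H. {x \<in> carrier G. inv g \<otimes> x \<in> H})"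
      using subgroup.one_closed[OF H(1)] by (intro UN_I[of x]) auto
  next
    fix x assume "x \<in> (\<Union>g\<in>carrier G - H. {x \<in> carrier G. inv g \<otimes> x \<in> H})"
    then obtain g where g: "g \<in> carrier G" "g \<notin> H" "x \<in> carrier G" "inv g \<otimes> x \<in> H" by auto
    have "x \<notin> H"
    proof
      assume "x \<in> H"
      then have "x \<otimes> inv (inv g \<otimes> x) \<in> H" using g H by (simp add: subgroup.m_closed subgroup.m_inv_closed)
      then show False using g by (simp add: word_simps)
    qed
    then show "x \<in> carrier G - H" using g by simp
  qed
  moreover have "openin T (\<Union>g\<in>carrier G - H. {x \<in> carrier G. inv g \<otimes> x \<in> H})"
    using openin_lcoset[OF H(2)] by blast
  ultimately show ?thesis
    unfolding closedin_def topspace_eq using subgroup.subset[OF H(1)] by simp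
qed

text \<open>The tube lemma, applied to \<open>C \<times> {\<one>}\<close> inside the preimage of
  \<open>V\<close> under conjugation.\<close>

lemma openin_conj_nhd:
  assumes C: "compactin T C" and V: "openin T V" "\<one> \<in> V"
  obtains W where "openin T W" "\<one> \<in> W" "\<And>c w. c \<in> C \<Longrightarrow> w \<in> W \<Longrightarrow> c \<otimes> w \<otimes> inv c \<in> V"
proof -
  have "continuous_map (prod_topology T T) T (\<lambda>z. fst z \<otimes> snd z \<otimes> inv (fst z))"
    by (intro continuous_map_mult continuous_map_inv continuous_map_fst continuous_map_snd)
  then have o: "openin (prod_topology T T)
      {z \<in> topspace (prod_topology T T). fst z \<otimes> snd z \<otimes> inv (fst z) \<in> V}"
    using V(1) by (rule openin_continuous_map_preimage)
  have one: "compactin T {\<one>}" by (simp add: topspace_eq)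
  have sub: "C \<times> {\<one>} \<subseteq> {z \<in> topspace (prod_topology T T). fst z \<otimes> snd z \<otimes> inv (fst z) \<in> V}"
    using compactin_carrier[OF C] V(2) by (auto simp: topspace_eq)
  obtain A B where AB: "openin T A" "openin T B" "C \<subseteq> A" "{\<one>} \<subseteq> B"
    "A \<times> B \<subseteq> {z \<in> topspace (prod_topology T T). fst z \<otimes> snd z \<otimes> inv (fst z) \<in> V}"
    by (rule Wallace_theorem_prod_topology[OF C one o sub])
  have "c \<otimes> w \<otimes> inv c \<in> V" if "c \<in> C" "w \<in> B" for c w
  proof -
    have "(c, w) \<in> A \<times> B" using that AB(3) by blast
    then show ?thesis using AB(5) by auto
  qed
  then show ?thesis
    using that AB by blast
qed

abbreviation cl :: "'a set \<Rightarrow> 'a set" where "cl \<equiv> Abstract_Topology.closure_of T"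

lemma closure_of_subgroup:
  assumes H: "subgroup H G"
  shows "subgroup (cl H) G"
proof (rule subgroupI)
  show "cl H \<subseteq> carrier G" using closure_of_subset_topspace topspace_eq by metis
  have sub: "H \<subseteq> cl H" using closure_of_subset subgroup.subset[OF H] topspace_eq by metis
  then show "cl H \<noteq> {}" using subgroup.one_closed[OF H] by blast
  fix x assume x: "x \<in> cl H"
  have "(\<lambda>x. inv x) ` (cl H) \<subseteq> cl ((\<lambda>x. inv x) ` H)"
    using inv_cont by (simp add: continuous_map_image_closure_subset)
  moreover have "(\<lambda>x. inv x) ` H \<subseteq> H" using subgroup.m_inv_closed[OF H] by auto
  ultimately show "inv x \<in> cl H" using x closure_of_mono by blast
  fix y assume y: "y \<in> cl H"
  have "(\<lambda>(x, y). x \<otimes> y) ` (Abstract_Topology.closure_of (prod_topology T T) (H \<times> H)) \<subseteq> cl ((\<lambda>(x, y). x \<otimes> y) ` (H \<times> H))"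
    using mult_cont by (rule continuous_map_image_closure_subset)
  moreover have "(\<lambda>(x, y). x \<otimes> y) ` (H \<times> H) \<subseteq> H" using subgroup.m_closed[OF H] by auto
  ultimately have "(\<lambda>(x, y). x \<otimes> y) ` (Abstract_Topology.closure_of (prod_topology T T) (H \<times> H)) \<subseteq> cl H"
    using closure_of_mono by blast
  then show "x \<otimes> y \<in> cl H"
    using x y by (force simp: closure_of_Times)
qed

lemma closure_of_mult_nhd:
  assumes x: "x \<in> cl A" and V: "openin T V" "\<one> \<in> V"
  obtains a where "a \<in> A" "a \<in> carrier G" "inv x \<otimes> a \<in> V"
proof -
  have xc: "x \<in> carrier G" using x by (simp add: in_closure_of topspace_eq)
  have "openin T {y \<in> carrier G. inv x \<otimes> y \<in> V}" by (rule openin_lcoset[OF V(1) xc])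
  moreover have "x \<in> {y \<in> carrier G. inv x \<otimes> y \<in> V}" using xc V by simp
  ultimately obtain a where "a \<in> A" "a \<in> {y \<in> carrier G. inv x \<otimes> y \<in> V}"
    using x by (meson in_closure_of)
  then show ?thesis using that by auto
qed

end

section \<open>Compact open subgroups\<close>

definition compact_open_subgroup :: "'a monoid \<Rightarrow> 'a topology \<Rightarrow> 'a set \<Rightarrow> bool" where
  "compact_open_subgroup G T V \<longleftrightarrow> subgroup V G \<and> openin T V \<and> compactin T V"

text \<open>Local compactness and total disconnectedness are packed into \<open>cos_basis\<close>,
  the form in which they are applied.\<close>

locale tdlc_grp = topgrp +
  assumes hausdorff: "Hausdorff_space T"
    and second_count: "second_countable T"
    and cos_basis: "openin T W \<Longrightarrow> \<one> \<in> W \<Longrightarrow> \<exists>V. compact_open_subgroup G T V \<and> V \<subseteq> W"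

text \<open>Van Dantzig's theorem.\<close>

lemma tdlcsc_group_imp_tdlc_grp:
  assumes "tdlcsc_group G T"
  shows "tdlc_grp G T"
proof -
  interpret topgrp G T
    using assms by (simp add: tdlcsc_group_def topological_group_iff_topgrp)
  have h: "Hausdorff_space T" and td: "totally_disconnected_space T"
    and lc: "locally_compact_space T" and sc: "second_countable T"
    using assms by (auto simp: tdlcsc_group_def)
  have "\<exists>V. compact_open_subgroup G T V \<and> V \<subseteq> W" if W: "openin T W" "\<one>\<^bsub>G\<^esub> \<in> W" for W
  proof -
    obtain N L where N: "openin T N" "compactin T L" "\<one>\<^bsub>G\<^esub> \<in> N" "N \<subseteq> L"
      using lc topspace_eq unfolding locally_compact_space_def by (metis one_closed)
    have conn: "connected_component_of_set T \<one>\<^bsub>G\<^esub> = {\<one>\<^bsub>G\<^esub>}"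
    proof -
      obtain a where "connected_component_of_set T \<one>\<^bsub>G\<^esub> \<subseteq> {a}"
        using td connectedin_connected_component_of unfolding totally_disconnected_space_def by metis
      moreover have "\<one>\<^bsub>G\<^esub> \<in> connected_component_of_set T \<one>\<^bsub>G\<^esub>"
        by (simp add: connected_component_of_refl topspace_eq)
      ultimately show ?thesis by blast
    qed
    then have "{\<one>\<^bsub>G\<^esub>} \<in> connected_components_of T"
      unfolding connected_components_of_def using topspace_eq one_closed by (metis image_eqI)
    \<comment> \<open>In a locally compact Hausdorff space a compact component, here a single point,
      has arbitrarily small clopen neighbourhoods.\<close>
    then obtain U U' where U: "openin T U" "openin T U'" "disjnt U U'" "U \<union> U' = topspace T"
      "{\<one>\<^bsub>G\<^esub>} \<subseteq> U" "U \<subseteq> W \<inter> N"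
      using wilder_locally_compact_component_thm[OF lc h, of "{\<one>\<^bsub>G\<^esub>}" "W \<inter> N"] W N
      by (auto simp: openin_Int topspace_eq)
    have "U = topspace T - U'" using U by (auto simp: disjnt_iff)
    then have Uc: "closedin T U" using U(2) by (metis closedin_diff closedin_topspace)
    have Uk: "compactin T U" using closed_compactin[OF N(2) _ Uc] U N by blast
    \<comment> \<open>The right stabilizer of the compact open set \<open>U\<close>. It lies in
      \<open>U\<close> because the identity does, and it is open by the tube lemma around
      \<open>U \<times> {\<one>}\<close>.\<close>
    define H where "H = {h \<in> carrier G. \<forall>u\<in>U. u \<otimes>\<^bsub>G\<^esub> h \<in> U \<and> u \<otimes>\<^bsub>G\<^esub> inv\<^bsub>G\<^esub> h \<in> U}"
    have Ucar: "U \<subseteq> carrier G" using openin_carrier U by blast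
    have H: "subgroup H G"
    proof (rule subgroupI)
      show "H \<noteq> {}" using Ucar by (auto simp: H_def intro!: exI[of _ "\<one>\<^bsub>G\<^esub>"])
      fix a b assume a: "a \<in> H" and b: "b \<in> H"
      show "a \<otimes>\<^bsub>G\<^esub> b \<in> H" using a b Ucar unfolding H_def
        by (auto simp: inv_mult_group simp flip: m_assoc)
    qed (use Ucar in \<open>auto simp: H_def\<close>)
    have one: "compactin T {\<one>\<^bsub>G\<^esub>}" by (simp add: topspace_eq)
    have o: "openin (prod_topology T T) {z \<in> topspace (prod_topology T T). (\<lambda>(x, y). x \<otimes>\<^bsub>G\<^esub> y) z \<in> U}"
      using mult_cont U(1) by (rule openin_continuous_map_preimage)
    have "U \<times> {\<one>\<^bsub>G\<^esub>} \<subseteq> {z \<in> topspace (prod_topology T T). (\<lambda>(x, y). x \<otimes>\<^bsub>G\<^esub> y) z \<in> U}"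
      using Ucar by (auto simp: topspace_eq)
    then obtain A B where AB: "openin T A" "openin T B" "U \<subseteq> A" "{\<one>\<^bsub>G\<^esub>} \<subseteq> B"
      "A \<times> B \<subseteq> {z \<in> topspace (prod_topology T T). (\<lambda>(x, y). x \<otimes>\<^bsub>G\<^esub> y) z \<in> U}"
      by (rule Wallace_theorem_prod_topology[OF Uk one o])
    define B' where "B' = B \<inter> {x \<in> topspace T. inv\<^bsub>G\<^esub> x \<in> B}"
    have "openin T B'" unfolding B'_def
      using AB openin_continuous_map_preimage[OF inv_cont] by blast
    moreover have "\<one>\<^bsub>G\<^esub> \<in> B'" using AB by (simp add: B'_def topspace_eq)
    moreover have "B' \<subseteq> H" using AB openin_carrier[OF AB(2)] by (fastforce simp: B'_def H_def)
    ultimately have Ho: "openin T H" using subgroup_openin[OF H] by blast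
    have "H \<subseteq> U"
    proof
      fix h assume "h \<in> H"
      then have "h \<in> carrier G" "\<one>\<^bsub>G\<^esub> \<otimes>\<^bsub>G\<^esub> h \<in> U" using U by (auto simp: H_def)
      then show "h \<in> U" by simp
    qed
    then have "compactin T H" using closed_compactin[OF Uk _ open_subgroup_closedin[OF H Ho]] by blast
    then show ?thesis using H Ho \<open>H \<subseteq> U\<close> U unfolding compact_open_subgroup_def by blast
  qed
  then show ?thesis by unfold_locales (auto intro: h sc)
qed

section \<open>Relative residuals\<close>

context tdlc_grp
begin

abbreviation "COS \<equiv> compact_open_subgroup G T"

lemma cosD:
  assumes "COS V"
  shows "subgroup V G" "openin T V" "compactin T V" "V \<subseteq> carrier G" "\<one> \<in> V"
  using assms by (auto simp: compact_open_subgroup_def subgroup.one_closed dest: subgroup.mem_carrier)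

lemma compactin_closedin: "compactin T C \<Longrightarrow> closedin T C"
  using hausdorff compactin_imp_closedin by blast

lemma compactin_Int_closedin: "compactin T C \<Longrightarrow> closedin T D \<Longrightarrow> compactin T (C \<inter> D)"
  by (rule closed_compactin[of T C]) (auto intro: compactin_closedin)

lemma cos_Int:
  assumes "COS V" "COS W"
  shows "COS (V \<inter> W)"
  using assms cosD(3)[OF assms(1)] compactin_closedin[OF cosD(3)[OF assms(2)]]
  by (auto simp: compact_open_subgroup_def subgroups_Inter_pair compactin_Int_closedin)

lemma cos_ex: "\<exists>V. COS V"
  using cos_basis[OF openin_topspace] topspace_eq by auto

lemma cos_conj:
  assumes C: "compactin T C" and V: "COS V"
  obtains W where "COS W" "W \<subseteq> V"
    "\<And>c w. c \<in> C \<Longrightarrow> w \<in> W \<Longrightarrow> c \<otimes> w \<otimes> inv c \<in> V"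
    "\<And>c w. c \<in> C \<Longrightarrow> w \<in> W \<Longrightarrow> inv c \<otimes> w \<otimes> c \<in> V"
proof -
  have C': "compactin T ((\<lambda>x. inv x) ` C)"
    using image_compactin[OF C inv_cont] .
  obtain W1 where W1: "openin T W1" "\<one> \<in> W1" "\<And>c w. c \<in> C \<Longrightarrow> w \<in> W1 \<Longrightarrow> c \<otimes> w \<otimes> inv c \<in> V"
    using openin_conj_nhd[OF C cosD(2,5)[OF V]] by blast
  obtain W2 where W2: "openin T W2" "\<one> \<in> W2"
    "\<And>c w. c \<in> (\<lambda>x. inv x) ` C \<Longrightarrow> w \<in> W2 \<Longrightarrow> c \<otimes> w \<otimes> inv c \<in> V"
    using openin_conj_nhd[OF C' cosD(2,5)[OF V]] by blast
  obtain W where W: "COS W" "W \<subseteq> W1 \<inter> W2 \<inter> V"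
    using cos_basis[of "W1 \<inter> W2 \<inter> V"] W1 W2 cosD[OF V] by blast
  show ?thesis
  proof (rule that[OF W(1)])
    fix c w assume c: "c \<in> C" and w: "w \<in> W"
    show "c \<otimes> w \<otimes> inv c \<in> V" using W1(3) c w W by blast
    have "inv c \<otimes> w \<otimes> inv (inv c) \<in> V" using W2(3) c w W by blast
    then show "inv c \<otimes> w \<otimes> c \<in> V" using c compactin_carrier[OF C] by auto
  qed (use W in blast)
qed

text \<open>The cosets \<open>x V\<close> by compact open subgroups form a neighbourhood basis of
  \<open>x\<close>, and \<open>x = a v\<close> puts \<open>a\<close> into
  \<open>x V\<close>.\<close>

lemma closedin_cosI:
  assumes A: "closedin T A" and x: "x \<in> carrier G"
    and *: "\<And>V. COS V \<Longrightarrow> \<exists>a\<in>A. \<exists>v\<in>V. x = a \<otimes> v"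
  shows "x \<in> A"
proof -
  have "x \<in> Abstract_Topology.closure_of T A"
    unfolding in_closure_of
  proof (intro conjI allI impI)
    show "x \<in> topspace T" using x topspace_eq by simp
    fix W assume W: "x \<in> W \<and> openin T W"
    have "openin T {y \<in> carrier G. inv (inv x) \<otimes> y \<in> W}"
      by (rule openin_lcoset) (use x W in auto)
    moreover have "\<one> \<in> {y \<in> carrier G. inv (inv x) \<otimes> y \<in> W}" using x W by simp
    ultimately obtain V where V: "COS V" "V \<subseteq> {y \<in> carrier G. inv (inv x) \<otimes> y \<in> W}"
      using cos_basis by blast
    obtain a v where a: "a \<in> A" "v \<in> V" "x = a \<otimes> v" using *[OF V(1)] by blast
    have c: "a \<in> carrier G" "v \<in> carrier G" using a closedin_carrier[OF A] cosD(4)[OF V(1)] by auto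
    have "inv v \<in> V" using subgroup.m_inv_closed[OF cosD(1)[OF V(1)] a(2)] .
    then have "x \<otimes> inv v \<in> W" using V x by auto
    moreover have "x \<otimes> inv v = a" using a c by (simp add: m_assoc)
    ultimately show "\<exists>y. y \<in> A \<and> y \<in> W" using a by auto
  qed
  then show ?thesis using A by (simp add: closure_of_closedin)
qed

lemma compactin_cosets:
  assumes C: "compactin T C" and V: "COS V"
  obtains F where "finite F" "F \<subseteq> C" "\<And>c. c \<in> C \<Longrightarrow> \<exists>f\<in>F. inv f \<otimes> c \<in> V"
proof -
  let ?U = "\<lambda>f. {x \<in> carrier G. inv f \<otimes> x \<in> V}"
  have Cc: "C \<subseteq> carrier G" by (rule compactin_carrier[OF C])
  have "\<forall>U\<in>?U ` C. openin T U" using openin_lcoset[OF cosD(2)[OF V]] Cc by blast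
  moreover have "C \<subseteq> \<Union>(?U ` C)" using Cc cosD(5)[OF V] by force
  ultimately obtain \<F> where \<F>: "finite \<F>" "\<F> \<subseteq> ?U ` C" "C \<subseteq> \<Union>\<F>"
    using C unfolding compactin_def by meson
  obtain F where "finite F" "F \<subseteq> C" "\<F> = ?U ` F"
    using finite_subset_image[OF \<F>(1,2)] by blast
  with \<F>(3) have "finite F" "F \<subseteq> C" "C \<subseteq> \<Union>(?U ` F)" by simp_all
  then show ?thesis by (intro that[of F]) auto
qed

lemma compactin_conj:
  assumes "compactin T V" "compactin T C"
  shows "compactin T {v \<otimes> c \<otimes> inv v |v c. v \<in> V \<and> c \<in> C}"
proof -
  have "continuous_map (prod_topology T T) T (\<lambda>z. fst z \<otimes> snd z \<otimes> inv (fst z))"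
    by (intro continuous_map_mult continuous_map_inv continuous_map_fst continuous_map_snd)
  moreover have "compactin (prod_topology T T) (V \<times> C)" using assms by (simp add: compactin_Times)
  ultimately have "compactin T ((\<lambda>z. fst z \<otimes> snd z \<otimes> inv (fst z)) ` (V \<times> C))"
    by (rule image_compactin[rotated])
  moreover have "(\<lambda>z. fst z \<otimes> snd z \<otimes> inv (fst z)) ` (V \<times> C) = {v \<otimes> c \<otimes> inv v |v c. v \<in> V \<and> c \<in> C}"
    by force
  ultimately show ?thesis by simp
qed

end

text \<open>Openness of \<open>D\<close> in \<open>H\<close> is tested at the identity only, which
  suffices for subgroups. No subspace topologies are formed, so chains of subgroups of one group can
  be compared directly.\<close>

definition rel_open :: "'a monoid \<Rightarrow> 'a topology \<Rightarrow> 'a set \<Rightarrow> 'a set \<Rightarrow> bool" where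
  "rel_open G T D H \<longleftrightarrow> (\<exists>V. compact_open_subgroup G T V \<and> V \<inter> H \<subseteq> D)"

lemma rel_open_mono: "rel_open G T D H \<Longrightarrow> D \<inter> H' \<subseteq> D' \<Longrightarrow> H' \<subseteq> H \<Longrightarrow> rel_open G T D' H'"
  unfolding rel_open_def by blast

text \<open>For \<open>N\<close> normal in \<open>P\<close> this is the preimage of the intersection
  of all open normal subgroups of \<open>P/N\<close>; for \<open>N = {\<one>}\<close> it is the
  discrete residual of \<open>P\<close>, independent of how \<open>P\<close> sits in
  \<open>G\<close> as an abstract subgroup.\<close>

definition rel_residual :: "'a monoid \<Rightarrow> 'a topology \<Rightarrow> 'a set \<Rightarrow> 'a set \<Rightarrow> 'a set" where
  "rel_residual G T N P =
     \<Inter>{D. subgroup D G \<and> N \<subseteq> D \<and> D \<subseteq> P \<and> rel_open G T D P \<and> normalizes G P D}"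

text \<open>For a subgroup \<open>V\<close> this is the intersection of the conjugates of
  \<open>S\<close> by \<open>V\<close>, the largest subset of \<open>S\<close> invariant under
  \<open>V\<close> (within the carrier).\<close>

definition conj_core :: "('a, 'b) monoid_scheme \<Rightarrow> 'a set \<Rightarrow> 'a set \<Rightarrow> 'a set" where
  "conj_core G V S = {x \<in> carrier G. \<forall>v\<in>V. v \<otimes>\<^bsub>G\<^esub> x \<otimes>\<^bsub>G\<^esub> inv\<^bsub>G\<^esub> v \<in> S}"

context group
begin

lemma conj_core_subgroup:
  assumes V: "V \<subseteq> carrier G" and S: "subgroup S G"
  shows "subgroup (conj_core G V S) G"
proof (rule subgroupI)
  have one: "\<one> \<in> conj_core G V S" using V subgroup.one_closed[OF S] by (auto simp: conj_core_def)
  then show "conj_core G V S \<noteq> {}" by blast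
  fix a assume a: "a \<in> conj_core G V S"
  show "inv a \<in> conj_core G V S" unfolding conj_core_def
  proof (intro CollectI conjI ballI)
    fix v assume v: "v \<in> V"
    have c: "v \<in> carrier G" "a \<in> carrier G" using a v V by (auto simp: conj_core_def)
    have "inv (v \<otimes> a \<otimes> inv v) \<in> S" using a v S by (simp add: conj_core_def subgroup.m_inv_closed)
    then show "v \<otimes> inv a \<otimes> inv v \<in> S" using c by (simp add: word_simps)
  qed (use a in \<open>simp add: conj_core_def\<close>)
  fix b assume b: "b \<in> conj_core G V S"
  show "a \<otimes> b \<in> conj_core G V S" unfolding conj_core_def
  proof (intro CollectI conjI ballI)
    fix v assume v: "v \<in> V"
    have c: "v \<in> carrier G" "a \<in> carrier G" "b \<in> carrier G" using a b v V by (auto simp: conj_core_def)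
    have "(v \<otimes> a \<otimes> inv v) \<otimes> (v \<otimes> b \<otimes> inv v) \<in> S"
      using a b v S by (simp add: conj_core_def subgroup.m_closed)
    then show "v \<otimes> (a \<otimes> b) \<otimes> inv v \<in> S" using c by (simp add: word_simps)
  qed (use a b in \<open>simp add: conj_core_def\<close>)
qed (auto simp: conj_core_def)

lemma conj_core_subset:
  assumes "subgroup V G" shows "conj_core G V S \<subseteq> S"
  using subgroup.one_closed[OF assms] by (force simp: conj_core_def)

lemma conj_core_normalizes:
  assumes V: "subgroup V G"
  shows "normalizes G V (conj_core G V S)"
  unfolding normalizes_def
proof (intro ballI)
  fix v x assume v: "v \<in> V" and x: "x \<in> conj_core G V S"
  have c: "v \<in> carrier G" "x \<in> carrier G" using v x V by (auto simp: conj_core_def subgroup.mem_carrier)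
  show "v \<otimes> x \<otimes> inv v \<in> conj_core G V S" unfolding conj_core_def
  proof (intro CollectI conjI ballI)
    fix w assume w: "w \<in> V"
    have "w \<otimes> v \<in> V" using V v w by (simp add: subgroup.m_closed)
    then have "(w \<otimes> v) \<otimes> x \<otimes> inv (w \<otimes> v) \<in> S" using x by (simp add: conj_core_def)
    then show "w \<otimes> (v \<otimes> x \<otimes> inv v) \<otimes> inv w \<in> S"
      using c subgroup.mem_carrier[OF V w] by (simp add: word_simps)
  qed (use c in auto)
qed

text \<open>Conjugating by \<open>p\<close> and then by \<open>v\<close> is the same as conjugating
  by \<open>v\<close> and then by \<open>v p (inv v)\<close>, which lies in \<open>P\<close>
  again.\<close>

lemma conj_core_normalizes_other:
  assumes V: "subgroup V G" and P: "subgroup P G" and n: "normalizes G V P" "normalizes G P S"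
  shows "normalizes G P (conj_core G V S)"
  unfolding normalizes_def
proof (intro ballI)
  fix p x assume p: "p \<in> P" and x: "x \<in> conj_core G V S"
  have c: "p \<in> carrier G" "x \<in> carrier G" using p x P by (auto simp: conj_core_def subgroup.mem_carrier)
  show "p \<otimes> x \<otimes> inv p \<in> conj_core G V S" unfolding conj_core_def
  proof (intro CollectI conjI ballI)
    fix v assume v: "v \<in> V"
    have "v \<otimes> p \<otimes> inv v \<in> P" using normalizesD[OF n(1) v p] .
    moreover have "v \<otimes> x \<otimes> inv v \<in> S" using x v by (simp add: conj_core_def)
    ultimately have "(v \<otimes> p \<otimes> inv v) \<otimes> (v \<otimes> x \<otimes> inv v) \<otimes> inv (v \<otimes> p \<otimes> inv v) \<in> S"
      by (rule normalizesD[OF n(2)])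
    then show "v \<otimes> (p \<otimes> x \<otimes> inv p) \<otimes> inv v \<in> S"
      using c subgroup.mem_carrier[OF V v] by (simp add: word_simps)
  qed (use c in auto)
qed

end

section \<open>Residuals relative to a subgroup and their compact approximations\<close>

context tdlc_grp
begin

lemma rel_open_cos: "COS V \<Longrightarrow> rel_open G T V H"
  unfolding rel_open_def by blast

lemma rel_open_self: "rel_open G T H H"
  using cos_ex unfolding rel_open_def by blast

lemma rel_open_Int: "rel_open G T D H \<Longrightarrow> rel_open G T D' H \<Longrightarrow> rel_open G T (D \<inter> D') H"
proof -
  assume "rel_open G T D H" "rel_open G T D' H"
  then obtain V W where "COS V" "V \<inter> H \<subseteq> D" "COS W" "W \<inter> H \<subseteq> D'" unfolding rel_open_def by blast
  then have "COS (V \<inter> W)" "(V \<inter> W) \<inter> H \<subseteq> D \<inter> D'" using cos_Int by auto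
  then show ?thesis unfolding rel_open_def by blast
qed

lemma rel_open_trans: "rel_open G T D P \<Longrightarrow> rel_open G T P B \<Longrightarrow> rel_open G T D B"
proof -
  assume "rel_open G T D P" "rel_open G T P B"
  then obtain V W where "COS V" "V \<inter> P \<subseteq> D" "COS W" "W \<inter> B \<subseteq> P" unfolding rel_open_def by blast
  then have "COS (V \<inter> W)" "(V \<inter> W) \<inter> B \<subseteq> D" using cos_Int by auto
  then show ?thesis unfolding rel_open_def by blast
qed

lemma rel_open_closedin:
  assumes D: "subgroup D G" "D \<subseteq> H" and H: "subgroup H G" "closedin T H" and o: "rel_open G T D H"
  shows "closedin T D"
proof -
  obtain V where V: "COS V" "V \<inter> H \<subseteq> D" using o unfolding rel_open_def by blast
  have "cl D \<subseteq> D"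
  proof
    fix x assume x: "x \<in> cl D"
    then obtain d where d: "d \<in> D" "d \<in> carrier G" "inv x \<otimes> d \<in> V"
      using closure_of_mult_nhd cosD[OF V(1)] by metis
    have xH: "x \<in> H" using x D H closure_of_minimal by blast
    then have xc: "x \<in> carrier G" using H by (simp add: subgroup.mem_carrier)
    have "inv x \<otimes> d \<in> H" using xH d D H by (meson subgroup.m_closed subgroup.m_inv_closed subsetD)
    then have "inv x \<otimes> d \<in> D" using d V by blast
    then have "d \<otimes> inv (inv x \<otimes> d) \<in> D" using d D by (meson subgroup.m_closed subgroup.m_inv_closed)
    then show "x \<in> D" using xc d by (simp add: word_simps)
  qed
  then show ?thesis using D(1) closure_of_subset_eq topspace_eq subgroup.subset by metis
qed

text \<open>Compactness of \<open>V\<close> gives one neighbourhood that all of \<open>V\<close>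
  conjugates into \<open>V0\<close>, so a possibly infinite intersection of conjugates is still open
  in \<open>H\<close>.\<close>

lemma rel_open_conj_core:
  assumes V: "subgroup V G" "compactin T V" and n: "normalizes G V H" and H: "H \<subseteq> carrier G"
    and S: "rel_open G T S H"
  shows "rel_open G T (conj_core G V S) H"
proof -
  obtain V0 where V0: "COS V0" "V0 \<inter> H \<subseteq> S" using S unfolding rel_open_def by blast
  obtain W where W: "COS W" "\<And>c w. c \<in> V \<Longrightarrow> w \<in> W \<Longrightarrow> c \<otimes> w \<otimes> inv c \<in> V0"
    using cos_conj[OF V(2) V0(1)] by metis
  have "W \<inter> H \<subseteq> conj_core G V S"
    using W V0 n H by (auto simp: conj_core_def dest: normalizesD)
  then show ?thesis using W unfolding rel_open_def by blast
qed

lemma rel_residual_subset: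
  assumes "subgroup P G" "N \<subseteq> P"
  shows "rel_residual G T N P \<subseteq> P"
  using assms rel_open_self normalizes_self unfolding rel_residual_def by blast

lemma rel_residual_least:
  assumes "subgroup D G" "N \<subseteq> D" "D \<subseteq> P" "rel_open G T D P" "normalizes G P D"
  shows "rel_residual G T N P \<subseteq> D"
  using assms unfolding rel_residual_def by blast

lemma rel_residual_contains: "N \<subseteq> rel_residual G T N P"
  unfolding rel_residual_def by blast

lemma rel_residual_subgroup:
  assumes "subgroup P G" "N \<subseteq> P"
  shows "subgroup (rel_residual G T N P) G"
  unfolding rel_residual_def
  by (rule subgroups_Inter) (use assms rel_open_self normalizes_self in blast)+

lemma rel_residual_closedin:
  assumes "subgroup P G" "N \<subseteq> P" "closedin T P"
  shows "closedin T (rel_residual G T N P)"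
  unfolding rel_residual_def
  by (rule closedin_Inter) (use assms rel_open_self normalizes_self rel_open_closedin in blast)+

lemma rel_residual_normalizes: "normalizes G P (rel_residual G T N P)"
  unfolding rel_residual_def by (rule normalizes_Inter) blast

text \<open>Conjugation by \<open>v\<close> permutes the family whose intersection is the residual:
  \<open>D'\<close> is the conjugate of \<open>D\<close> by \<open>inv v\<close>, and it is again a
  member.\<close>

lemma rel_residual_normalizes_other:
  assumes V: "subgroup V G" and P: "subgroup P G" and n: "normalizes G V P" "normalizes G V N"
    and N: "N \<subseteq> P"
  shows "normalizes G V (rel_residual G T N P)"
  unfolding normalizes_def
proof (intro ballI)
  fix v x assume v: "v \<in> V" and x: "x \<in> rel_residual G T N P"
  have vc: "v \<in> carrier G" using v V by (simp add: subgroup.mem_carrier)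
  show "v \<otimes> x \<otimes> inv v \<in> rel_residual G T N P"
    unfolding rel_residual_def
  proof clarify
    fix D assume D: "subgroup D G" "N \<subseteq> D" "D \<subseteq> P" "rel_open G T D P" "normalizes G P D"
    define D' where "D' = conj_core G {v} D"
    have D'iff: "y \<in> D' \<longleftrightarrow> y \<in> carrier G \<and> v \<otimes> y \<otimes> inv v \<in> D" for y
      by (simp add: D'_def conj_core_def)
    have "rel_residual G T N P \<subseteq> D'"
    proof (rule rel_residual_least)
      show "subgroup D' G" unfolding D'_def by (rule conj_core_subgroup) (use vc D in auto)
      show "N \<subseteq> D'"
      proof
        fix x assume x: "x \<in> N"
        then show "x \<in> D'"
          using D N P normalizesD[OF n(2) v x] subgroup.subset[OF P] by (auto simp: D'iff)
      qed
      show "D' \<subseteq> P"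
      proof
        fix y assume y: "y \<in> D'"
        then have "inv v \<otimes> (v \<otimes> y \<otimes> inv v) \<otimes> v \<in> P"
          using normalizes_inv[OF V n(1) v] D by (auto simp: D'iff)
        then show "y \<in> P" using y vc by (simp add: D'iff word_simps)
      qed
      obtain V0 where V0: "COS V0" "V0 \<inter> P \<subseteq> D" using D unfolding rel_open_def by blast
      have "compactin T {v}" using vc topspace_eq by simp
      then obtain W where W: "COS W" "\<And>c w. c \<in> {v} \<Longrightarrow> w \<in> W \<Longrightarrow> c \<otimes> w \<otimes> inv c \<in> V0"
        using cos_conj[OF _ V0(1)] by metis
      have "W \<inter> P \<subseteq> D'"
      proof
        fix x assume x: "x \<in> W \<inter> P"
        then have "v \<otimes> x \<otimes> inv v \<in> V0 \<inter> P" using W(2)[of v x] normalizesD[OF n(1) v] by blast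
        then show "x \<in> D'" using x V0 cosD(4)[OF W(1)] by (auto simp: D'iff)
      qed
      then show "rel_open G T D' P" using W unfolding rel_open_def by blast
      show "normalizes G P D'" unfolding normalizes_def
      proof (intro ballI)
        fix p y assume p: "p \<in> P" and y: "y \<in> D'"
        have c: "p \<in> carrier G" "y \<in> carrier G" using p y P by (auto simp: D'iff subgroup.mem_carrier)
        have "(v \<otimes> p \<otimes> inv v) \<otimes> (v \<otimes> y \<otimes> inv v) \<otimes> inv (v \<otimes> p \<otimes> inv v) \<in> D"
          using normalizesD[OF D(5) normalizesD[OF n(1) v p]] y by (simp add: D'iff)
        then show "p \<otimes> y \<otimes> inv p \<in> D'" using c vc by (simp add: D'iff word_simps)
      qed
    qed
    then show "v \<otimes> x \<otimes> inv v \<in> D" using x by (auto simp: D'iff)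
  qed
qed

text \<open>
  A relative form of a theorem of Caprace and Monod: a residually discrete compactly generated group
  has arbitrarily small compact open normal subgroups.  If \<open>D\<close> is a member of the filtered family
  defining the residual that meets \<open>V\<close> inside \<open>R W\<close>, where \<open>W\<close> is so small that conjugation by the
  generators maps it into \<open>V\<close>, then \<open>(D \<inter> V) R\<close> is normal.
\<close>

lemma rel_residual_compact_approx:
  assumes P: "subgroup P G" "closedin T P" and C: "compactin T C" "P = generate G C"
    and V: "subgroup V G" "V \<subseteq> P" "compactin T V" "rel_open G T V P"
  obtains Q where "subgroup Q G" "Q \<subseteq> V <#> rel_residual G T {\<one>} P"
    "rel_open G T Q P" "normalizes G P Q"
proof -
  define R where "R = rel_residual G T {\<one>} P"
  have one: "{\<one>} \<subseteq> P" using P by (simp add: subgroup.one_closed)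
  have R: "subgroup R G" "R \<subseteq> P" "normalizes G P R"
    unfolding R_def using rel_residual_subgroup[OF P(1) one] rel_residual_subset[OF P(1) one]
      rel_residual_normalizes by auto
  have CP: "C \<subseteq> P" using C by (auto intro: generate.incl)
  have Pc: "P \<subseteq> carrier G" using P by (simp add: subgroup.subset)
  obtain V0 where V0: "COS V0" "V0 \<inter> P \<subseteq> V" using V unfolding rel_open_def by blast
  obtain W where W: "COS W" "W \<subseteq> V0"
    "\<And>c w. c \<in> C \<Longrightarrow> w \<in> W \<Longrightarrow> c \<otimes> w \<otimes> inv c \<in> V0"
    "\<And>c w. c \<in> C \<Longrightarrow> w \<in> W \<Longrightarrow> inv c \<otimes> w \<otimes> c \<in> V0"
    using cos_conj[OF C(1) V0(1)] by metis
  define \<D> where "\<D> = {D. subgroup D G \<and> {\<one>} \<subseteq> D \<and> D \<subseteq> P \<and> rel_open G T D P \<and> normalizes G P D}"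
  define RW where "RW = R <#> W"
  have RWo: "openin T RW" unfolding RW_def
    by (rule openin_mult_right) (use R Pc cosD[OF W(1)] in auto)
  \<comment> \<open>No point of this compact set lies in every member of \<open>\<D>\<close>, so
    finitely many members already have no common point there. As \<open>\<D>\<close> is closed under
    intersection, a single \<open>D\<close> with \<open>D \<inter> V \<subseteq> RW\<close>
    results.\<close>
  have "compactin T (V \<inter> (topspace T - RW))"
    by (rule compactin_Int_closedin[OF V(3)]) (use RWo in blast)
  moreover have "\<forall>U\<in>(\<lambda>D. topspace T - D) ` \<D>. openin T U"
    using rel_open_closedin[OF _ _ P] by (auto simp: \<D>_def)
  moreover have "V \<inter> (topspace T - RW) \<subseteq> \<Union>((\<lambda>D. topspace T - D) ` \<D>)"
  proof
    fix e assume e: "e \<in> V \<inter> (topspace T - RW)"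
    have "e \<notin> R"
    proof
      assume "e \<in> R"
      then have "e \<otimes> \<one> \<in> RW" unfolding RW_def using cosD(5)[OF W(1)] by blast
      then show False using e topspace_eq by simp
    qed
    then show "e \<in> \<Union>((\<lambda>D. topspace T - D) ` \<D>)"
      using e by (auto simp: R_def rel_residual_def \<D>_def)
  qed
  ultimately obtain \<F> where \<F>: "finite \<F>" "\<F> \<subseteq> (\<lambda>D. topspace T - D) ` \<D>" "V \<inter> (topspace T - RW) \<subseteq> \<Union>\<F>"
    unfolding compactin_def by meson
  obtain \<E> where \<E>': "finite \<E>" "\<E> \<subseteq> \<D>" "\<F> = (\<lambda>D. topspace T - D) ` \<E>"
    using finite_subset_image[OF \<F>(1,2)] by blast
  with \<F>(3) have \<E>: "finite \<E>" "\<E> \<subseteq> \<D>" "V \<inter> (topspace T - RW) \<subseteq> \<Union>((\<lambda>D. topspace T - D) ` \<E>)"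
    by simp_all
  have PD: "P \<in> \<D>" unfolding \<D>_def using P one rel_open_self normalizes_self by blast
  have IntD: "A \<inter> B \<in> \<D>" if "A \<in> \<D>" "B \<in> \<D>" for A B
    using that unfolding \<D>_def by (auto intro: rel_open_Int normalizes_Int subgroups_Inter_pair)
  have "\<exists>D0\<in>\<D>. D0 \<subseteq> \<Inter>\<E>"
    using \<E>(1,2)
  proof (induction rule: finite_induct)
    case empty then show ?case using PD by auto
  next
    case (insert A \<E>)
    then obtain D0 where "D0 \<in> \<D>" "D0 \<subseteq> \<Inter>\<E>" by auto
    then show ?case using IntD[of A D0] insert by (intro bexI[of _ "A \<inter> D0"]) auto
  qed
  then obtain D where D: "D \<in> \<D>" "D \<subseteq> \<Inter>\<E>" by blast
  have Dp: "subgroup D G" "D \<subseteq> P" "rel_open G T D P" "normalizes G P D"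
    using D(1) by (auto simp: \<D>_def)
  have RD: "R \<subseteq> D" unfolding R_def using D by (auto simp: rel_residual_def \<D>_def)
  have DV: "D \<inter> V \<subseteq> RW"
  proof
    fix x assume x: "x \<in> D \<inter> V"
    show "x \<in> RW"
    proof (rule ccontr)
      assume "x \<notin> RW"
      then have "x \<in> \<Union>((\<lambda>D. topspace T - D) ` \<E>)" using x \<E>(3) Dp Pc topspace_eq by blast
      then show False using x D by blast
    qed
  qed
  define Q where "Q = (D \<inter> V) <#> R"
  have DVs: "subgroup (D \<inter> V) G" using Dp V by (simp add: subgroups_Inter_pair)
  have Q: "subgroup Q G" unfolding Q_def
  proof (rule subgroup_mult_set[OF DVs R(1)])
    show "normalizes G (D \<inter> V) R" using normalizes_mono[OF R(3)] Dp by blast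
  qed
  \<comment> \<open>Write \<open>q = s w r\<close> with \<open>s\<close>, \<open>r\<close> in
    \<open>R\<close> and \<open>w\<close> in \<open>W\<close>. The conjugate of \<open>w\<close>
    lies in \<open>V0\<close> by the hypothesis on \<open>g\<close>, and in \<open>D\<close> because
    \<open>w = inv s \<otimes> v\<close> does; the conjugates of \<open>s\<close> and
    \<open>r\<close> stay in \<open>R\<close>, and \<open>s\<close> can be moved to the right past
    \<open>v1\<close>.\<close>
  have key: "g \<otimes> q \<otimes> inv g \<in> Q" if g: "g \<in> P" "\<And>w. w \<in> W \<Longrightarrow> g \<otimes> w \<otimes> inv g \<in> V0" and q: "q \<in> Q" for g q
  proof -
    obtain v r where q: "q = v \<otimes> r" "v \<in> D \<inter> V" "r \<in> R" using q by (auto simp: Q_def)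
    obtain s w where v: "v = s \<otimes> w" "s \<in> R" "w \<in> W" using DV q(2) by (auto simp: RW_def)
    have c: "g \<in> carrier G" "s \<in> carrier G" "w \<in> carrier G" "r \<in> carrier G"
      using g v q R Pc cosD(4)[OF W(1)] by auto
    have "inv s \<otimes> v \<in> D" using q(2) v(2) RD Dp(1) by (blast intro: subgroup.m_closed subgroup.m_inv_closed)
    then have wD: "w \<in> D" using v c by (simp add: word_simps)
    define v1 where "v1 = g \<otimes> w \<otimes> inv g"
    have v1D: "v1 \<in> D" unfolding v1_def using normalizesD[OF Dp(4) g(1) wD] .
    then have v1: "v1 \<in> D \<inter> V" using g(2)[OF v(3)] V0 Dp unfolding v1_def by blast
    have v1P: "v1 \<in> P" using v1D Dp by blast
    have r1: "g \<otimes> s \<otimes> inv g \<in> R" "g \<otimes> r \<otimes> inv g \<in> R" using normalizesD[OF R(3) g(1)] v q by auto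
    have r2: "inv v1 \<otimes> (g \<otimes> s \<otimes> inv g) \<otimes> v1 \<in> R"
      by (rule normalizes_inv[OF P(1) R(3) v1P r1(1)])
    have v1c: "v1 \<in> carrier G" using v1P Pc by blast
    have "g \<otimes> q \<otimes> inv g = (g \<otimes> s \<otimes> inv g) \<otimes> v1 \<otimes> (g \<otimes> r \<otimes> inv g)"
      unfolding q v v1_def using c by (simp add: word_simps)
    also have "\<dots> = v1 \<otimes> ((inv v1 \<otimes> (g \<otimes> s \<otimes> inv g) \<otimes> v1) \<otimes> (g \<otimes> r \<otimes> inv g))"
      using c v1c by (simp add: word_simps)
    also have "\<dots> \<in> Q" unfolding Q_def using v1 subgroup.m_closed[OF R(1) r2 r1(2)] by blast
    finally show ?thesis .
  qed
  have Cc: "C \<subseteq> carrier G" using CP Pc by blast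
  have "normalizes G P Q" unfolding C(2)
  proof (rule normalizes_generate)
    show "Q \<subseteq> carrier G" "C \<subseteq> carrier G" using Q Cc by (auto simp: subgroup.mem_carrier)
    fix c q assume c: "c \<in> C" "q \<in> Q"
    show "c \<otimes> q \<otimes> inv c \<in> Q" by (rule key) (use c CP W in auto)
    have "inv c \<otimes> q \<otimes> inv (inv c) \<in> Q"
      by (rule key) (use c CP W Cc P in \<open>auto simp: subgroup.m_inv_closed\<close>)
    then show "inv c \<otimes> q \<otimes> c \<in> Q" using c Cc by auto
  qed
  moreover have "rel_open G T Q P"
  proof -
    have "rel_open G T (D \<inter> V) P" by (rule rel_open_Int[OF Dp(3) V(4)])
    moreover have "D \<inter> V \<subseteq> Q" unfolding Q_def by (rule subset_set_mult[OF DVs R(1)])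
    ultimately show ?thesis by (meson inf.coboundedI1 order_refl rel_open_mono)
  qed
  ultimately show ?thesis using that[OF Q] unfolding Q_def R_def by blast
qed

text \<open>Carries the approximation from \<open>P\<close> to \<open>V P\<close>. First
  \<open>Q\<close> is replaced by its core \<open>Q'\<close> under \<open>V\<close>. If
  \<open>V3\<close> is so small that all commutators of \<open>V3\<close> with \<open>P\<close> lie
  in \<open>Q'\<close>, then \<open>V3 Q'\<close> is normalized by \<open>P\<close> as well as by
  \<open>V\<close>. With \<open>V\<close> compact open in \<open>G\<close>, this produces open
  subgroups of \<open>G\<close> close to the residual of \<open>P\<close>.\<close>

lemma rel_residual_compact_extension:
  assumes P: "subgroup P G" "closedin T P" and C: "compactin T C" "P = generate G C"
    and V: "subgroup V G" "compactin T V" "normalizes G V P"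
      "rel_open G T V (V <#> P)"
    and V1: "COS V1"
  obtains D where "subgroup D G" "rel_open G T D (V <#> P)"
    "normalizes G P D" "normalizes G V D"
    "D \<subseteq> (V \<inter> V1) <#> rel_residual G T {\<one>} P"
proof -
  define VP where "VP = V <#> P"
  have Vc: "V \<subseteq> carrier G" and Pc: "P \<subseteq> carrier G" using V P by (auto simp: subgroup.mem_carrier)
  have CP: "C \<subseteq> P" using C by (auto intro: generate.incl)
  have PVP: "P \<subseteq> VP" unfolding VP_def by (rule subset_set_mult[OF V(1) P(1)])
  have VVP: "rel_open G T V VP" using V by (simp add: VP_def)
  define V2 where "V2 = conj_core G V (V \<inter> V1)"
  have VV1: "subgroup (V \<inter> V1) G" using V cosD[OF V1] by (simp add: subgroups_Inter_pair)
  have V2: "subgroup V2 G" "V2 \<subseteq> V \<inter> V1" "normalizes G V V2" "rel_open G T V2 V"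
    unfolding V2_def
    using conj_core_subgroup[OF Vc VV1] conj_core_subset[OF V(1)] conj_core_normalizes[OF V(1)]
      rel_open_conj_core[OF V(1,2) normalizes_self[OF V(1)] Vc rel_open_Int[OF rel_open_self rel_open_cos[OF V1]]]
    by auto
  have V2VP: "rel_open G T V2 VP" by (rule rel_open_trans[OF V2(4) VVP])
  have V2cl: "closedin T V2"
    by (rule rel_open_closedin[OF V2(1) _ V(1) compactin_closedin[OF V(2)] V2(4)]) (use V2 in blast)
  have V2k: "compactin T V2" using closed_compactin[OF V(2) _ V2cl] V2 by blast
  obtain Q where Q: "subgroup Q G" "Q \<subseteq> (V2 \<inter> P) <#> rel_residual G T {\<one>} P"
    "rel_open G T Q P" "normalizes G P Q"
  proof (rule rel_residual_compact_approx[OF P C, of "V2 \<inter> P"])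
    show "subgroup (V2 \<inter> P) G" using V2 P by (simp add: subgroups_Inter_pair)
    show "compactin T (V2 \<inter> P)" using V2k P compactin_Int_closedin by blast
    show "rel_open G T (V2 \<inter> P) P" using rel_open_mono[OF V2VP] PVP by blast
  qed auto
  define Q' where "Q' = conj_core G V Q"
  have Q': "subgroup Q' G" "Q' \<subseteq> Q" "normalizes G V Q'" "normalizes G P Q'" "rel_open G T Q' P"
    unfolding Q'_def
    using conj_core_subgroup[OF Vc Q(1)] conj_core_subset[OF V(1)] conj_core_normalizes[OF V(1)]
      conj_core_normalizes_other[OF V(1) P(1) V(3) Q(4)] rel_open_conj_core[OF V(1,2,3) Pc Q(3)]
    by auto
  have Q'c: "Q' \<subseteq> carrier G" using Q' by (simp add: subgroup.subset)
  obtain V' where V': "COS V'" "V' \<inter> P \<subseteq> Q'" using Q'(5) unfolding rel_open_def by blast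
  obtain W where W: "COS W" "W \<subseteq> V'" "\<And>c w. c \<in> C \<Longrightarrow> w \<in> W \<Longrightarrow> c \<otimes> w \<otimes> inv c \<in> V'"
    using cos_conj[OF C(1) V'(1)] by metis
  define V3 where "V3 = conj_core G V (V2 \<inter> W)"
  have V2W: "subgroup (V2 \<inter> W) G" using V2 cosD[OF W(1)] by (simp add: subgroups_Inter_pair)
  have V3: "subgroup V3 G" "V3 \<subseteq> V2 \<inter> W" "normalizes G V V3" "rel_open G T V3 V"
    unfolding V3_def
    using conj_core_subgroup[OF Vc V2W] conj_core_subset[OF V(1)] conj_core_normalizes[OF V(1)]
      rel_open_conj_core[OF V(1,2) normalizes_self[OF V(1)] Vc rel_open_Int[OF V2(4) rel_open_cos[OF W(1)]]]
    by auto
  have V3V: "V3 \<subseteq> V" using V3 V2 by blast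
  \<comment> \<open>For a generator the commutator lies in \<open>V' \<inter> P\<close>, by the
    choice of \<open>W\<close>. Products follow from
    \<open>[v, p q] = [v, p] (p [v, q] (inv p))\<close> and the invariance of \<open>Q'\<close>
    under \<open>P\<close>.\<close>
  have comm: "v \<otimes> p \<otimes> inv v \<otimes> inv p \<in> Q'" if "p \<in> P" "v \<in> V3" for p v
    using that unfolding C(2)
  proof (induction p rule: generate.induct)
    case one
    then show ?case using Q'(1) V3V Vc subgroup.one_closed[OF Q'(1)] by (auto simp: subset_iff)
  next
    case (incl c)
    have c: "v \<in> carrier G" "c \<in> carrier G" "c \<in> P" "v \<in> V" using incl V3V Vc CP Pc by auto
    have iv: "inv v \<in> W" using incl V3 subgroup.m_inv_closed[OF V3(1)] by blast
    have "c \<otimes> inv v \<otimes> inv c \<in> V'" using W(3)[OF incl(1) iv] .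
    moreover have "v \<in> V'" using incl V3 W by blast
    ultimately have "v \<otimes> (c \<otimes> inv v \<otimes> inv c) \<in> V'" using cosD(1)[OF V'(1)] by (simp add: subgroup.m_closed)
    then have "v \<otimes> c \<otimes> inv v \<otimes> inv c \<in> V'" using c by (simp add: word_simps)
    moreover have "v \<otimes> c \<otimes> inv v \<otimes> inv c \<in> P"
      using normalizesD[OF V(3) c(4,3)] c P by (simp add: subgroup.m_closed subgroup.m_inv_closed)
    ultimately show ?case using V' by blast
  next
    case (inv c)
    have c: "v \<in> carrier G" "c \<in> carrier G" "c \<in> P" "v \<in> V" using inv V3V Vc CP Pc by auto
    have iv: "inv v \<in> W" using inv V3 subgroup.m_inv_closed[OF V3(1)] by blast
    have "c \<otimes> inv v \<otimes> inv c \<in> V'" using W(3)[OF inv(1) iv] .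
    moreover have "v \<in> V'" using inv V3 W by blast
    ultimately have "v \<otimes> (c \<otimes> inv v \<otimes> inv c) \<in> V'" using cosD(1)[OF V'(1)] by (simp add: subgroup.m_closed)
    then have "v \<otimes> c \<otimes> inv v \<otimes> inv c \<in> V'" using c by (simp add: word_simps)
    moreover have "v \<otimes> c \<otimes> inv v \<otimes> inv c \<in> P"
      using normalizesD[OF V(3) c(4,3)] c P by (simp add: subgroup.m_closed subgroup.m_inv_closed)
    ultimately have "v \<otimes> c \<otimes> inv v \<otimes> inv c \<in> Q'" using V' by blast
    then have "inv (v \<otimes> c \<otimes> inv v \<otimes> inv c) \<in> Q'" using Q' by (simp add: subgroup.m_inv_closed)
    then have "inv c \<otimes> inv (v \<otimes> c \<otimes> inv v \<otimes> inv c) \<otimes> c \<in> Q'"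
      by (rule normalizes_inv[OF P(1) Q'(4) c(3)])
    then show ?case using c by (simp add: word_simps)
  next
    case (eng p q)
    have pq: "p \<in> P" "q \<in> P" using eng C by auto
    have c: "v \<in> carrier G" "p \<in> carrier G" "q \<in> carrier G" using eng pq V3V Vc Pc by auto
    have "(v \<otimes> p \<otimes> inv v \<otimes> inv p) \<otimes> (p \<otimes> (v \<otimes> q \<otimes> inv v \<otimes> inv q) \<otimes> inv p) \<in> Q'"
      using eng normalizesD[OF Q'(4) pq(1)] Q' by (simp add: subgroup.m_closed)
    then show ?case using c by (simp add: word_simps)
  qed
  define D where "D = V3 <#> Q'"
  have "subgroup D G" unfolding D_def
    by (rule subgroup_mult_set[OF V3(1) Q'(1) normalizes_mono[OF Q'(3) V3V]])
  moreover have "rel_open G T D VP"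
  proof -
    have "rel_open G T V3 VP" by (rule rel_open_trans[OF V3(4) VVP])
    moreover have "V3 \<subseteq> D" unfolding D_def by (rule subset_set_mult[OF V3(1) Q'(1)])
    ultimately show ?thesis by (meson inf.coboundedI1 order_refl rel_open_mono)
  qed
  moreover have "normalizes G P D" unfolding normalizes_def
  proof (intro ballI)
    fix p d assume p: "p \<in> P" and "d \<in> D"
    then obtain v q where d: "d = v \<otimes> q" "v \<in> V3" "q \<in> Q'" by (auto simp: D_def)
    have c: "p \<in> carrier G" "v \<in> carrier G" "q \<in> carrier G" using p d Pc V3V Vc Q'c by auto
    have "inv v \<otimes> p \<otimes> inv (inv v) \<otimes> inv p \<in> Q'"
      by (rule comm[OF p]) (use d V3 in \<open>simp add: subgroup.m_inv_closed\<close>)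
    then have "(inv v \<otimes> p \<otimes> inv (inv v) \<otimes> inv p) \<otimes> (p \<otimes> q \<otimes> inv p) \<in> Q'"
      using normalizesD[OF Q'(4) p d(3)] Q' by (simp add: subgroup.m_closed)
    then have "v \<otimes> ((inv v \<otimes> p \<otimes> inv (inv v) \<otimes> inv p) \<otimes> (p \<otimes> q \<otimes> inv p)) \<in> D"
      unfolding D_def using d by blast
    then show "p \<otimes> d \<otimes> inv p \<in> D" using c d by (simp add: word_simps)
  qed
  moreover have "normalizes G V D" unfolding normalizes_def
  proof (intro ballI)
    fix x d assume x: "x \<in> V" and "d \<in> D"
    then obtain v q where d: "d = v \<otimes> q" "v \<in> V3" "q \<in> Q'" by (auto simp: D_def)
    have c: "x \<in> carrier G" "v \<in> carrier G" "q \<in> carrier G" using x d V3V Vc Q'c by auto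
    have "(x \<otimes> v \<otimes> inv x) \<otimes> (x \<otimes> q \<otimes> inv x) \<in> D"
      unfolding D_def using normalizesD[OF V3(3) x d(2)] normalizesD[OF Q'(3) x d(3)] by blast
    then show "x \<otimes> d \<otimes> inv x \<in> D" using c d by (simp add: word_simps)
  qed
  moreover have "D \<subseteq> (V \<inter> V1) <#> rel_residual G T {\<one>} P"
  proof
    fix d assume "d \<in> D"
    then obtain v q where d: "d = v \<otimes> q" "v \<in> V3" "q \<in> Q'" by (auto simp: D_def)
    then obtain v' r where q: "q = v' \<otimes> r" "v' \<in> V2" "v' \<in> P" "r \<in> rel_residual G T {\<one>} P"
      using Q' Q by blast
    have r: "r \<in> P" using q rel_residual_subset[OF P(1)] subgroup.one_closed[OF P(1)] by blast
    have c: "v \<in> carrier G" "v' \<in> carrier G" "r \<in> carrier G" using d q r V3V Vc Pc by auto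
    have "v \<otimes> v' \<in> V2" using d q V3 V2 by (auto intro: subgroup.m_closed)
    then have "(v \<otimes> v') \<otimes> r \<in> (V \<inter> V1) <#> rel_residual G T {\<one>} P"
      using V2 q by blast
    then show "d \<in> (V \<inter> V1) <#> rel_residual G T {\<one>} P"
      using c d q by (simp add: m_assoc)
  qed
  ultimately show ?thesis using that unfolding VP_def by blast
qed

end

section \<open>Iterated residuals\<close>

text \<open>Generation by \<open>C \<union> N\<close> expresses that \<open>P/N\<close> is compactly
  generated. The rule \<open>base\<close> starts the recursion: for \<open>B = N\<close> the only
  choice is \<open>P = N\<close>, whose residual is \<open>N\<close> itself, so \<open>step\<close>
  would be circular there.\<close>

inductive res_founded :: "'a monoid \<Rightarrow> 'a topology \<Rightarrow> 'a set \<Rightarrow> 'a set \<Rightarrow> bool"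
  for G T N where
  base: "res_founded G T N N"
| step: "res_founded G T N B"
    if "\<And>P C. subgroup P G \<Longrightarrow> N \<subseteq> P \<Longrightarrow> P \<subseteq> B \<Longrightarrow> rel_open G T P B \<Longrightarrow> compactin T C \<Longrightarrow>
       P = generate G (C \<union> N) \<Longrightarrow> res_founded G T N (rel_residual G T N P)"

context group
begin

lemma generate_Un_one:
  assumes "C \<subseteq> carrier G"
  shows "generate G (C \<union> {\<one>}) = generate G C"
proof
  show "generate G (C \<union> {\<one>}) \<subseteq> generate G C"
    by (rule generate_subgroup_incl[OF _ generate_is_subgroup[OF assms]])
      (auto intro: generate.incl generate.one)
qed (rule mono_generate, blast)

lemma normalizes_generate_set:
  assumes V: "subgroup V G" and C: "C \<subseteq> carrier G" "normalizes G V C"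
  shows "normalizes G V (generate G C)"
  unfolding normalizes_def
proof (intro ballI)
  fix v x assume v: "v \<in> V" and x: "x \<in> generate G C"
  have vc: "v \<in> carrier G" using v V by (simp add: subgroup.mem_carrier)
  from x show "v \<otimes> x \<otimes> inv v \<in> generate G C"
  proof (induction x rule: generate.induct)
    case one then show ?case using vc by (simp add: generate.one)
  next
    case (incl h) then show ?case using normalizesD[OF C(2) v] by (blast intro: generate.incl)
  next
    case (inv h)
    then have "inv (v \<otimes> h \<otimes> inv v) \<in> generate G C"
      using normalizesD[OF C(2) v] by (blast intro: generate.inv)
    moreover have "h \<in> carrier G" using inv C by blast
    ultimately show ?case using vc by (simp add: word_simps)
  next
    case (eng h1 h2)
    have c: "h1 \<in> carrier G" "h2 \<in> carrier G" using eng generate_in_carrier[OF C(1)] by auto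
    have "(v \<otimes> h1 \<otimes> inv v) \<otimes> (v \<otimes> h2 \<otimes> inv v) \<in> generate G C"
      using eng by (blast intro: generate.eng)
    then show ?case using c vc by (simp add: word_simps)
  qed
qed

lemma normalizes_mult:
  assumes "A \<subseteq> carrier G" "B \<subseteq> carrier G" "S \<subseteq> carrier G" "normalizes G A S" "normalizes G B S"
  shows "normalizes G (A <#> B) S"
  unfolding normalizes_def
proof (intro ballI)
  fix x s assume "x \<in> A <#> B" and s: "s \<in> S"
  then obtain a b where x: "x = a \<otimes> b" "a \<in> A" "b \<in> B" by auto
  have c: "a \<in> carrier G" "b \<in> carrier G" "s \<in> carrier G" using x s assms by auto
  have "a \<otimes> (b \<otimes> s \<otimes> inv b) \<otimes> inv a \<in> S" using x s assms by (auto dest: normalizesD)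
  then show "x \<otimes> s \<otimes> inv x \<in> S" using c x by (simp add: word_simps)
qed

lemma normalizes_mult_set:
  assumes "H \<subseteq> carrier G" "A \<subseteq> carrier G" "B \<subseteq> carrier G" "normalizes G H A" "normalizes G H B"
  shows "normalizes G H (A <#> B)"
  unfolding normalizes_def
proof (intro ballI)
  fix h x assume h: "h \<in> H" and "x \<in> A <#> B"
  then obtain a b where x: "x = a \<otimes> b" "a \<in> A" "b \<in> B" by auto
  have c: "h \<in> carrier G" "a \<in> carrier G" "b \<in> carrier G" using x h assms by auto
  have "(h \<otimes> a \<otimes> inv h) \<otimes> (h \<otimes> b \<otimes> inv h) \<in> A <#> B"
    using normalizesD[OF assms(4) h x(2)] normalizesD[OF assms(5) h x(3)] by blast
  then show "h \<otimes> x \<otimes> inv h \<in> A <#> B"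
    using c x by (simp add: word_simps)
qed

end

section \<open>Permanence of well-foundedness under closed subgroups, extensions and
  quotients\<close>

context tdlc_grp
begin

text \<open>Closing \<open>C\<close> up under conjugation by the compact \<open>V\<close> keeps it
  compact, and adding \<open>V \<inter> B\<close> makes the generated subgroup open in
  \<open>B\<close> whenever \<open>V\<close> is. The last conclusion, minimality, serves to locate
  \<open>E\<close> in given invariant sets.\<close>

lemma normalized_generators:
  assumes V: "subgroup V G" "compactin T V" and C: "compactin T C"
    and B: "closedin T B" "normalizes G V B"
  obtains E where "compactin T E" "normalizes G V E" "C \<subseteq> E" "V \<inter> B \<subseteq> E"
    "\<And>S. normalizes G V S \<Longrightarrow> C \<subseteq> S \<Longrightarrow> V \<inter> B \<subseteq> S \<Longrightarrow> E \<subseteq> S"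
proof -
  define E where "E = {v \<otimes> c \<otimes> inv v |v c. v \<in> V \<and> c \<in> C} \<union> (V \<inter> B)"
  have Vc: "V \<subseteq> carrier G" and Cc: "C \<subseteq> carrier G" using compactin_carrier V C by auto
  show ?thesis
  proof (rule that)
    show "compactin T E" unfolding E_def
      by (intro compactin_Un compactin_conj V C compactin_Int_closedin B)
    show "normalizes G V E" unfolding normalizes_def
    proof (intro ballI)
      fix v e assume v: "v \<in> V" and "e \<in> E"
      then consider w c where "w \<in> V" "c \<in> C" "e = w \<otimes> c \<otimes> inv w" | "e \<in> V \<inter> B"
        unfolding E_def by blast
      then show "v \<otimes> e \<otimes> inv v \<in> E"
      proof cases
        case 1
        have "v \<otimes> w \<in> V" using v 1 V by (simp add: subgroup.m_closed)
        then have "(v \<otimes> w) \<otimes> c \<otimes> inv (v \<otimes> w) \<in> E" unfolding E_def using 1 by blast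
        moreover have "v \<in> carrier G" "w \<in> carrier G" "c \<in> carrier G" using v 1 Vc Cc by auto
        ultimately show ?thesis using 1 by (simp add: word_simps)
      next
        case 2
        then have "v \<otimes> e \<otimes> inv v \<in> V \<inter> B"
          using normalizesD[OF B(2) v] normalizesD[OF normalizes_self[OF V(1)] v] by blast
        then show ?thesis unfolding E_def by blast
      qed
    qed
    show "C \<subseteq> E"
    proof
      fix c assume c: "c \<in> C"
      then have "\<one> \<otimes> c \<otimes> inv \<one> \<in> E" unfolding E_def using subgroup.one_closed[OF V(1)] by blast
      moreover have "c \<in> carrier G" using c Cc by blast
      ultimately show "c \<in> E" by simp
    qed
    show "E \<subseteq> S" if "normalizes G V S" "C \<subseteq> S" "V \<inter> B \<subseteq> S" for S
      using that unfolding E_def by (auto dest: normalizesD)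
  qed (auto simp: E_def)
qed

text \<open>Intersecting with \<open>P'\<close> sends members of the family for \<open>P\<close> to
  members of the family for \<open>P'\<close>.\<close>

lemma rel_residual_mono:
  assumes "subgroup P' G" "P' \<subseteq> P" "N' \<subseteq> N" "N' \<subseteq> P'"
  shows "rel_residual G T N' P' \<subseteq> rel_residual G T N P"
proof -
  have "rel_residual G T N' P' \<subseteq> D"
    if D: "subgroup D G" "N \<subseteq> D" "D \<subseteq> P" "rel_open G T D P" "normalizes G P D" for D
  proof -
    have "rel_residual G T N' P' \<subseteq> D \<inter> P'"
    proof (rule rel_residual_least)
      show "subgroup (D \<inter> P') G" using D assms by (simp add: subgroups_Inter_pair)
      show "rel_open G T (D \<inter> P') P'" by (rule rel_open_mono[OF D(4)]) (use assms in auto)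
      show "normalizes G P' (D \<inter> P')"
        by (intro normalizes_Int normalizes_self assms normalizes_mono[OF D(5)])
    qed (use assms D in auto)
    then show ?thesis by blast
  qed
  then show ?thesis unfolding rel_residual_def[of G T N P] by blast
qed

lemma rel_residual_trivial: "subgroup N G \<Longrightarrow> rel_residual G T N N = N"
  using rel_residual_subset[of N N] rel_residual_contains by blast

lemma founded_residual:
  assumes "res_founded G T N B" and P: "subgroup P G" "N \<subseteq> P" "P \<subseteq> B" "rel_open G T P B"
    and C: "compactin T C" "P = generate G (C \<union> N)"
  shows "res_founded G T N (rel_residual G T N P)"
  using assms(1)
proof cases
  case base
  then have "P = N" using P by blast
  then show ?thesis using P rel_residual_trivial res_founded.base by metis
next
  case step
  then show ?thesis using P C by blast
qed

text \<open>A subgroup \<open>P\<close> open in \<open>H\<close> need not be open in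
  \<open>B\<close>. Adding \<open>V \<inter> B\<close> to its generators gives a compactly generated
  \<open>Q\<close> that is, and the residual of \<open>P\<close> is a closed subgroup of that of
  \<open>Q\<close>, to which the induction hypothesis applies.\<close>

lemma founded_closed_subgroup:
  assumes "res_founded G T {\<one>} B" "subgroup B G" "closedin T B"
    "subgroup H G" "closedin T H" "H \<subseteq> B"
  shows "res_founded G T {\<one>} H"
  using assms
proof (induction arbitrary: H rule: res_founded.induct)
  case base
  then have "H = {\<one>}" using subgroup.one_closed by blast
  then show ?case using res_founded.base by metis
next
  case (step B)
  show ?case
  proof (rule res_founded.step)
    fix P C
    assume P: "subgroup P G" "{\<one>} \<subseteq> P" "P \<subseteq> H" "rel_open G T P H"
      and C: "compactin T C" "P = generate G (C \<union> {\<one>})"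
    obtain V where V: "COS V" using cos_ex by blast
    let ?C = "C \<union> (V \<inter> B)"
    have k: "compactin T ?C" by (intro compactin_Un C compactin_Int_closedin cosD(3)[OF V] step)
    have Cc: "?C \<subseteq> carrier G" using compactin_carrier[OF k] .
    define Q where "Q = generate G (?C \<union> {\<one>})"
    have Q: "subgroup Q G" "?C \<subseteq> Q" unfolding Q_def
      using generate_is_subgroup[of "?C \<union> {\<one>}"] Cc by (auto intro: generate.incl)
    have CB: "C \<subseteq> B" using C P step.prems by (auto intro: generate.incl)
    have QB: "Q \<subseteq> B" unfolding Q_def
      by (rule generate_subgroup_incl) (use CB step.prems in \<open>auto simp: subgroup.one_closed\<close>)
    have Qo: "rel_open G T Q B" unfolding rel_open_def using V Q by blast
    have PQ: "P \<subseteq> Q" unfolding C(2) Q_def by (rule mono_generate) blast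
    have one: "{\<one>} \<subseteq> Q" using Q by (simp add: subgroup.one_closed)
    have Qcl: "closedin T Q" using rel_open_closedin[OF Q(1) QB _ _ Qo] step.prems by blast
    have Pcl: "closedin T P" using rel_open_closedin[OF P(1,3) _ _ P(4)] step.prems by blast
    show "res_founded G T {\<one>} (rel_residual G T {\<one>} P)"
    proof (rule step.IH[OF Q(1) one QB Qo k Q_def])
      show "rel_residual G T {\<one>} P \<subseteq> rel_residual G T {\<one>} Q"
        by (rule rel_residual_mono[OF P(1) PQ _ P(2)]) simp
    qed (use rel_residual_subgroup rel_residual_closedin P Pcl Q one Qcl in auto)
  qed
qed

text \<open>Induction over the foundedness modulo \<open>N\<close>, ending at \<open>N\<close>,
  which is founded by assumption. For a given \<open>P\<close> the hypothesis is applied to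
  \<open>P N\<close>, generated by \<open>C \<union> N\<close>; the residual of \<open>P\<close> is
  a closed subgroup of the residual of \<open>P N\<close> modulo \<open>N\<close>.\<close>

lemma founded_extension:
  assumes "res_founded G T N B" "subgroup B G" "closedin T B" "N \<subseteq> B" "normalizes G B N"
    and N: "subgroup N G" "closedin T N" "res_founded G T {\<one>} N"
  shows "res_founded G T {\<one>} B"
  using assms(1-5)
proof (induction rule: res_founded.induct)
  case base
  then show ?case using N by simp
next
  case (step B)
  show ?case
  proof (rule res_founded.step)
    fix P C
    assume P: "subgroup P G" "{\<one>} \<subseteq> P" "P \<subseteq> B" "rel_open G T P B"
      and C: "compactin T C" "P = generate G (C \<union> {\<one>})"
    have Bc: "B \<subseteq> carrier G" using step.prems by (simp add: subgroup.subset)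
    have Cc: "C \<subseteq> carrier G" by (rule compactin_carrier[OF C(1)])
    have CP: "C \<subseteq> P" using C by (auto intro: generate.incl)
    have nPN: "normalizes G P N" using normalizes_mono[OF step.prems(4) P(3)] .
    define Q where "Q = P <#> N"
    have Q: "subgroup Q G" unfolding Q_def by (rule subgroup_mult_set[OF P(1) N(1) nPN])
    have NQ: "N \<subseteq> Q" and PQ: "P \<subseteq> Q" unfolding Q_def using subset_set_mult[OF P(1) N(1)] by auto
    have QB: "Q \<subseteq> B" unfolding Q_def using P step.prems by (auto intro!: subgroup.m_closed)
    have Qo: "rel_open G T Q B" by (rule rel_open_mono[OF P(4)]) (use PQ in auto)
    have CNc: "C \<union> N \<subseteq> carrier G" using Cc N by (simp add: subgroup.subset)
    have Qg: "Q = generate G (C \<union> N)"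
    proof
      show "generate G (C \<union> N) \<subseteq> Q" by (rule generate_subgroup_incl[OF _ Q]) (use CP PQ NQ in blast)
      have "P \<subseteq> generate G (C \<union> N)" unfolding C(2)
        by (rule generate_subgroup_incl[OF _ generate_is_subgroup[OF CNc]])
          (auto intro: generate.incl generate.one)
      moreover have "N \<subseteq> generate G (C \<union> N)" by (auto intro: generate.incl)
      ultimately show "Q \<subseteq> generate G (C \<union> N)" unfolding Q_def by (auto intro!: generate.eng)
    qed
    have Qcl: "closedin T Q" using rel_open_closedin[OF Q QB _ _ Qo] step.prems by blast
    have Pcl: "closedin T P" using rel_open_closedin[OF P(1,3) _ _ P(4)] step.prems by blast
    have R: "subgroup (rel_residual G T N Q) G" "closedin T (rel_residual G T N Q)"
      "N \<subseteq> rel_residual G T N Q" "rel_residual G T N Q \<subseteq> Q"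
      using rel_residual_subgroup[OF Q NQ] rel_residual_closedin[OF Q NQ Qcl] rel_residual_contains
        rel_residual_subset[OF Q NQ] by auto
    have nR: "normalizes G (rel_residual G T N Q) N"
      using normalizes_mono[OF step.prems(4)] R QB by blast
    have "res_founded G T {\<one>} (rel_residual G T N Q)"
      by (rule step.IH[OF Q NQ QB Qo C(1) Qg R(1,2,3) nR])
    moreover have "rel_residual G T {\<one>} P \<subseteq> rel_residual G T N Q"
      by (rule rel_residual_mono[OF P(1) PQ _ P(2)]) (use N in \<open>simp add: subgroup.one_closed\<close>)
    ultimately show "res_founded G T {\<one>} (rel_residual G T {\<one>} P)"
      using founded_closed_subgroup[OF _ R(1,2) rel_residual_subgroup[OF P(1,2)]
          rel_residual_closedin[OF P(1,2) Pcl]] by blast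
  qed
qed

text \<open>
  The hypotheses say that \<open>A N\<close> is dense in \<open>B\<close> and that an open subgroup of \<open>B\<close> normalizes \<open>A\<close>.
  The residual of a quotient is not the image of a residual but only contains it as a dense
  normal subgroup, which is why the induction has to be set up in this generality.
\<close>

lemma founded_quotient:
  assumes "res_founded G T {\<one>} A" "subgroup A G" "closedin T A" "A \<subseteq> B"
    and "subgroup B G" "closedin T B" "N \<subseteq> B" "normalizes G B N"
    and N: "subgroup N G" "closedin T N"
    and "subgroup V G" "compactin T V" "V \<subseteq> B" "rel_open G T V B" "normalizes G V A"
    and "\<And>W b. COS W \<Longrightarrow> b \<in> B \<Longrightarrow> \<exists>a\<in>A. \<exists>n\<in>N. \<exists>w\<in>W. b = a \<otimes> n \<otimes> w"
  shows "res_founded G T N B"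
  using assms(1-8,11-16)
proof (induction arbitrary: B V rule: res_founded.induct)
  case base
  have "B \<subseteq> N"
  proof
    fix b assume b: "b \<in> B"
    show "b \<in> N"
    proof (rule closedin_cosI[OF N(2)])
      show "b \<in> carrier G" using b base by (simp add: subgroup.mem_carrier)
      fix W assume W: "COS W"
      then obtain n w where "n \<in> N" "w \<in> W" "b = \<one> \<otimes> n \<otimes> w" using base(13)[OF W b] by blast
      then show "\<exists>a\<in>N. \<exists>v\<in>W. b = a \<otimes> v" using N by (auto simp: subgroup.mem_carrier)
    qed
  qed
  then have "B = N" using base by blast
  then show ?case using res_founded.base by metis
next
  case (step A B V)
  note A = \<open>subgroup A G\<close> \<open>closedin T A\<close> \<open>A \<subseteq> B\<close>
  note B = \<open>subgroup B G\<close> \<open>closedin T B\<close> \<open>N \<subseteq> B\<close> \<open>normalizes G B N\<close>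
  note V = \<open>subgroup V G\<close> \<open>compactin T V\<close> \<open>V \<subseteq> B\<close> \<open>rel_open G T V B\<close> \<open>normalizes G V A\<close>
  note dense = step.prems(13)
  have Bc: "B \<subseteq> carrier G" using B by (simp add: subgroup.subset)
  have Nc: "N \<subseteq> carrier G" using N by (simp add: subgroup.subset)
  have Ac: "A \<subseteq> carrier G" using A by (simp add: subgroup.subset)
  show ?case
  proof (rule res_founded.step)
    fix Q C
    assume Q: "subgroup Q G" "N \<subseteq> Q" "Q \<subseteq> B" "rel_open G T Q B"
      and C: "compactin T C" "Q = generate G (C \<union> N)"
    have Qcl: "closedin T Q" by (rule rel_open_closedin[OF Q(1,3) B(1,2) Q(4)])
    have Qc: "Q \<subseteq> carrier G" using Q Bc by blast
    have CQ: "C \<subseteq> Q" using C by (auto intro: generate.incl)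
    define V' where "V' = V \<inter> Q"
    have V': "subgroup V' G" "compactin T V'" "V' \<subseteq> Q" "rel_open G T V' B" "normalizes G V' A"
      unfolding V'_def using V Q Qcl
      by (auto simp: subgroups_Inter_pair compactin_Int_closedin intro: rel_open_Int normalizes_mono)
    have V'c: "V' \<subseteq> carrier G" using V' Qc by blast
    obtain V0 where V0: "COS V0" "V0 \<inter> B \<subseteq> V'" using V'(4) unfolding rel_open_def by blast
    \<comment> \<open>The factor \<open>w\<close> lies in \<open>V0 \<inter> B\<close>, hence in
      \<open>V'\<close> and in \<open>Q\<close>; then so does \<open>a\<close>. Thus the covering of
      \<open>B\<close> by \<open>A N V0\<close> descends to a covering of \<open>Q\<close> by
      \<open>(A \<inter> Q) N V0\<close>.\<close>
    have split: "\<exists>a\<in>A \<inter> Q. \<exists>n\<in>N. \<exists>w\<in>V0. q = a \<otimes> n \<otimes> w" if q: "q \<in> Q" for q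
    proof -
      have "q \<in> B" using q Q by blast
      then obtain a n w where anw: "a \<in> A" "n \<in> N" "w \<in> V0" "q = a \<otimes> n \<otimes> w"
        using dense[OF V0(1)] by blast
      have c: "a \<in> carrier G" "n \<in> carrier G" "w \<in> carrier G"
        using anw Ac Nc cosD(4)[OF V0(1)] by auto
      have "w = inv (a \<otimes> n) \<otimes> q" using anw c by (simp add: word_simps)
      moreover have "a \<otimes> n \<in> B" using anw A B by (auto intro: subgroup.m_closed)
      ultimately have "w \<in> B" using q Q B by (auto intro: subgroup.m_closed subgroup.m_inv_closed)
      then have w: "w \<in> V'" using V0 anw by blast
      have "q \<otimes> inv w \<otimes> inv n \<in> Q"
        using q w anw V' Q by (auto intro!: subgroup.m_closed subgroup.m_inv_closed)
      moreover have "q \<otimes> inv w \<otimes> inv n = a" using anw c by (simp add: word_simps)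
      ultimately show ?thesis using anw by auto
    qed
    let ?S = "\<lambda>a. {n \<otimes> a |n. n \<in> N} <#> V0"
    have "\<forall>U\<in>?S ` (A \<inter> Q). openin T U"
    proof
      fix U assume "U \<in> ?S ` (A \<inter> Q)"
      then obtain a where a: "a \<in> A \<inter> Q" "U = ?S a" by blast
      show "openin T U" unfolding a(2)
        by (rule openin_mult_right) (use a Ac Nc cosD[OF V0(1)] in auto)
    qed
    moreover have "C \<subseteq> \<Union>(?S ` (A \<inter> Q))"
    proof
      fix c assume c: "c \<in> C"
      then obtain a n w where anw: "a \<in> A" "a \<in> Q" "n \<in> N" "w \<in> V0" "c = a \<otimes> n \<otimes> w"
        using split CQ by blast
      have cc: "a \<in> carrier G" "n \<in> carrier G" "w \<in> carrier G"
        using anw Ac Nc cosD(4)[OF V0(1)] by auto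
      have "a \<otimes> n \<otimes> inv a \<in> N" using normalizesD[OF B(4)] anw A by blast
      moreover have "c = ((a \<otimes> n \<otimes> inv a) \<otimes> a) \<otimes> w" using anw cc by (simp add: word_simps)
      ultimately have "c \<in> ?S a" using anw by blast
      then show "c \<in> \<Union>(?S ` (A \<inter> Q))" using anw by blast
    qed
    ultimately obtain \<F> where \<F>: "finite \<F>" "\<F> \<subseteq> ?S ` (A \<inter> Q)" "C \<subseteq> \<Union>\<F>"
      using C(1) unfolding compactin_def by meson
    obtain F where F: "finite F" "F \<subseteq> A \<inter> Q" "\<F> = ?S ` F"
      using finite_subset_image[OF \<F>(1,2)] by blast
    have CF: "\<exists>n\<in>N. \<exists>f\<in>F. \<exists>v\<in>V'. c = n \<otimes> f \<otimes> v" if c: "c \<in> C" for c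
    proof -
      obtain n f v where nfv: "n \<in> N" "f \<in> F" "v \<in> V0" "c = n \<otimes> f \<otimes> v"
        using c \<F>(3) F(3) by blast
      have cc: "n \<in> carrier G" "f \<in> carrier G" "v \<in> carrier G"
        using nfv F Ac Nc cosD(4)[OF V0(1)] by auto
      have nf: "n \<otimes> f \<in> Q" using nfv F Q by (auto intro: subgroup.m_closed)
      have "v = inv (n \<otimes> f) \<otimes> c" using nfv cc by (simp add: word_simps)
      then have "v \<in> Q" using nf c CQ Q by (auto intro: subgroup.m_closed subgroup.m_inv_closed)
      then have "v \<in> V'" using nfv V0 Q by blast
      then show ?thesis using nfv by blast
    qed
    have Fk: "compactin T F" using F Ac by (intro finite_imp_compactin) (auto simp: topspace_eq)
    \<comment> \<open>The finitely many representatives are closed up under \<open>V'\<close> and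
      enlarged by \<open>V' \<inter> A\<close>, so that the generated \<open>P\<close> is normalized
      by \<open>V'\<close>, open in \<open>A\<close>, and satisfies
      \<open>Q = V' P N\<close>.\<close>
    obtain E where Ek: "compactin T E" and nVE: "normalizes G V' E" and FE: "F \<subseteq> E" "V' \<inter> A \<subseteq> E"
      and Emin: "\<And>S. normalizes G V' S \<Longrightarrow> F \<subseteq> S \<Longrightarrow> V' \<inter> A \<subseteq> S \<Longrightarrow> E \<subseteq> S"
      by (rule normalized_generators[OF V'(1,2) Fk A(2) V'(5)]) blast
    have Ec: "E \<subseteq> carrier G" by (rule compactin_carrier[OF Ek])
    have "normalizes G V' Q" by (rule normalizes_mono[OF normalizes_self[OF Q(1)] V'(3)])
    then have EAQ: "E \<subseteq> A \<inter> Q" using V' F(2) by (intro Emin normalizes_Int) auto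
    define P where "P = generate G (E \<union> {\<one>})"
    have P: "subgroup P G" "P = generate G E" unfolding P_def
      using generate_is_subgroup[of "E \<union> {\<one>}"] generate_Un_one[OF Ec] Ec by auto
    have EP: "E \<subseteq> P" unfolding P_def by (auto intro: generate.incl)
    have AQ: "subgroup (A \<inter> Q) G" using A Q by (simp add: subgroups_Inter_pair)
    have PAQ: "P \<subseteq> A \<inter> Q" unfolding P(2) by (rule generate_subgroup_incl[OF EAQ AQ])
    have Pc: "P \<subseteq> carrier G" using PAQ Ac by blast
    have nVP: "normalizes G V' P" unfolding P(2) by (rule normalizes_generate_set[OF V'(1) Ec nVE])
    have Po: "rel_open G T P A"
      by (rule rel_open_mono[OF V'(4)]) (use A EP FE in auto)
    have Pcl: "closedin T P" by (rule rel_open_closedin[OF P(1) _ A(1,2) Po]) (use PAQ in blast)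
    have oneP: "{\<one>} \<subseteq> P" using P by (simp add: subgroup.one_closed)
    define A' where "A' = rel_residual G T {\<one>} P"
    have A': "subgroup A' G" "closedin T A'" "A' \<subseteq> P"
      unfolding A'_def using rel_residual_subgroup[OF P(1) oneP] rel_residual_closedin[OF P(1) oneP Pcl]
        rel_residual_subset[OF P(1) oneP] by auto
    have n1: "normalizes G V' {\<one>}" using V'c by (auto simp: normalizes_def)
    have nVA': "normalizes G V' A'" unfolding A'_def
      by (rule rel_residual_normalizes_other[OF V'(1) P(1) nVP n1 oneP])
    define VP where "VP = V' <#> P"
    have VP: "subgroup VP G" unfolding VP_def by (rule subgroup_mult_set[OF V'(1) P(1) nVP])
    have VPQ: "VP \<subseteq> Q" unfolding VP_def using V' PAQ Q by (auto intro!: subgroup.m_closed)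
    have nVPN: "normalizes G VP N" using normalizes_mono[OF B(4)] VPQ Q by blast
    have QVPN: "Q \<subseteq> VP <#> N"
      unfolding C(2)
    proof (rule generate_subgroup_incl)
      show "subgroup (VP <#> N) G"
        by (rule subgroup_mult_set[OF VP N(1) nVPN])
      show "C \<union> N \<subseteq> VP <#> N"
      proof
        fix c assume "c \<in> C \<union> N"
        then consider "c \<in> C" | "c \<in> N" by blast
        then show "c \<in> VP <#> N"
        proof cases
          case 1
          then obtain n f v where nfv: "n \<in> N" "f \<in> F" "v \<in> V'" "c = n \<otimes> f \<otimes> v" using CF by blast
          have cc: "n \<in> carrier G" "f \<in> carrier G" "v \<in> carrier G"
            using nfv F Ac Nc V'c by auto
          have "inv v \<otimes> f \<otimes> inv (inv v) \<in> E"
            using nfv FE subgroup.m_inv_closed[OF V'(1)] by (intro normalizesD[OF nVE]) auto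
          then have "v \<otimes> (inv v \<otimes> f \<otimes> inv (inv v)) \<in> VP" unfolding VP_def using nfv EP by blast
          then have fv: "f \<otimes> v \<in> VP" using cc by (simp add: word_simps)
          have "inv (f \<otimes> v) \<otimes> n \<otimes> (f \<otimes> v) \<in> N" by (rule normalizes_inv[OF VP nVPN fv nfv(1)])
          moreover have "c = (f \<otimes> v) \<otimes> (inv (f \<otimes> v) \<otimes> n \<otimes> (f \<otimes> v))"
            using nfv cc by (simp add: word_simps)
          ultimately show ?thesis using fv by blast
        next
          case 2
          then show ?thesis using subset_set_mult[OF VP N(1)] by blast
        qed
      qed
    qed
    define B' where "B' = rel_residual G T N Q"
    have B': "subgroup B' G" "closedin T B'" "N \<subseteq> B'" "B' \<subseteq> Q"
      unfolding B'_def using rel_residual_subgroup[OF Q(1,2)] rel_residual_closedin[OF Q(1,2) Qcl]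
        rel_residual_contains rel_residual_subset[OF Q(1,2)] by auto
    have nB'N: "normalizes G B' N" using normalizes_mono[OF B(4)] B' Q by blast
    have A'B': "A' \<subseteq> B'" unfolding A'_def B'_def
      by (rule rel_residual_mono[OF P(1) _ _ oneP]) (use PAQ N in \<open>auto simp: subgroup.one_closed\<close>)
    have V'Q: "rel_open G T V' Q" by (rule rel_open_mono[OF V'(4)]) (use Q in auto)
    have V'VP: "rel_open G T V' (V' <#> P)"
      by (rule rel_open_mono[OF V'Q]) (use VPQ in \<open>auto simp: VP_def\<close>)
    have V'subVP: "V' \<subseteq> VP" unfolding VP_def by (rule subset_set_mult[OF V'(1) P(1)])
    \<comment> \<open>This is the density hypothesis for the next pair \<open>A'\<close>,
      \<open>B'\<close>. An open subgroup \<open>D\<close> of \<open>V' P\<close> inside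
      \<open>W A'\<close> that is normalized by \<open>V'\<close> and \<open>P\<close> yields the
      member \<open>M = D N\<close> of the family defining \<open>B'\<close>; hence
      \<open>B'\<close> lies in \<open>W A' N\<close>.\<close>
    have dense': "\<exists>a\<in>A'. \<exists>n\<in>N. \<exists>w\<in>W. b = a \<otimes> n \<otimes> w" if W: "COS W" and b: "b \<in> B'" for W b
    proof -
      obtain D where D: "subgroup D G" "rel_open G T D VP" "normalizes G P D" "normalizes G V' D"
        "D \<subseteq> (V' \<inter> W) <#> A'"
        using rel_residual_compact_extension[OF P(1) Pcl Ek P(2) V'(1,2) nVP V'VP W]
        unfolding VP_def A'_def by blast
      have Dc: "D \<subseteq> carrier G" using D by (simp add: subgroup.subset)
      have DVP: "D \<subseteq> VP" using D(5) A' unfolding VP_def by blast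
      have nDN: "normalizes G D N" using normalizes_mono[OF nVPN DVP] .
      define M where "M = D <#> N"
      have M: "subgroup M G" unfolding M_def by (rule subgroup_mult_set[OF D(1) N(1) nDN])
      have DM: "D \<subseteq> M" and NM: "N \<subseteq> M" unfolding M_def by (rule subset_set_mult[OF D(1) N(1)])+
      have Mc: "M \<subseteq> carrier G" using M by (simp add: subgroup.subset)
      have "B' \<subseteq> M" unfolding B'_def
      proof (rule rel_residual_least[OF M NM])
        show "M \<subseteq> Q" unfolding M_def using DVP VPQ Q by (auto intro!: subgroup.m_closed)
        have "rel_open G T D V'" by (rule rel_open_mono[OF D(2)]) (use V'subVP in auto)
        then have "rel_open G T D Q" using rel_open_trans V'Q by blast
        then show "rel_open G T M Q" by (rule rel_open_mono) (use DM in auto)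
        have nVPD: "normalizes G VP D" unfolding VP_def
          by (rule normalizes_mult[OF V'c Pc Dc D(4,3)])
        have VPc: "VP \<subseteq> carrier G" using VP by (simp add: subgroup.subset)
        have "normalizes G VP M" unfolding M_def
          by (rule normalizes_mult_set[OF VPc Dc Nc nVPD nVPN])
        moreover have "normalizes G N M" by (rule normalizes_mono[OF normalizes_self[OF M] NM])
        ultimately have "normalizes G (VP <#> N) M"
          by (rule normalizes_mult[OF VPc Nc Mc])
        then show "normalizes G Q M" by (rule normalizes_mono[OF _ QVPN])
      qed
      \<comment> \<open>Inversion turns \<open>W A' N\<close> into \<open>N A' W\<close>, and
        normality of \<open>N\<close> turns this into the required order
        \<open>A' N W\<close>.\<close>
      moreover have "inv b \<in> B'" using b B' by (simp add: subgroup.m_inv_closed)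
      ultimately have "inv b \<in> M" by blast
      then obtain d n where d: "d \<in> D" "n \<in> N" "inv b = d \<otimes> n" unfolding M_def by blast
      then obtain v r where v: "v \<in> W" "v \<in> V'" "r \<in> A'" "d = v \<otimes> r" using D(5) by blast
      have c: "b \<in> carrier G" "n \<in> carrier G" "v \<in> carrier G" "r \<in> carrier G"
        using b B' Qc d Nc v V'c A' Pc by auto
      have ir: "inv r \<in> A'" "inv v \<in> W" "inv n \<in> N"
        using v A' cosD(1)[OF W] N d by (auto intro: subgroup.m_inv_closed)
      have "r \<in> B" using v A' PAQ Q by blast
      then have "r \<otimes> inv n \<otimes> inv r \<in> N" using normalizesD[OF B(4)] ir by blast
      moreover have "b = inv r \<otimes> (r \<otimes> inv n \<otimes> inv r) \<otimes> inv v"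
      proof -
        have "b = inv (inv b)" using c by simp
        also have "\<dots> = inv r \<otimes> (r \<otimes> inv n \<otimes> inv r) \<otimes> inv v"
          unfolding d(3) v(4) using c by (simp add: word_simps)
        finally show ?thesis .
      qed
      ultimately show ?thesis using ir by blast
    qed
    have "res_founded G T N B'"
    proof (rule step.IH[OF P(1) oneP _ Po Ek P_def, of B' "V' \<inter> B'", folded A'_def])
      show "subgroup (V' \<inter> B') G" using V' B' by (simp add: subgroups_Inter_pair)
      show "compactin T (V' \<inter> B')" using V' B' compactin_Int_closedin by blast
      show "rel_open G T (V' \<inter> B') B'" by (rule rel_open_mono[OF V'Q]) (use B' in auto)
      show "normalizes G (V' \<inter> B') A'" using normalizes_mono[OF nVA'] by blast
    qed (use A' A'B' B' nB'N dense' PAQ in auto)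
    then show "res_founded G T N (rel_residual G T N Q)" unfolding B'_def .
  qed
qed

end

section \<open>Elementary groups\<close>

lemma (in tdlc_grp) tdlc_closed_subgroup:
  assumes B: "subgroup B G" "closedin T B"
  shows "tdlc_grp (G\<lparr>carrier := B\<rparr>) (subtopology T B)"
proof -
  let ?H = "G\<lparr>carrier := B\<rparr>" and ?S = "subtopology T B"
  have Bc: "B \<subseteq> carrier G" using B by (simp add: subgroup.subset)
  interpret H: group ?H by (rule subgroup_imp_group[OF B(1)])
  have ts: "topspace ?S = B" using Bc topspace_eq by auto
  show ?thesis
  proof unfold_locales
    show "topspace ?S = carrier ?H" using ts by simp
    have "continuous_map (prod_topology ?S ?S) T (\<lambda>(x, y). x \<otimes> y)"
      unfolding subtopology_Times[symmetric] using mult_cont by (rule continuous_map_from_subtopology)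
    then have "continuous_map (prod_topology ?S ?S) ?S (\<lambda>(x, y). x \<otimes> y)"
      unfolding continuous_map_in_subtopology using subgroup.m_closed[OF B(1)] ts by auto
    then show "continuous_map (prod_topology ?S ?S) ?S (\<lambda>(x, y). x \<otimes>\<^bsub>?H\<^esub> y)" by simp
    have "continuous_map ?S T (\<lambda>x. inv x)"
      using inv_cont by (rule continuous_map_from_subtopology)
    then have "continuous_map ?S ?S (\<lambda>x. inv x)"
      unfolding continuous_map_in_subtopology using subgroup.m_inv_closed[OF B(1)] ts by auto
    then show "continuous_map ?S ?S (\<lambda>x. inv\<^bsub>?H\<^esub> x)"
      by (rule continuous_map_eq) (use ts m_inv_consistent[OF B(1)] in auto)
    show "Hausdorff_space ?S" using hausdorff by (rule Hausdorff_space_subtopology)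
    show "second_countable ?S" using second_count by (rule second_countable_subtopology)
    fix W assume W: "openin ?S W" "\<one>\<^bsub>?H\<^esub> \<in> W"
    then obtain W' where W': "openin T W'" "W = W' \<inter> B" by (auto simp: openin_subtopology)
    then obtain V where V: "COS V" "V \<subseteq> W'" using cos_basis W by auto
    have "compact_open_subgroup ?H ?S (V \<inter> B)"
      unfolding compact_open_subgroup_def
    proof (intro conjI)
      show "subgroup (V \<inter> B) ?H"
        by (rule subgroup_incl) (use V B cosD in \<open>auto simp: subgroups_Inter_pair\<close>)
      show "openin ?S (V \<inter> B)" using cosD(2)[OF V(1)] by (rule openin_subtopology_Int)
      show "compactin ?S (V \<inter> B)"
        using compactin_Int_closedin[OF cosD(3)[OF V(1)] B(2)] by (simp add: compactin_subtopology)
    qed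
    then show "\<exists>V. compact_open_subgroup ?H ?S V \<and> V \<subseteq> W" using V W' by blast
  qed
qed

text \<open>Since \<open>f\<close> is open and its kernel closed, the identity of \<open>Q\<close>
  is a closed point; distinct points are then separated by the tube lemma for
  \<open>inv x \<otimes> y\<close>. Compact open subgroups are images of compact open
  subgroups.\<close>

lemma (in tdlc_grp) tdlc_quotient:
  assumes Q: "topological_group Q S" and f: "f \<in> hom G Q" "f ` carrier G = carrier Q"
    and cont: "continuous_map T S f" and op: "open_map T S f"
    and ker: "closedin T {x \<in> carrier G. f x = \<one>\<^bsub>Q\<^esub>}"
  shows "tdlc_grp Q S"
proof -
  interpret Q: topgrp Q S using Q by (simp add: topological_group_iff_topgrp)
  interpret f: group_hom G Q f by unfold_locales (rule f)
  have "closedin S {\<one>\<^bsub>Q\<^esub>}"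
  proof -
    have "openin S (f ` (topspace T - {x \<in> carrier G. f x = \<one>\<^bsub>Q\<^esub>}))"
      using op ker by (auto simp: open_map_def)
    moreover have "f ` (topspace T - {x \<in> carrier G. f x = \<one>\<^bsub>Q\<^esub>}) = topspace S - {\<one>\<^bsub>Q\<^esub>}"
      using f(2) topspace_eq Q.topspace_eq by auto
    ultimately show ?thesis by (simp add: closedin_def Q.topspace_eq)
  qed
  have haus: "Hausdorff_space S"
    unfolding Hausdorff_space_def
  proof (intro allI impI)
    fix x y assume xy: "x \<in> topspace S \<and> y \<in> topspace S \<and> x \<noteq> y"
    have "continuous_map (prod_topology S S) S (\<lambda>z. inv\<^bsub>Q\<^esub> (fst z) \<otimes>\<^bsub>Q\<^esub> snd z)"
      by (intro Q.continuous_map_mult Q.continuous_map_inv continuous_map_fst continuous_map_snd)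
    moreover have "openin S (topspace S - {\<one>\<^bsub>Q\<^esub>})" using \<open>closedin S {\<one>\<^bsub>Q\<^esub>}\<close> by blast
    ultimately have o: "openin (prod_topology S S)
       {z \<in> topspace (prod_topology S S). inv\<^bsub>Q\<^esub> (fst z) \<otimes>\<^bsub>Q\<^esub> snd z \<in> topspace S - {\<one>\<^bsub>Q\<^esub>}}"
      by (rule openin_continuous_map_preimage)
    have c: "x \<in> carrier Q" "y \<in> carrier Q" using xy Q.topspace_eq by auto
    have "inv\<^bsub>Q\<^esub> x \<otimes>\<^bsub>Q\<^esub> y \<noteq> \<one>\<^bsub>Q\<^esub>"
      using xy c by (metis Q.inv_closed Q.inv_equality Q.inv_inv)
    then have "{x} \<times> {y} \<subseteq> {z \<in> topspace (prod_topology S S). inv\<^bsub>Q\<^esub> (fst z) \<otimes>\<^bsub>Q\<^esub> snd z \<in> topspace S - {\<one>\<^bsub>Q\<^esub>}}"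
      using c by (auto simp: Q.topspace_eq)
    note sub = this
    have "compactin S {x}" "compactin S {y}" using xy by auto
    then obtain A B where AB: "openin S A" "openin S B" "{x} \<subseteq> A" "{y} \<subseteq> B"
      "A \<times> B \<subseteq> {z \<in> topspace (prod_topology S S). inv\<^bsub>Q\<^esub> (fst z) \<otimes>\<^bsub>Q\<^esub> snd z \<in> topspace S - {\<one>\<^bsub>Q\<^esub>}}"
      by (rule Wallace_theorem_prod_topology[OF _ _ o sub])
    have "disjnt A B"
    proof (rule ccontr)
      assume "\<not> disjnt A B"
      then obtain z where z: "z \<in> A" "z \<in> B" by (auto simp: disjnt_def)
      then have "(z, z) \<in> A \<times> B" by blast
      then have "inv\<^bsub>Q\<^esub> z \<otimes>\<^bsub>Q\<^esub> z \<noteq> \<one>\<^bsub>Q\<^esub>" using AB(5) by auto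
      moreover have "z \<in> carrier Q" using z AB Q.openin_carrier by blast
      ultimately show False by simp
    qed
    then show "\<exists>U V. openin S U \<and> openin S V \<and> x \<in> U \<and> y \<in> V \<and> disjnt U V" using AB by blast
  qed
  have sc: "second_countable S"
    by (rule second_countable_open_map_image[OF cont op _ second_count])
      (use f topspace_eq Q.topspace_eq in simp)
  have "\<exists>V. compact_open_subgroup Q S V \<and> V \<subseteq> W" if W: "openin S W" "\<one>\<^bsub>Q\<^esub> \<in> W" for W
  proof -
    have "openin T {x \<in> topspace T. f x \<in> W}" using cont W(1) by (rule openin_continuous_map_preimage)
    moreover have "\<one> \<in> {x \<in> topspace T. f x \<in> W}" using W topspace_eq by simp
    ultimately obtain V where V: "COS V" "V \<subseteq> {x \<in> topspace T. f x \<in> W}" using cos_basis by blast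
    have "compact_open_subgroup Q S (f ` V)"
      unfolding compact_open_subgroup_def
      using f.subgroup_img_is_subgroup[OF cosD(1)[OF V(1)]] op cosD[OF V(1)] image_compactin[OF _ cont]
      by (auto simp: open_map_def)
    then show ?thesis using V by blast
  qed
  then show ?thesis by unfold_locales (auto intro: haus sc)
qed

text \<open>The last assumption says that \<open>f\<close> is open onto its image in the topology
  induced from \<open>Q\<close>. Open surjections and inclusions of closed subgroups are both of
  this kind, so one transfer argument serves for both.\<close>

locale tdlc_hom = A: tdlc_grp G T + B: tdlc_grp Q S
  for G :: "'a monoid" and T and Q :: "'b monoid" and S +
  fixes f :: "'a \<Rightarrow> 'b" and N :: "'a set"
  assumes f_hom: "f \<in> hom G Q" and f_cont: "continuous_map T S f"
    and N_eq: "N = {x \<in> carrier G. f x = \<one>\<^bsub>Q\<^esub>}"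
    and f_rel_open: "compact_open_subgroup G T V \<Longrightarrow>
      \<exists>V'. compact_open_subgroup Q S V' \<and> V' \<inter> f ` carrier G \<subseteq> f ` V"
begin

sublocale f: group_hom G Q f
  by unfold_locales (rule f_hom)

lemma mem_subgroup_if_image:
  assumes "subgroup D G" "N \<subseteq> D" "x \<in> carrier G" "f x \<in> f ` D"
  shows "x \<in> D"
proof -
  obtain d where d: "d \<in> D" "f x = f d" using assms by auto
  have dc: "d \<in> carrier G" using d assms by (simp add: subgroup.mem_carrier)
  have "inv\<^bsub>G\<^esub> d \<otimes>\<^bsub>G\<^esub> x \<in> N" using d dc assms by (simp add: N_eq)
  then have "d \<otimes>\<^bsub>G\<^esub> (inv\<^bsub>G\<^esub> d \<otimes>\<^bsub>G\<^esub> x) \<in> D" using assms d by (blast intro: subgroup.m_closed)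
  then show ?thesis using dc assms by (simp add: A.word_simps)
qed

lemma rel_open_image_iff:
  assumes D: "subgroup D G" "N \<subseteq> D" and H: "subgroup H G" "D \<subseteq> H"
  shows "rel_open Q S (f ` D) (f ` H) \<longleftrightarrow> rel_open G T D H"
proof
  assume "rel_open G T D H"
  then obtain V where V: "compact_open_subgroup G T V" "V \<inter> H \<subseteq> D" by (auto simp: rel_open_def)
  obtain V' where V': "compact_open_subgroup Q S V'" "V' \<inter> f ` carrier G \<subseteq> f ` V"
    using f_rel_open[OF V(1)] by blast
  have "V' \<inter> f ` H \<subseteq> f ` D"
  proof
    fix y assume "y \<in> V' \<inter> f ` H"
    then obtain h where h: "h \<in> H" "y = f h" "f h \<in> V'" by blast
    have hc: "h \<in> carrier G" using h H by (simp add: subgroup.mem_carrier)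
    then obtain v where v: "v \<in> V" "f h = f v" using V' h by blast
    have "v \<in> carrier G" using v A.cosD[OF V(1)] by blast
    then have "v \<in> H" using mem_subgroup_if_image[OF H(1), of v] D H h v by (metis imageI subset_trans)
    then show "y \<in> f ` D" using v V h by auto
  qed
  then show "rel_open Q S (f ` D) (f ` H)" using V' by (auto simp: rel_open_def)
next
  assume "rel_open Q S (f ` D) (f ` H)"
  then obtain V' where V': "compact_open_subgroup Q S V'" "V' \<inter> f ` H \<subseteq> f ` D" by (auto simp: rel_open_def)
  have "openin T {x \<in> topspace T. f x \<in> V'}"
    using f_cont B.cosD(2)[OF V'(1)] by (rule openin_continuous_map_preimage)
  moreover have "\<one>\<^bsub>G\<^esub> \<in> {x \<in> topspace T. f x \<in> V'}" using B.cosD(5)[OF V'(1)] A.topspace_eq by simp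
  ultimately obtain V where V: "compact_open_subgroup G T V" "V \<subseteq> {x \<in> topspace T. f x \<in> V'}"
    using A.cos_basis by blast
  have "V \<inter> H \<subseteq> D"
  proof
    fix x assume x: "x \<in> V \<inter> H"
    then have "f x \<in> f ` D" using V V' by blast
    then show "x \<in> D" using mem_subgroup_if_image[OF D] x A.cosD[OF V(1)] by blast
  qed
  then show "rel_open G T D H" using V by (auto simp: rel_open_def)
qed

definition pre :: "'a set \<Rightarrow> 'b set \<Rightarrow> 'a set" where
  "pre P D = {x \<in> P. f x \<in> D}"

lemma pre:
  assumes "subgroup P G" "subgroup D Q" "D \<subseteq> f ` P" "N \<subseteq> P"
  shows "subgroup (pre P D) G" "N \<subseteq> pre P D" "f ` pre P D = D" "pre P D \<subseteq> P"
proof -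
  have "pre P D = P \<inter> {x \<in> carrier G. f x \<in> D}"
    using assms(1) by (auto simp: pre_def subgroup.mem_carrier)
  then show "subgroup (pre P D) G"
    using A.subgroups_Inter_pair[OF assms(1) f.subgroup_preimage[OF assms(2)]] by simp
  show "N \<subseteq> pre P D" using assms subgroup.one_closed[OF assms(2)] by (auto simp: pre_def N_eq)
  show "f ` pre P D = D" using assms by (auto simp: pre_def)
qed (auto simp: pre_def)

lemma rel_residual_image:
  assumes P: "subgroup P G" "N \<subseteq> P"
  shows "f ` rel_residual G T N P = rel_residual Q S {\<one>\<^bsub>Q\<^esub>} (f ` P)"
proof
  have Pc: "P \<subseteq> carrier G" using P by (simp add: subgroup.subset)
  have fP: "subgroup (f ` P) Q" using f.subgroup_img_is_subgroup[OF P(1)] .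
  show "f ` rel_residual G T N P \<subseteq> rel_residual Q S {\<one>\<^bsub>Q\<^esub>} (f ` P)"
    unfolding rel_residual_def[of Q]
  proof clarify
    fix x D assume x: "x \<in> rel_residual G T N P"
      and D: "subgroup D Q" "{\<one>\<^bsub>Q\<^esub>} \<subseteq> D" "D \<subseteq> f ` P" "rel_open Q S D (f ` P)" "normalizes Q (f ` P) D"
    note p = pre[OF P(1) D(1) D(3) P(2)]
    have "rel_residual G T N P \<subseteq> pre P D"
    proof (rule A.rel_residual_least[OF p(1,2,4)])
      show "rel_open G T (pre P D) P" using rel_open_image_iff[OF p(1,2) P(1) p(4)] D p by simp
      show "normalizes G P (pre P D)" unfolding normalizes_def
      proof (intro ballI)
        fix h s assume h: "h \<in> P" and s: "s \<in> pre P D"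
        have c: "h \<in> carrier G" "s \<in> carrier G" "s \<in> P" using h s Pc by (auto simp: pre_def)
        have "f h \<otimes>\<^bsub>Q\<^esub> f s \<otimes>\<^bsub>Q\<^esub> inv\<^bsub>Q\<^esub> (f h) \<in> D"
          by (rule normalizesD[OF D(5)]) (use h s in \<open>auto simp: pre_def\<close>)
        then show "h \<otimes>\<^bsub>G\<^esub> s \<otimes>\<^bsub>G\<^esub> inv\<^bsub>G\<^esub> h \<in> pre P D"
          using c h P by (simp add: pre_def subgroup.m_closed subgroup.m_inv_closed)
      qed
    qed
    then show "f x \<in> D" using x by (auto simp: pre_def)
  qed
  have one: "{\<one>\<^bsub>Q\<^esub>} \<subseteq> f ` P" using fP by (simp add: subgroup.one_closed)
  show "rel_residual Q S {\<one>\<^bsub>Q\<^esub>} (f ` P) \<subseteq> f ` rel_residual G T N P"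
  proof
    fix y assume y: "y \<in> rel_residual Q S {\<one>\<^bsub>Q\<^esub>} (f ` P)"
    then obtain x where x: "x \<in> P" "y = f x" using B.rel_residual_subset[OF fP one] by blast
    have "x \<in> D" if D: "subgroup D G" "N \<subseteq> D" "D \<subseteq> P" "rel_open G T D P" "normalizes G P D" for D
    proof -
      have "rel_residual Q S {\<one>\<^bsub>Q\<^esub>} (f ` P) \<subseteq> f ` D"
      proof (rule B.rel_residual_least)
        show fD: "subgroup (f ` D) Q" using f.subgroup_img_is_subgroup[OF D(1)] .
        show "{\<one>\<^bsub>Q\<^esub>} \<subseteq> f ` D" using fD by (simp add: subgroup.one_closed)
        show "rel_open Q S (f ` D) (f ` P)" using rel_open_image_iff[OF D(1,2) P(1) D(3)] D by simp
        show "normalizes Q (f ` P) (f ` D)" unfolding normalizes_def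
        proof clarify
          fix p d assume pd: "p \<in> P" "d \<in> D"
          have "f (p \<otimes>\<^bsub>G\<^esub> d \<otimes>\<^bsub>G\<^esub> inv\<^bsub>G\<^esub> p) \<in> f ` D" using normalizesD[OF D(5) pd] by blast
          then show "f p \<otimes>\<^bsub>Q\<^esub> f d \<otimes>\<^bsub>Q\<^esub> inv\<^bsub>Q\<^esub> (f p) \<in> f ` D"
            using pd Pc D by (auto simp: subset_iff)
        qed
      qed (use D in blast)
      then show "x \<in> D" using y x mem_subgroup_if_image[OF D(1,2)] Pc by blast
    qed
    then show "y \<in> f ` rel_residual G T N P" using x by (auto simp: rel_residual_def)
  qed
qed

lemma compact_lift:
  assumes C: "compactin S C" "C \<subseteq> f ` carrier G"
  obtains C' where "compactin T C'" "f ` C' = C"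
proof -
  obtain V where V: "compact_open_subgroup G T V" using A.cos_ex by blast
  obtain V' where V': "compact_open_subgroup Q S V'" "V' \<inter> f ` carrier G \<subseteq> f ` V"
    using f_rel_open[OF V] by blast
  obtain F where F: "finite F" "F \<subseteq> C" "\<And>c. c \<in> C \<Longrightarrow> \<exists>y\<in>F. inv\<^bsub>Q\<^esub> y \<otimes>\<^bsub>Q\<^esub> c \<in> V'"
    using B.compactin_cosets[OF C(1) V'(1)] by metis
  have "F \<subseteq> f ` carrier G" using F C by blast
  then obtain F' where F': "finite F'" "F' \<subseteq> carrier G" "F = f ` F'"
    using finite_subset_image[OF F(1)] by metis
  define E where "E = (\<Union>g\<in>F'. (\<lambda>x. g \<otimes>\<^bsub>G\<^esub> x) ` V)"
  have "compactin T E" unfolding E_def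
    using F' A.cosD(3)[OF V] image_compactin[OF _ A.continuous_map_lmult]
    by (intro compactin_Union) auto
  moreover have "closedin T {x \<in> topspace T. f x \<in> C}"
    using f_cont B.compactin_closedin[OF C(1)] by (rule closedin_continuous_map_preimage)
  ultimately have "compactin T (E \<inter> {x \<in> topspace T. f x \<in> C})" by (rule A.compactin_Int_closedin)
  moreover have "f ` (E \<inter> {x \<in> topspace T. f x \<in> C}) = C"
  proof
    show "C \<subseteq> f ` (E \<inter> {x \<in> topspace T. f x \<in> C})"
    proof
      fix c assume c: "c \<in> C"
      then obtain g where g: "g \<in> F'" "inv\<^bsub>Q\<^esub> (f g) \<otimes>\<^bsub>Q\<^esub> c \<in> V'" using F F' by blast
      have gc: "g \<in> carrier G" using g F' by blast
      obtain x where x: "x \<in> carrier G" "c = f x" using c C by blast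
      have "inv\<^bsub>Q\<^esub> (f g) \<otimes>\<^bsub>Q\<^esub> c = f (inv\<^bsub>G\<^esub> g \<otimes>\<^bsub>G\<^esub> x)" using x gc by simp
      moreover have "f (inv\<^bsub>G\<^esub> g \<otimes>\<^bsub>G\<^esub> x) \<in> f ` carrier G" using x gc by blast
      ultimately have "inv\<^bsub>Q\<^esub> (f g) \<otimes>\<^bsub>Q\<^esub> c \<in> f ` V" using V' g by auto
      then obtain v where v: "v \<in> V" "inv\<^bsub>Q\<^esub> (f g) \<otimes>\<^bsub>Q\<^esub> c = f v" by blast
      have vc: "v \<in> carrier G" using v A.cosD[OF V] by blast
      have "f (g \<otimes>\<^bsub>G\<^esub> v) = f g \<otimes>\<^bsub>Q\<^esub> (inv\<^bsub>Q\<^esub> (f g) \<otimes>\<^bsub>Q\<^esub> c)" using v gc vc by simp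
      also have "\<dots> = c" using gc x by (simp add: B.word_simps)
      finally have "f (g \<otimes>\<^bsub>G\<^esub> v) = c" .
      moreover have "g \<otimes>\<^bsub>G\<^esub> v \<in> E" unfolding E_def using g v by blast
      ultimately show "c \<in> f ` (E \<inter> {x \<in> topspace T. f x \<in> C})"
        using c gc vc A.topspace_eq by (intro image_eqI[of _ f "g \<otimes>\<^bsub>G\<^esub> v"]) auto
    qed
  qed auto
  ultimately show ?thesis using that by blast
qed

lemma N_subgroup: "subgroup N G"
  using f.subgroup_kernel by (simp add: N_eq kernel_def)

lemma founded_image:
  assumes "res_founded G T N B" "subgroup B G" "N \<subseteq> B"
  shows "res_founded Q S {\<one>\<^bsub>Q\<^esub>} (f ` B)"
  using assms
proof (induction rule: res_founded.induct)
  case base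
  have "f ` N = {\<one>\<^bsub>Q\<^esub>}" using subgroup.one_closed[OF N_subgroup] by (auto simp: N_eq image_iff)
  then show ?case using res_founded.base by metis
next
  case (step B)
  show ?case
  proof (rule res_founded.step)
    fix P C
    assume P: "subgroup P Q" "{\<one>\<^bsub>Q\<^esub>} \<subseteq> P" "P \<subseteq> f ` B" "rel_open Q S P (f ` B)"
      and C: "compactin S C" "P = generate Q (C \<union> {\<one>\<^bsub>Q\<^esub>})"
    note p = pre[OF step.prems(1) P(1) P(3) step.prems(2)]
    have Bc: "B \<subseteq> carrier G" using step.prems by (simp add: subgroup.subset)
    have CP: "C \<subseteq> P" using C by (auto intro: generate.incl)
    have "C \<subseteq> f ` carrier G" using CP P Bc by blast
    then obtain C' where C': "compactin T C'" "f ` C' = C" by (rule compact_lift[OF C(1)])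
    have C'c: "C' \<subseteq> carrier G" using A.compactin_carrier C' by blast
    have Nc: "N \<subseteq> carrier G" using N_subgroup by (simp add: subgroup.subset)
    have cn: "C' \<union> N \<subseteq> carrier G" using C'c Nc by blast
    have gen: "subgroup (generate G (C' \<union> N)) G" "N \<subseteq> generate G (C' \<union> N)"
      using A.generate_is_subgroup[OF cn] by (auto intro: generate.incl)
    have fgen: "f ` generate G (C' \<union> N) = P"
    proof -
      have "f ` (C' \<union> N) = C \<union> {\<one>\<^bsub>Q\<^esub>}"
        using C' subgroup.one_closed[OF N_subgroup] by (auto simp: N_eq image_Un image_iff)
      then show ?thesis using f.generate_img[OF cn] C by simp
    qed
    \<comment> \<open>The preimage of a compactly generated subgroup is compactly generated only
      modulo the kernel, which is exactly what \<open>res_founded G T N\<close> deals with.\<close>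
    have eq: "pre B P = generate G (C' \<union> N)"
    proof
      show "pre B P \<subseteq> generate G (C' \<union> N)"
        using mem_subgroup_if_image[OF gen] fgen Bc by (auto simp: pre_def)
      show "generate G (C' \<union> N) \<subseteq> pre B P"
      proof
        fix x assume x: "x \<in> generate G (C' \<union> N)"
        then have "f x \<in> P" using fgen by blast
        moreover have "x \<in> carrier G" using x gen(1) by (simp add: subgroup.mem_carrier)
        ultimately show "x \<in> pre B P"
          using mem_subgroup_if_image[OF step.prems, of x] P by (auto simp: pre_def)
      qed
    qed
    have o: "rel_open G T (pre B P) B"
      using rel_open_image_iff[OF p(1,2) step.prems(1) p(4)] P p by simp
    have "res_founded Q S {\<one>\<^bsub>Q\<^esub>} (f ` rel_residual G T N (pre B P))"
      by (rule step.IH[OF p(1,2,4) o C'(1) eq A.rel_residual_subgroup[OF p(1,2)] A.rel_residual_contains])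
    then show "res_founded Q S {\<one>\<^bsub>Q\<^esub>} (rel_residual Q S {\<one>\<^bsub>Q\<^esub>} P)"
      using rel_residual_image[OF p(1,2)] p by simp
  qed
qed

lemma founded_preimage:
  assumes "res_founded Q S {\<one>\<^bsub>Q\<^esub>} B'" "f ` B = B'" "subgroup B G" "N \<subseteq> B"
  shows "res_founded G T N B"
  using assms
proof (induction arbitrary: B rule: res_founded.induct)
  case base
  have "B \<subseteq> N" using base by (auto simp: N_eq subgroup.mem_carrier)
  then have "B = N" using base by blast
  then show ?case using res_founded.base by metis
next
  case (step B' B)
  show ?case
  proof (rule res_founded.step)
    fix P C
    assume P: "subgroup P G" "N \<subseteq> P" "P \<subseteq> B" "rel_open G T P B"
      and C: "compactin T C" "P = generate G (C \<union> N)"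
    have fP: "subgroup (f ` P) Q" using f.subgroup_img_is_subgroup[OF P(1)] .
    have cn: "C \<union> N \<subseteq> carrier G" using A.compactin_carrier[OF C(1)] N_subgroup by (simp add: subgroup.subset)
    have fC: "compactin S (f ` C)" using image_compactin[OF C(1) f_cont] .
    have "f ` (C \<union> N) = f ` C \<union> {\<one>\<^bsub>Q\<^esub>}"
      using subgroup.one_closed[OF N_subgroup] by (auto simp: N_eq image_Un image_iff)
    then have g: "f ` P = generate Q (f ` C \<union> {\<one>\<^bsub>Q\<^esub>})" using f.generate_img[OF cn] C by simp
    have o: "rel_open Q S (f ` P) B'" using rel_open_image_iff[OF P(1,2) step.prems(2) P(3)] P step.prems by simp
    show "res_founded G T N (rel_residual G T N P)"
      by (rule step.IH[OF fP _ _ o fC g rel_residual_image[OF P(1,2)] A.rel_residual_subgroup[OF P(1,2)]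
            A.rel_residual_contains])
        (use fP P step.prems in \<open>auto simp: subgroup.one_closed\<close>)
  qed
qed

end

lemma (in tdlc_grp) tdlc_hom_surj:
  assumes Q: "tdlc_grp Q S" and f: "f \<in> hom G Q" "f ` carrier G = carrier Q"
    and cont: "continuous_map T S f" and op: "open_map T S f"
  shows "tdlc_hom G T Q S f {x \<in> carrier G. f x = \<one>\<^bsub>Q\<^esub>}"
proof -
  interpret Q: tdlc_grp Q S by (rule Q)
  interpret f: group_hom G Q f by unfold_locales (rule f)
  show ?thesis
  proof unfold_locales
    fix V assume V: "COS V"
    have "compact_open_subgroup Q S (f ` V)"
      unfolding compact_open_subgroup_def
      using f.subgroup_img_is_subgroup[OF cosD(1)[OF V]] op cosD[OF V] image_compactin[OF _ cont]
      by (auto simp: open_map_def)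
    then show "\<exists>V'. compact_open_subgroup Q S V' \<and> V' \<inter> f ` carrier G \<subseteq> f ` V" by blast
  qed (use f cont in auto)
qed

lemma (in tdlc_grp) tdlc_hom_subgroup:
  assumes B: "subgroup B G" "closedin T B"
  shows "tdlc_hom (G\<lparr>carrier := B\<rparr>) (subtopology T B) G T (\<lambda>x. x) {\<one>}"
proof -
  interpret H: tdlc_grp "G\<lparr>carrier := B\<rparr>" "subtopology T B" by (rule tdlc_closed_subgroup[OF B])
  have Bc: "B \<subseteq> carrier G" using B by (simp add: subgroup.subset)
  show ?thesis
  proof unfold_locales
    show "(\<lambda>x. x) \<in> hom (G\<lparr>carrier := B\<rparr>) G" using Bc by (auto simp: hom_def)
    show "continuous_map (subtopology T B) T (\<lambda>x. x)"
      by (rule continuous_map_from_subtopology) simp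
    show "{\<one>} = {x \<in> carrier (G\<lparr>carrier := B\<rparr>). x = \<one>}" using B by (auto simp: subgroup.one_closed)
    fix V assume V: "compact_open_subgroup (G\<lparr>carrier := B\<rparr>) (subtopology T B) V"
    then obtain W where W: "openin T W" "V = W \<inter> B" using H.cosD(2)[OF V] by (auto simp: openin_subtopology)
    moreover have "\<one> \<in> W" using H.cosD(5)[OF V] W by simp
    ultimately obtain V' where "COS V'" "V' \<subseteq> W" using cos_basis by blast
    then show "\<exists>V'. COS V' \<and> V' \<inter> (\<lambda>x. x) ` carrier (G\<lparr>carrier := B\<rparr>) \<subseteq> (\<lambda>x. x) ` V" using W by auto
  qed
qed

text \<open>Passes between \<open>B\<close> as a group of its own, the form in which the elementary
  class speaks of it, and \<open>B\<close> as a subset of \<open>G\<close>, the form used in the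
  permanence lemmas.\<close>

lemma (in tdlc_grp) founded_subgroup_iff:
  assumes B: "subgroup B G" "closedin T B"
  shows "res_founded (G\<lparr>carrier := B\<rparr>) (subtopology T B) {\<one>} B \<longleftrightarrow> res_founded G T {\<one>} B"
proof -
  interpret h: tdlc_hom "G\<lparr>carrier := B\<rparr>" "subtopology T B" G T "\<lambda>x. x" "{\<one>}"
    by (rule tdlc_hom_subgroup[OF B])
  have s: "subgroup B (G\<lparr>carrier := B\<rparr>)" using h.A.subgroup_self by simp
  show ?thesis
    using h.founded_image[OF _ s] h.founded_preimage[OF _ _ s] B by (auto simp: subgroup.one_closed)
qed

text \<open>Composes the projection with the isomorphism onto the copy \<open>Q\<close>. The
  projection is open because the saturation of \<open>U\<close> is the open set
  \<open>N U\<close>.\<close>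

lemma quotient_map_hom:
  assumes G: "topological_group G T" and N: "N \<lhd> G"
    and q: "quotient_map T S' (\<lambda>g. N #>\<^bsub>G\<^esub> g)" and iso: "topgroup_isomorphic (G Mod N) S' Q S"
  obtains f where "f \<in> hom G Q" "f ` carrier G = carrier Q" "continuous_map T S f" "open_map T S f"
    "N = {x \<in> carrier G. f x = \<one>\<^bsub>Q\<^esub>}"
proof -
  interpret topgrp G T using G by (simp add: topological_group_iff_topgrp)
  interpret N: normal N G by (rule N)
  obtain h where h: "h \<in> iso (G Mod N) Q" "homeomorphic_map S' S h"
    and tg: "topological_group (G Mod N) S'" "topological_group Q S"
    using iso by (auto simp: topgroup_isomorphic_def)
  let ?p = "\<lambda>g. N #>\<^bsub>G\<^esub> g"
  let ?f = "h \<circ> ?p"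
  have hp: "?p \<in> hom G (G Mod N)" by (rule N.r_coset_hom_Mod)
  have hh: "h \<in> hom (G Mod N) Q" "bij_betw h (carrier (G Mod N)) (carrier Q)" using h by (auto simp: iso_def)
  have pim: "?p ` carrier G = carrier (G Mod N)" by (auto simp: FactGroup_def RCOSETS_def)
  have Qg: "group Q" and Mg: "group (G Mod N)" using tg by (auto simp: topological_group_def)
  have ker: "x \<in> N \<longleftrightarrow> ?f x = \<one>\<^bsub>Q\<^esub>" if x: "x \<in> carrier G" for x
  proof -
    have "h \<one>\<^bsub>G Mod N\<^esub> = \<one>\<^bsub>Q\<^esub>" using hom_one[OF hh(1) Mg Qg] .
    moreover have "?p x \<in> carrier (G Mod N)" using pim x by blast
    moreover have "\<one>\<^bsub>G Mod N\<^esub> \<in> carrier (G Mod N)" using Mg group.is_monoid monoid.one_closed by blast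
    ultimately have "?f x = \<one>\<^bsub>Q\<^esub> \<longleftrightarrow> ?p x = \<one>\<^bsub>G Mod N\<^esub>"
      using hh(2) by (metis bij_betw_def comp_apply inj_on_eq_iff)
    also have "\<dots> \<longleftrightarrow> N #>\<^bsub>G\<^esub> x = N" by (simp add: FactGroup_def)
    also have "\<dots> \<longleftrightarrow> x \<in> N"
      using coset_join1 coset_join2 N.is_subgroup N.subset x by metis
    finally show ?thesis by simp
  qed
  have op: "open_map T S' ?p" unfolding open_map_def
  proof (intro allI impI)
    fix U assume U: "openin T U"
    have Uc: "U \<subseteq> carrier G" using openin_carrier[OF U] .
    have eq: "{x \<in> topspace T. ?p x \<in> ?p ` U} = N <#>\<^bsub>G\<^esub> U"
    proof (intro Set.equalityI subsetI)
      fix x assume "x \<in> {x \<in> topspace T. ?p x \<in> ?p ` U}"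
      then obtain u where u: "u \<in> U" "x \<in> carrier G" "?p x = ?p u" using topspace_eq by auto
      then have "x \<in> N #>\<^bsub>G\<^esub> u" using rcos_self[OF u(2) N.is_subgroup] by simp
      then show "x \<in> N <#>\<^bsub>G\<^esub> U" using u by (auto simp: r_coset_def)
    next
      fix x assume "x \<in> N <#>\<^bsub>G\<^esub> U"
      then obtain n u where x: "x = n \<otimes>\<^bsub>G\<^esub> u" "n \<in> N" "u \<in> U" by blast
      then have "x \<in> N #>\<^bsub>G\<^esub> u" by (auto simp: r_coset_def)
      moreover have "u \<in> carrier G" using x Uc by blast
      ultimately have "?p x = ?p u" using repr_independence[OF _ _ N.is_subgroup] by metis
      moreover have "x \<in> carrier G" using x Uc N.subset by auto
      ultimately show "x \<in> {x \<in> topspace T. ?p x \<in> ?p ` U}" using x topspace_eq by auto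
    qed
    have o: "openin T (N <#>\<^bsub>G\<^esub> U)"
      by (rule openin_mult_right[OF N.subset U])
    have sub: "?p ` U \<subseteq> topspace S'" using pim Uc tg by (auto simp: topological_group_def)
    have "openin T {x \<in> topspace T. ?p x \<in> W} \<longleftrightarrow> openin S' W" if "W \<subseteq> topspace S'" for W
      using q that by (simp add: quotient_map_def)
    from this[OF sub] show "openin S' (?p ` U)" unfolding eq using o by simp
  qed
  show ?thesis
  proof
    show "?f \<in> hom G Q" using Group.hom_compose[OF hp hh(1)] by simp
    show "?f ` carrier G = carrier Q" using pim hh(2) by (metis bij_betw_def image_comp)
    show "continuous_map T S ?f"
      using continuous_map_compose[OF quotient_imp_continuous_map[OF q] homeomorphic_imp_continuous_map[OF h(2)]] .
    show "open_map T S ?f"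
      using open_map_compose[OF op homeomorphic_imp_open_map[OF h(2)]] .
    show "N = {x \<in> carrier G. ?f x = \<one>\<^bsub>Q\<^esub>}" using ker N.subset by blast
  qed
qed

section \<open>Well-foundedness of elementary groups\<close>

definition founded_tdlc :: "'a monoid \<Rightarrow> 'a topology \<Rightarrow> bool" where
  "founded_tdlc G T \<longleftrightarrow> tdlc_grp G T \<and> res_founded G T {\<one>\<^bsub>G\<^esub>} (carrier G)"

lemma (in tdlc_grp) closedin_one: "closedin T {\<one>}"
  by (rule closedin_Hausdorff_singleton[OF hausdorff]) (simp add: topspace_eq)

lemma (in tdlc_grp) mem_all_cos:
  assumes "x \<in> carrier G" "\<And>V. COS V \<Longrightarrow> x \<in> V"
  shows "x = \<one>"
proof -
  have "x \<in> {\<one>}" by (rule closedin_cosI[OF closedin_one assms(1)]) (use assms in \<open>auto intro!: bexI[of _ x]\<close>)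
  then show ?thesis by simp
qed

lemma (in tdlc_grp) carrier_facts [simp]: "subgroup (carrier G) G" "closedin T (carrier G)"
  using subgroup_self closedin_topspace[of T] by (auto simp: topspace_eq)

text \<open>All residuals are trivial already after one step. This disposes of both kinds of
  generators of the elementary class, the profinite and the discrete groups.\<close>

lemma (in tdlc_grp) founded_if_small_normal:
  assumes "\<And>V. COS V \<Longrightarrow> \<exists>W. COS W \<and> W \<subseteq> V \<and> normalizes G (carrier G) W"
  shows "res_founded G T {\<one>} (carrier G)"
proof (rule res_founded.step)
  fix P C assume P: "subgroup P G" "{\<one>} \<subseteq> P" "P \<subseteq> carrier G"
  have "rel_residual G T {\<one>} P \<subseteq> {\<one>}"
  proof
    fix x assume x: "x \<in> rel_residual G T {\<one>} P"
    have "x = \<one>"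
    proof (rule mem_all_cos)
      show "x \<in> carrier G" using x rel_residual_subset[OF P(1,2)] P by blast
      fix V assume "COS V"
      then obtain W where W: "COS W" "W \<subseteq> V" "normalizes G (carrier G) W" using assms by blast
      have "rel_residual G T {\<one>} P \<subseteq> W \<inter> P"
      proof (rule rel_residual_least)
        show "subgroup (W \<inter> P) G" using cosD[OF W(1)] P by (simp add: subgroups_Inter_pair)
        show "rel_open G T (W \<inter> P) P" using W by (auto simp: rel_open_def)
        show "normalizes G P (W \<inter> P)"
          by (intro normalizes_Int normalizes_self P normalizes_mono[OF W(3)])
      qed (use cosD[OF W(1)] P in auto)
      then show "x \<in> V" using x W by blast
    qed
    then show "x \<in> {\<one>}" by simp
  qed
  then have "rel_residual G T {\<one>} P = {\<one>}" using rel_residual_contains by blast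
  then show "res_founded G T {\<one>} (rel_residual G T {\<one>} P)" using res_founded.base by metis
qed

lemma founded_tdlc_iso:
  assumes G: "founded_tdlc G T" and i: "topgroup_isomorphic G T H S"
  shows "founded_tdlc H S"
proof -
  interpret tdlc_grp G T using G by (simp add: founded_tdlc_def)
  obtain h where h: "h \<in> iso G H" "homeomorphic_map T S h" and tg: "topological_group H S"
    using i by (auto simp: topgroup_isomorphic_def)
  have hh: "h \<in> hom G H" "h ` carrier G = carrier H" "inj_on h (carrier G)"
    using h by (auto simp: iso_def bij_betw_def)
  have Hg: "group H" using tg by (simp add: topological_group_def)
  have "h \<one>\<^bsub>G\<^esub> = \<one>\<^bsub>H\<^esub>" using hom_one[OF hh(1) _ Hg] is_group by simp
  then have ker: "{x \<in> carrier G. h x = \<one>\<^bsub>H\<^esub>} = {\<one>\<^bsub>G\<^esub>}" by (auto intro!: inj_onD[OF hh(3)])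
  have c: "continuous_map T S h" "open_map T S h"
    using h(2) by (auto intro: homeomorphic_imp_continuous_map homeomorphic_imp_open_map)
  have H: "tdlc_grp H S" using tdlc_quotient[OF tg hh(1,2) c] ker closedin_one by simp
  interpret h: tdlc_hom G T H S h "{\<one>\<^bsub>G\<^esub>}" using tdlc_hom_surj[OF H hh(1,2) c] ker by simp
  show ?thesis using h.founded_image[of "carrier G"] G H hh by (auto simp: founded_tdlc_def)
qed

lemma elementary_coded_founded: "elementary_coded G T \<Longrightarrow> founded_tdlc G T"
proof (induction rule: elementary_coded.induct)
  case (profinite G T)
  interpret tdlc_grp G T using profinite tdlcsc_group_imp_tdlc_grp by blast
  have k: "compactin T (carrier G)" using profinite by (simp add: compact_space_def topspace_eq)
  have "res_founded G T {\<one>\<^bsub>G\<^esub>} (carrier G)"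
  proof (rule founded_if_small_normal)
    fix V assume V: "COS V"
    define W where "W = conj_core G (carrier G) V"
    have W: "subgroup W G" "W \<subseteq> V" "normalizes G (carrier G) W" "rel_open G T W (carrier G)"
      unfolding W_def using conj_core_subgroup[OF _ cosD(1)[OF V]] conj_core_subset[OF carrier_facts(1)]
        conj_core_normalizes[OF carrier_facts(1)]
        rel_open_conj_core[OF carrier_facts(1) k normalizes_self[OF carrier_facts(1)] _ rel_open_cos[OF V]]
      by auto
    obtain V' where "COS V'" "V' \<inter> carrier G \<subseteq> W" using W(4) by (auto simp: rel_open_def)
    then have "openin T W" using subgroup_openin[OF W(1)] cosD by (metis Int_absorb2)
    moreover have "compactin T W"
      using closed_compactin[OF cosD(3)[OF V] W(2) open_subgroup_closedin[OF W(1) calculation]] .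
    ultimately show "\<exists>W. COS W \<and> W \<subseteq> V \<and> normalizes G (carrier G) W"
      using W by (auto simp: compact_open_subgroup_def)
  qed
  then show ?case by (simp add: founded_tdlc_def tdlc_grp_axioms)
next
  case (discrete G T)
  interpret tdlc_grp G T using discrete tdlcsc_group_imp_tdlc_grp by blast
  have "res_founded G T {\<one>\<^bsub>G\<^esub>} (carrier G)"
  proof (rule founded_if_small_normal)
    fix V assume V: "COS V"
    have "COS {\<one>\<^bsub>G\<^esub>}" using discrete triv_subgroup by (auto simp: compact_open_subgroup_def)
    moreover have "normalizes G (carrier G) {\<one>\<^bsub>G\<^esub>}" by (auto simp: normalizes_def)
    ultimately show "\<exists>W. COS W \<and> W \<subseteq> V \<and> normalizes G (carrier G) W" using cosD(5)[OF V] by blast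
  qed
  then show ?case by (simp add: founded_tdlc_def tdlc_grp_axioms)
next
  case (isomorphic G T H S)
  then show ?case using founded_tdlc_iso by blast
next
  case (extension G T N S' Q S)
  interpret tdlc_grp G T using extension tdlcsc_group_imp_tdlc_grp by blast
  interpret N: normal N G by (rule extension.hyps(2))
  have Q: "tdlc_grp Q S" "res_founded Q S {\<one>\<^bsub>Q\<^esub>} (carrier Q)" using extension by (auto simp: founded_tdlc_def)
  have N: "res_founded G T {\<one>\<^bsub>G\<^esub>} N"
    using extension founded_subgroup_iff[OF N.is_subgroup extension.hyps(3)] by (auto simp: founded_tdlc_def)
  have tg: "topological_group G T" using topgrp_axioms by (simp add: topological_group_iff_topgrp)
  obtain f where f: "f \<in> hom G Q" "f ` carrier G = carrier Q" "continuous_map T S f" "open_map T S f"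
    "N = {x \<in> carrier G. f x = \<one>\<^bsub>Q\<^esub>}"
    by (rule quotient_map_hom[OF tg extension.hyps(2) extension.hyps(5) extension.hyps(6)])
  interpret f: tdlc_hom G T Q S f N
    by (rule tdlc_hom_surj[OF Q(1) f(1-4), folded f(5)])
  have "res_founded G T N (carrier G)"
    by (rule f.founded_preimage[OF Q(2) f(2)]) (simp_all add: N.subset)
  moreover have "normalizes G (carrier G) N"
    using N.inv_op_closed2 by (auto simp: normalizes_def)
  ultimately have "res_founded G T {\<one>\<^bsub>G\<^esub>} (carrier G)"
    by (intro founded_extension[OF _ _ _ N.subset _ N.is_subgroup extension.hyps(3) N]) auto
  then show ?case by (simp add: founded_tdlc_def tdlc_grp_axioms)
next
  case (closed_subgroup G T H)
  interpret tdlc_grp G T using closed_subgroup by (simp add: founded_tdlc_def)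
  have "res_founded G T {\<one>\<^bsub>G\<^esub>} H"
    using founded_closed_subgroup[OF _ carrier_facts closed_subgroup.hyps(2,3)] closed_subgroup
    by (auto simp: founded_tdlc_def subgroup.subset)
  then show ?case
    using founded_subgroup_iff[OF closed_subgroup.hyps(2,3)] tdlc_closed_subgroup[OF closed_subgroup.hyps(2,3)]
    by (simp add: founded_tdlc_def)
next
  case (quotient G T N S' Q S)
  interpret tdlc_grp G T using quotient by (simp add: founded_tdlc_def)
  interpret N: normal N G by (rule quotient.hyps(2))
  have tg: "topological_group G T" using topgrp_axioms by (simp add: topological_group_iff_topgrp)
  obtain f where f: "f \<in> hom G Q" "f ` carrier G = carrier Q" "continuous_map T S f" "open_map T S f"
    "N = {x \<in> carrier G. f x = \<one>\<^bsub>Q\<^esub>}"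
    by (rule quotient_map_hom[OF tg quotient.hyps(2) quotient.hyps(4) quotient.hyps(5)])
  have tQ: "topological_group Q S" using quotient.hyps(5) by (simp add: topgroup_isomorphic_def)
  have Q: "tdlc_grp Q S" by (rule tdlc_quotient[OF tQ f(1-4), folded f(5), OF quotient.hyps(3)])
  interpret f: tdlc_hom G T Q S f N
    by (rule tdlc_hom_surj[OF Q f(1-4), folded f(5)])
  obtain V where V: "COS V" using cos_ex by blast
  have nN: "normalizes G (carrier G) N"
    using N.inv_op_closed2 by (auto simp: normalizes_def)
  have g: "res_founded G T {\<one>\<^bsub>G\<^esub>} (carrier G)" using quotient by (simp add: founded_tdlc_def)
  \<comment> \<open>Here \<open>A = B = carrier G\<close>, for which the density hypothesis holds
    with trivial second and third factors.\<close>
  have "res_founded G T N (carrier G)"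
  proof (rule founded_quotient[OF g _ _ _ _ _ N.subset nN N.is_subgroup quotient.hyps(3), where V = V])
    show "normalizes G V (carrier G)" using cosD(4)[OF V] by (auto simp: normalizes_def subset_iff)
    fix W b assume "COS W" "b \<in> carrier G"
    then have "b = b \<otimes>\<^bsub>G\<^esub> \<one>\<^bsub>G\<^esub> \<otimes>\<^bsub>G\<^esub> \<one>\<^bsub>G\<^esub>" "\<one>\<^bsub>G\<^esub> \<in> W" using cosD by auto
    then show "\<exists>a\<in>carrier G. \<exists>n\<in>N. \<exists>w\<in>W. b = a \<otimes>\<^bsub>G\<^esub> n \<otimes>\<^bsub>G\<^esub> w"
      using \<open>b \<in> carrier G\<close> N.one_closed by blast
  qed (use cosD[OF V] rel_open_cos[OF V] in auto)
  then have "res_founded Q S {\<one>\<^bsub>Q\<^esub>} (f ` carrier G)" by (rule f.founded_image) (simp_all add: N.subset)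
  then show ?case using Q f(2) by (simp add: founded_tdlc_def)
next
  case (increasing_union G T H)
  interpret tdlc_grp G T using increasing_union tdlcsc_group_imp_tdlc_grp by blast
  have Hcl: "closedin T (H n)" for n using open_subgroup_closedin increasing_union by blast
  have Hf: "res_founded G T {\<one>\<^bsub>G\<^esub>} (H n)" for n
    using increasing_union founded_subgroup_iff[OF _ Hcl] by (auto simp: founded_tdlc_def)
  have mono: "H m \<subseteq> H n" if "m \<le> n" for m n
    using that increasing_union.hyps(4) by (rule lift_Suc_mono_le[rotated])
  have "res_founded G T {\<one>\<^bsub>G\<^esub>} (carrier G)"
  proof (rule res_founded.step)
    fix P C
    assume P: "subgroup P G" "{\<one>\<^bsub>G\<^esub>} \<subseteq> P" "P \<subseteq> carrier G" "rel_open G T P (carrier G)"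
      and C: "compactin T C" "P = generate G (C \<union> {\<one>\<^bsub>G\<^esub>})"
    \<comment> \<open>A compact generating set lies in a single \<open>H n\<close>. Then so does
      \<open>P\<close>, and the foundedness of that \<open>H n\<close> takes over.\<close>
    have "\<forall>U\<in>range H. openin T U" "C \<subseteq> \<Union>(range H)"
      using increasing_union compactin_carrier[OF C(1)] by auto
    then obtain \<F> where \<F>: "finite \<F>" "\<F> \<subseteq> range H" "C \<subseteq> \<Union>\<F>"
      using C(1) unfolding compactin_def by meson
    then obtain I where I: "finite I" "\<F> = H ` I" using finite_subset_image by metis
    have "C \<subseteq> H (Max (insert 0 I))"
    proof
      fix c assume "c \<in> C"
      then obtain i where "i \<in> I" "c \<in> H i" using \<F> I by blast
      then show "c \<in> H (Max (insert 0 I))" using mono[of i "Max (insert 0 I)"] I by auto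
    qed
    then obtain n where n: "C \<subseteq> H n" by blast
    have "P \<subseteq> H n" unfolding C(2)
      by (rule generate_subgroup_incl) (use n increasing_union in \<open>auto simp: subgroup.one_closed\<close>)
    moreover have "rel_open G T P (H n)"
      by (rule rel_open_mono[OF P(4)]) (use increasing_union in auto)
    ultimately show "res_founded G T {\<one>\<^bsub>G\<^esub>} (rel_residual G T {\<one>\<^bsub>G\<^esub>} P)"
      using founded_residual[OF Hf P(1,2) _ _ C] by blast
  qed
  then show ?case by (simp add: founded_tdlc_def tdlc_grp_axioms)
qed

lemma topgroup_isomorphic_sym:
  assumes "topgroup_isomorphic G T H S"
  shows "topgroup_isomorphic H S G T"
proof -
  obtain h where h: "h \<in> iso G H" "homeomorphic_map T S h"
    and tg: "topological_group G T" "topological_group H S"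
    using assms by (auto simp: topgroup_isomorphic_def)
  have G: "group G" and ts: "topspace T = carrier G" "topspace S = carrier H"
    using tg by (auto simp: topological_group_def)
  obtain g where g: "homeomorphic_maps T S h g" using h(2) homeomorphic_map_maps by blast
  have inj: "inj_on h (carrier G)" and img: "h ` carrier G = carrier H" using h by (auto simp: iso_def bij_betw_def)
  have geq: "inv_into (carrier G) h y = g y" if "y \<in> carrier H" for y
  proof -
    have "g y \<in> carrier G" "h (g y) = y"
      using g that ts by (auto simp: homeomorphic_maps_def continuous_map_def)
    then show ?thesis using inj by (metis inv_into_f_eq)
  qed
  have "inv_into (carrier G) h \<in> iso H G" using group.iso_set_sym[OF G h(1)] .
  moreover have "homeomorphic_map S T g" using g homeomorphic_maps_map homeomorphic_maps_sym by blast
  then have "homeomorphic_map S T (inv_into (carrier G) h)"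
    by (rule homeomorphic_map_eq) (use geq ts in auto)
  ultimately show ?thesis using tg by (auto simp: topgroup_isomorphic_def)
qed

lemma elementary_group_founded: "elementary_group G T \<Longrightarrow> founded_tdlc G T"
  unfolding elementary_group_def
  using elementary_coded_founded founded_tdlc_iso topgroup_isomorphic_sym by blast

section \<open>Ordinals\<close>

lemma ordinal_eqI:
  fixes \<alpha> \<beta> :: ordinal
  assumes "\<And>\<gamma>. \<gamma> < \<alpha> \<longleftrightarrow> \<gamma> < \<beta>"
  shows "\<alpha> = \<beta>"
  using assms by (metis linorder_neq_iff order_less_irrefl)

lemma ordinal_zero_le [simp]: "(0::ordinal) \<le> \<alpha>"
  using ordinal_not_less_zero not_less by blast

lemma ordinal_zero_neq_one [simp]: "0 \<noteq> (1::ordinal)" "1 \<noteq> (0::ordinal)"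
  by (metis ordinal_less_one_iff order_less_irrefl)+

lemma lessThan_ordinal_zero [simp]: "{..<0::ordinal} = {}"
  by auto

lemma lessThan_ordinal_one [simp]: "{..<1::ordinal} = {0}"
  by auto

lemma ordinal_le_add: "\<alpha> \<le> \<alpha> + (\<beta>::ordinal)"
  using ordinal_less_add_iff by (metis not_less order_less_irrefl)

lemma ordinal_add_less_cancel: "\<alpha> + \<beta> < \<alpha> + \<gamma> \<longleftrightarrow> \<beta> < (\<gamma>::ordinal)"
proof
  have less: "\<alpha> + \<beta> < \<alpha> + \<gamma>" if "\<beta> < \<gamma>" for \<beta> \<gamma>
    using that by (auto simp: ordinal_less_add_iff)
  then show "\<beta> < \<gamma> \<Longrightarrow> \<alpha> + \<beta> < \<alpha> + \<gamma>" .
  show "\<alpha> + \<beta> < \<alpha> + \<gamma> \<Longrightarrow> \<beta> < \<gamma>"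
    using less[of \<gamma> \<beta>] by (metis linorder_neq_iff order_less_asym)
qed

lemma ordinal_add_le_cancel: "\<alpha> + \<beta> \<le> \<alpha> + \<gamma> \<longleftrightarrow> \<beta> \<le> (\<gamma>::ordinal)"
  using ordinal_add_less_cancel[of \<alpha> \<gamma> \<beta>] by (simp add: not_less[symmetric])

lemma ordinal_add_assoc: "(\<alpha> + \<beta>) + \<gamma> = \<alpha> + (\<beta> + (\<gamma>::ordinal))"
proof (induction \<gamma> rule: less_induct)
  case (less \<gamma>)
  show ?case
  proof (rule ordinal_eqI)
    fix x
    have "x < (\<alpha> + \<beta>) + \<gamma> \<longleftrightarrow> x < \<alpha> + \<beta> \<or> (\<exists>\<delta><\<gamma>. x = \<alpha> + (\<beta> + \<delta>))"
      using less by (auto simp: ordinal_less_add_iff[of x "\<alpha> + \<beta>"])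
    also have "\<dots> \<longleftrightarrow> x < \<alpha> \<or> (\<exists>\<epsilon><\<beta> + \<gamma>. x = \<alpha> + \<epsilon>)"
      unfolding ordinal_less_add_iff[of x \<alpha>] ordinal_less_add_iff[of _ \<beta> \<gamma>] by blast
    also have "\<dots> \<longleftrightarrow> x < \<alpha> + (\<beta> + \<gamma>)" by (simp add: ordinal_less_add_iff)
    finally show "x < (\<alpha> + \<beta>) + \<gamma> \<longleftrightarrow> x < \<alpha> + (\<beta> + \<gamma>)" .
  qed
qed

lemma ordinal_le_add_left: "\<alpha> \<le> \<beta> + (\<alpha>::ordinal)"
proof (induction \<alpha> rule: less_induct)
  case (less \<alpha>)
  show ?case
  proof (rule leI, rule notI)
    assume *: "\<beta> + \<alpha> < \<alpha>"
    then have "\<beta> + \<alpha> \<le> \<beta> + (\<beta> + \<alpha>)" using less by blast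
    then show False using * by (simp add: ordinal_add_le_cancel)
  qed
qed

lemma ordinal_zero_add [simp]: "0 + \<alpha> = (\<alpha>::ordinal)"
proof (induction \<alpha> rule: less_induct)
  case (less \<alpha>)
  then show ?case by (intro ordinal_eqI) (auto simp: ordinal_less_add_iff)
qed

lemma ordinal_less_succ [simp]: "\<alpha> < \<alpha> + (1::ordinal)"
  by (simp add: ordinal_less_add_one_iff)

lemma ordinal_succ_le_iff: "\<alpha> + 1 \<le> \<beta> \<longleftrightarrow> \<alpha> < (\<beta>::ordinal)"
  by (metis not_less ordinal_less_add_one_iff)

lemma ordinal_succ_eq_iff [simp]: "\<alpha> + 1 = \<beta> + 1 \<longleftrightarrow> \<alpha> = (\<beta>::ordinal)"
  by (metis ordinal_less_add_one_iff order_antisym order_refl)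

lemma ordinal_succ_neq_zero [simp]: "\<alpha> + 1 \<noteq> (0::ordinal)" "0 \<noteq> \<alpha> + (1::ordinal)"
  by (metis ordinal_less_succ ordinal_not_less_zero)+

lemma ordinal_one_le_iff: "(1::ordinal) \<le> \<alpha> \<longleftrightarrow> \<alpha> \<noteq> 0"
  by (simp add: not_less[symmetric])

lemma ord_pred_succ [simp]: "ord_pred (\<alpha> + 1) = \<alpha>"
  unfolding ord_pred_def by (rule the_equality) simp_all

lemma not_is_limit_succ [simp]: "\<not> is_limit (\<alpha> + 1)"
  by (auto simp: is_limit_def)

lemma less_omega1_iff: "\<alpha> < omega1 \<longleftrightarrow> countable {..<\<alpha>}"
proof
  show "\<alpha> < omega1 \<Longrightarrow> countable {..<\<alpha>}" unfolding omega1_def using not_less_Least by blast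
  assume c: "countable {..<\<alpha>}"
  have "uncountable {..<omega1}"
    unfolding omega1_def by (rule LeastI_ex[of "\<lambda>\<alpha>. uncountable {..<\<alpha>}"]) (rule ex_uncountable_ordinal)
  then show "\<alpha> < omega1" using c by (meson countable_subset lessThan_subset_iff not_less)
qed

lemma omega1_add:
  assumes "\<alpha> < omega1" "\<beta> < omega1"
  shows "\<alpha> + \<beta> < omega1"
proof -
  have "{..<\<alpha> + \<beta>} = {..<\<alpha>} \<union> (\<lambda>\<delta>. \<alpha> + \<delta>) ` {..<\<beta>}"
    by (auto simp: ordinal_less_add_iff)
  then show ?thesis using assms by (simp add: less_omega1_iff)
qed

lemma zero_less_omega1 [simp]: "0 < omega1"
  by (simp add: less_omega1_iff)

lemma one_less_omega1 [simp]: "1 < omega1"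
  by (simp add: less_omega1_iff)

text \<open>The least ordinal \<open>\<sigma>\<close> outside the countable union \<open>B\<close>
  of the segments up to members of \<open>A\<close> is a bound; everything below it lies in
  \<open>B\<close>, so it is countable.\<close>

lemma omega1_bounded:
  assumes A: "countable A" "\<And>\<alpha>. \<alpha> \<in> A \<Longrightarrow> \<alpha> < omega1"
  obtains \<sigma> where "\<sigma> < omega1" "\<And>\<alpha>. \<alpha> \<in> A \<Longrightarrow> \<alpha> \<le> \<sigma>"
proof -
  define B where "B = (\<Union>\<alpha>\<in>A. {..<\<alpha> + 1})"
  have "countable {..<\<alpha> + 1}" if "\<alpha> \<in> A" for \<alpha>
    using omega1_add[OF A(2)[OF that] one_less_omega1] by (simp only: less_omega1_iff)
  then have "countable B" unfolding B_def using A(1) by (rule countable_UN[rotated])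
  moreover have "uncountable (UNIV :: ordinal set)"
    using ex_uncountable_ordinal by (metis countable_subset subset_UNIV)
  ultimately have ex: "\<exists>\<sigma>. \<sigma> \<notin> B" by (metis UNIV_eq_I)
  define \<sigma> where "\<sigma> = (LEAST \<sigma>. \<sigma> \<notin> B)"
  have n: "\<sigma> \<notin> B" unfolding \<sigma>_def using ex by (rule LeastI_ex)
  have "{..<\<sigma>} \<subseteq> B" unfolding \<sigma>_def using not_less_Least by blast
  then have "\<sigma> < omega1" using \<open>countable B\<close> countable_subset less_omega1_iff by blast
  moreover have "\<alpha> \<le> \<sigma>" if "\<alpha> \<in> A" for \<alpha>
    using n that by (auto simp: B_def ordinal_less_add_one_iff)
  ultimately show ?thesis using that by blast
qed

lemma less_omega_iff: "\<alpha> < omega \<longleftrightarrow> finite {..<\<alpha>}"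
proof
  show "\<alpha> < omega \<Longrightarrow> finite {..<\<alpha>}" unfolding omega_def using not_less_Least by blast
  assume c: "finite {..<\<alpha>}"
  have "infinite {..<omega}"
    unfolding omega_def
    by (rule LeastI_ex[of "\<lambda>\<alpha>. infinite {..<\<alpha>}"]) (use ex_uncountable_ordinal countable_finite in blast)
  then show "\<alpha> < omega" using c by (meson finite_subset lessThan_subset_iff not_less)
qed

text \<open>Below \<open>omega\<close> the ordinal \<open>1 + \<delta>\<close> is again finite, and
  from \<open>omega\<close> on the induction hypothesis gives
  \<open>1 + \<delta> = \<delta>\<close>.\<close>

lemma one_add_omega_le:
  assumes "omega \<le> \<alpha>"
  shows "1 + \<alpha> = \<alpha>"
  using assms
proof (induction \<alpha> rule: less_induct)
  case (less \<alpha>)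
  show ?case
  proof (rule ordinal_eqI)
    fix \<gamma>
    show "\<gamma> < 1 + \<alpha> \<longleftrightarrow> \<gamma> < \<alpha>"
    proof
      show "\<gamma> < \<alpha> \<Longrightarrow> \<gamma> < 1 + \<alpha>" using ordinal_le_add_left[of \<alpha> 1] by simp
      have pos: "0 < \<alpha>" using less.prems less_omega_iff[of 0] by (simp add: order_less_le_trans)
      assume "\<gamma> < 1 + \<alpha>"
      then consider "\<gamma> = 0" | \<delta> where "\<delta> < \<alpha>" "\<gamma> = 1 + \<delta>" by (auto simp: ordinal_less_add_iff)
      then show "\<gamma> < \<alpha>"
      proof cases
        case (2 \<delta>)
        show ?thesis
        proof (cases "omega \<le> \<delta>")
          case True
          then show ?thesis using less.IH[OF 2(1)] 2 by simp
        next
          case False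
          then have "finite {..<\<delta>}" by (simp add: not_le less_omega_iff)
          moreover have "{..<1 + \<delta>} = {0} \<union> (\<lambda>x. 1 + x) ` {..<\<delta>}"
            by (auto simp: ordinal_less_add_iff)
          ultimately have "1 + \<delta> < omega" by (simp add: less_omega_iff)
          then show ?thesis using 2 less.prems by simp
        qed
      qed (use pos in simp)
    qed
  qed
qed

lemma ord_sup_plus_max:
  assumes "\<beta> + 1 \<in> A" "\<And>\<alpha>. \<alpha> \<in> A \<Longrightarrow> \<alpha> \<le> \<beta> + 1"
  shows "ord_sup_plus A = \<beta> + 1"
proof -
  have "ord_sup A = \<beta> + 1" unfolding ord_sup_def
    by (rule Least_equality) (use assms in auto)
  then show ?thesis by (auto simp: ord_sup_plus_def)
qed

section \<open>Residuals and heights\<close>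

text \<open>Only the group structure is fixed and the topology remains a free parameter, so the
  lemmas on \<open>Res\<close> apply to the wreath product on the strength of its group
  axioms.\<close>

locale group_monoid = group G for G :: "'a monoid" (structure)

sublocale tdlc_grp \<subseteq> group_monoid ..

lemma (in group_monoid) cg_subgroups_iff:
  "H \<in> cg_subgroups G T \<longleftrightarrow>
     subgroup H G \<and> closedin T H \<and> (\<exists>C. compactin T C \<and> C \<subseteq> H \<and> generate G C = H)"
  unfolding cg_subgroups_def compactly_generated_def
  by (auto simp: compactin_subtopology generate_consistent)

lemma Res_mono: "K \<subseteq> K' \<Longrightarrow> Res G T K \<subseteq> Res G T K'"
  unfolding Res_def by blast

lemma (in group_monoid) Res_least:
  assumes "subgroup K G" "subgroup V G" "openin T V" "normalizes G K V"
  shows "Res G T K \<subseteq> V"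
proof -
  have "(\<lambda>x. k \<otimes> x \<otimes> inv k) ` V = V" if "k \<in> K" for k
    using normalizes_image_eq[OF assms(1) _ assms(4) that] assms(2) subgroup.subset by blast
  then show ?thesis unfolding Res_def using assms by blast
qed

lemma (in group_monoid) mem_ResI:
  assumes "\<And>V. subgroup V G \<Longrightarrow> openin T V \<Longrightarrow> normalizes G K V \<Longrightarrow> x \<in> V"
  shows "x \<in> Res G T K"
  unfolding Res_def using assms by (auto simp: normalizes_def)

text \<open>The preimage of an open subgroup normalized by \<open>B\<close> is an open subgroup
  normalized by \<open>A\<close>.\<close>

lemma continuous_hom_Res:
  fixes G :: "'a monoid" and H :: "'b monoid"
  assumes f: "group_hom G H f" "continuous_map T S f" "topspace T = carrier G"
    and A: "subgroup A G" "f ` A \<subseteq> B" and x: "x \<in> Res G T A"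
  shows "f x \<in> Res H S B"
proof -
  interpret f: group_hom G H f by (rule f)
  interpret G: group_monoid G by unfold_locales
  interpret H: group_monoid H by unfold_locales
  show ?thesis
  proof (rule H.mem_ResI)
    fix Q assume Q: "subgroup Q H" "openin S Q" "normalizes H B Q"
    have "openin T {x \<in> carrier G. f x \<in> Q}"
      using openin_continuous_map_preimage[OF f(2) Q(2)] f(3) by simp
    moreover have "normalizes G A {x \<in> carrier G. f x \<in> Q}"
      using A Q(3) by (auto simp: normalizes_def subgroup.mem_carrier)
    ultimately have "Res G T A \<subseteq> {x \<in> carrier G. f x \<in> Q}"
      by (rule G.Res_least[OF A(1) f.subgroup_preimage[OF Q(1)]])
    then show "f x \<in> Q" using x by blast
  qed
qed

lemma (in group_monoid) Res_subgroup:
  assumes "openin T (carrier G)" "K \<subseteq> carrier G"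
  shows "subgroup (Res G T K) G"
  unfolding Res_def
proof (rule subgroups_Inter)
  have "(\<lambda>x. k \<otimes> x \<otimes> inv k) ` carrier G = carrier G" if "k \<in> K" for k
    using normalizes_image_eq[OF subgroup_self _ normalizes_self[OF subgroup_self]] assms that by blast
  then show "{V. subgroup V G \<and> openin T V \<and> (\<forall>k\<in>K. (\<lambda>x. k \<otimes> x \<otimes> inv k) ` V = V)} \<noteq> {}"
    using assms subgroup_self by blast
qed auto

section \<open>Ambient residuals and countable bounds for levels\<close>

context tdlc_grp
begin

lemma openin_carrier_self: "openin T (carrier G)"
  using openin_topspace[of T] by (simp add: topspace_eq)

lemma rel_open_carrier_openin: "subgroup D G \<Longrightarrow> rel_open G T D (carrier G) \<Longrightarrow> openin T D"
  unfolding rel_open_def using subgroup_openin cosD by (metis Int_absorb2)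

lemma Res_closedin:
  assumes "K \<subseteq> carrier G"
  shows "closedin T (Res G T K)"
  unfolding Res_def
proof (rule closedin_Inter)
  have "(\<lambda>x. k \<otimes> x \<otimes> inv k) ` carrier G = carrier G" if "k \<in> K" for k
    using normalizes_image_eq[OF subgroup_self _ normalizes_self[OF subgroup_self]] assms that by blast
  then show "{V. subgroup V G \<and> openin T V \<and> (\<forall>k\<in>K. (\<lambda>x. k \<otimes> x \<otimes> inv k) ` V = V)} \<noteq> {}"
    using openin_carrier_self subgroup_self by blast
qed (auto intro: open_subgroup_closedin)

text \<open>For compact \<open>K\<close> the core of a compact open subgroup under \<open>K\<close>
  is open and invariant, and these cores shrink to the identity.\<close>

lemma Res_compact:
  assumes K: "subgroup K G" "compactin T K"
  shows "Res G T K = {\<one>}"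
proof
  have Kc: "K \<subseteq> carrier G" using K by (simp add: subgroup.subset)
  have R: "subgroup (Res G T K) G" by (rule Res_subgroup[OF openin_carrier_self Kc])
  show "{\<one>} \<subseteq> Res G T K" using R by (simp add: subgroup.one_closed)
  show "Res G T K \<subseteq> {\<one>}"
  proof
    fix x assume x: "x \<in> Res G T K"
    have "x = \<one>"
    proof (rule mem_all_cos)
      show "x \<in> carrier G" using x R by (simp add: subgroup.mem_carrier)
      fix V assume V: "COS V"
      have c: "subgroup (conj_core G K V) G" by (rule conj_core_subgroup[OF Kc cosD(1)[OF V]])
      have n: "normalizes G K (carrier G)" using Kc by (auto simp: normalizes_def)
      have "openin T (conj_core G K V)"
        by (rule rel_open_carrier_openin[OF c rel_open_conj_core[OF K n order_refl rel_open_cos[OF V]]])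
      then have "Res G T K \<subseteq> conj_core G K V"
        by (rule Res_least[OF K(1) c _ conj_core_normalizes[OF K(1)]])
      then show "x \<in> V" using x conj_core_subset[OF K(1)] by blast
    qed
    then show "x \<in> {\<one>}" by simp
  qed
qed

text \<open>When \<open>V\<close> is a compact open subgroup, the subgroup \<open>D\<close> of
  \<open>V P\<close> supplied by \<open>rel_residual_compact_extension\<close> is open in
  \<open>G\<close> itself and normalized by \<open>P\<close>, so it contains
  \<open>Res G T P\<close>. Letting \<open>W\<close> shrink in \<open>D \<subseteq> W R\<close>
  leaves the closed group \<open>R = rel_residual G T {\<one>} P\<close>.\<close>

lemma Res_subset_rel_residual:
  assumes P: "subgroup P G" "closedin T P" and C: "compactin T C" "P = generate G C"
    and V: "COS V" "normalizes G V P"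
  shows "Res G T P \<subseteq> rel_residual G T {\<one>} P"
proof
  fix x assume x: "x \<in> Res G T P"
  have Pc: "P \<subseteq> carrier G" using P by (simp add: subgroup.subset)
  have one: "{\<one>} \<subseteq> P" using P by (simp add: subgroup.one_closed)
  have Rs: "subgroup (Res G T P) G" by (rule Res_subgroup[OF openin_carrier_self Pc])
  have R: "subgroup (rel_residual G T {\<one>} P) G" by (rule rel_residual_subgroup[OF P(1) one])
  show "x \<in> rel_residual G T {\<one>} P"
  proof (rule closedin_cosI[OF rel_residual_closedin[OF P(1) one P(2)]])
    show xc: "x \<in> carrier G" using x Rs by (simp add: subgroup.mem_carrier)
    fix W assume W: "COS W"
    obtain D where D: "subgroup D G" "rel_open G T D (V <#> P)" "normalizes G P D"
      "D \<subseteq> (V \<inter> W) <#> rel_residual G T {\<one>} P"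
      by (rule rel_residual_compact_extension[OF P C cosD(1,3)[OF V(1)] V(2) rel_open_cos[OF V(1)] W]) blast
    have "V \<subseteq> V <#> P" by (rule subset_set_mult[OF cosD(1)[OF V(1)] P(1)])
    then have "rel_open G T D V" by (intro rel_open_mono[OF D(2)]) auto
    then have "rel_open G T D (carrier G)" using rel_open_trans rel_open_cos[OF V(1)] by blast
    then have "openin T D" by (rule rel_open_carrier_openin[OF D(1)])
    then have "Res G T P \<subseteq> D" by (rule Res_least[OF P(1) D(1) _ D(3)])
    moreover have "inv x \<in> Res G T P" using x Rs by (simp add: subgroup.m_inv_closed)
    ultimately obtain v r where vr: "inv x = v \<otimes> r" "v \<in> W" "r \<in> rel_residual G T {\<one>} P" using D(4) by blast
    have c: "v \<in> carrier G" "r \<in> carrier G" using vr cosD(4)[OF W] R by (auto simp: subgroup.mem_carrier)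
    have "x = inv (v \<otimes> r)" using xc vr by (metis inv_inv)
    then have "x = inv r \<otimes> inv v" using c by (simp add: inv_mult_group)
    moreover have "inv r \<in> rel_residual G T {\<one>} P" "inv v \<in> W"
      using vr R cosD(1)[OF W] by (auto simp: subgroup.m_inv_closed)
    ultimately show "\<exists>a\<in>rel_residual G T {\<one>} P. \<exists>v\<in>W. x = a \<otimes> v" by blast
  qed
qed

text \<open>A dense subgroup meets every coset of an open subgroup, so adding
  \<open>V \<inter> H\<close> to the generators produces the whole closure \<open>H\<close>.\<close>

lemma closure_generate_cg:
  assumes C: "compactin T C"
  shows "cl (generate G C) \<in> cg_subgroups G T"
proof -
  have Cc: "C \<subseteq> carrier G" by (rule compactin_carrier[OF C])
  have g: "subgroup (generate G C) G" by (rule generate_is_subgroup[OF Cc])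
  let ?H = "cl (generate G C)"
  have H: "subgroup ?H G" "closedin T ?H" using closure_of_subgroup[OF g] by auto
  have gH: "generate G C \<subseteq> ?H" using closure_of_subset subgroup.subset[OF g] topspace_eq by metis
  have CH: "C \<subseteq> ?H" using gH by (auto intro: generate.incl)
  obtain V where V: "COS V" using cos_ex by blast
  let ?C = "C \<union> (V \<inter> ?H)"
  have k: "compactin T ?C" by (intro compactin_Un C compactin_Int_closedin cosD(3)[OF V] H)
  have "generate G ?C = ?H"
  proof
    show "generate G ?C \<subseteq> ?H" by (rule generate_subgroup_incl[OF _ H(1)]) (use CH in blast)
    show "?H \<subseteq> generate G ?C"
    proof
      fix x assume x: "x \<in> ?H"
      obtain a where a: "a \<in> generate G C" "a \<in> carrier G" "inv x \<otimes> a \<in> V"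
        by (rule closure_of_mult_nhd[OF x cosD(2,5)[OF V]])
      have xc: "x \<in> carrier G" using x H by (simp add: subgroup.mem_carrier)
      have "inv x \<otimes> a \<in> ?H" using x a gH H by (meson subgroup.m_closed subgroup.m_inv_closed subsetD)
      then have "inv x \<otimes> a \<in> generate G ?C" using a by (blast intro: generate.incl)
      moreover have "a \<in> generate G ?C" using a mono_generate[of C ?C] by blast
      moreover have s: "subgroup (generate G ?C) G" by (rule generate_is_subgroup[OF compactin_carrier[OF k]])
      ultimately have "a \<otimes> inv (inv x \<otimes> a) \<in> generate G ?C"
        by (meson subgroup.m_closed subgroup.m_inv_closed)
      then show "x \<in> generate G ?C" using xc a by (simp add: word_simps)
    qed
  qed
  then show ?thesis using H k CH by (auto simp: cg_subgroups_iff)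
qed

lemma one_cg: "{\<one>} \<in> cg_subgroups G T"
proof -
  have "generate G {\<one>} = {\<one>}" by (rule generate_one)
  then show ?thesis
    unfolding cg_subgroups_iff using triv_subgroup closedin_one topspace_eq
    by (intro conjI exI[of _ "{\<one>}"]) auto
qed

lemma countable_transversal:
  assumes B: "B \<subseteq> carrier G" and V: "COS V"
  obtains D where "countable D" "D \<subseteq> B" "\<And>b. b \<in> B \<Longrightarrow> \<exists>d\<in>D. inv d \<otimes> b \<in> V"
proof -
  have "Lindelof_space (subtopology T B)"
    using second_countable_imp_Lindelof_space second_countable_subtopology second_count by blast
  moreover have ts: "topspace (subtopology T B) = B" using B topspace_eq by auto
  let ?U = "\<lambda>d. {x \<in> carrier G. inv d \<otimes> x \<in> V} \<inter> B"
  have "\<forall>U\<in>?U ` B. openin (subtopology T B) U"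
    using B openin_lcoset[OF cosD(2)[OF V]] by (auto intro: openin_subtopology_Int)
  moreover have "\<Union>(?U ` B) = B" using B cosD(5)[OF V] by force
  ultimately obtain \<V> where \<V>: "countable \<V>" "\<V> \<subseteq> ?U ` B" "\<Union>\<V> = B"
    unfolding Lindelof_space_def ts by meson
  obtain D where D: "countable D" "D \<subseteq> B" "\<V> = ?U ` D"
    using countable_subset_image[of \<V> ?U B] \<V>(1,2) by blast
  show ?thesis
  proof (rule that[OF D(1,2)])
    fix b assume "b \<in> B"
    then have "b \<in> \<Union>(?U ` D)" using \<V>(3) D(3) by simp
    then show "\<exists>d\<in>D. inv d \<otimes> b \<in> V" by blast
  qed
qed

text \<open>Each \<open>H\<close> lies in some member \<open>P\<close> of a countable family of
  compactly generated open subgroups of \<open>B\<close> normalized by \<open>V\<close>, and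
  \<open>Res G T H\<close> lies in the residual of \<open>P\<close>, where the induction hypothesis
  bounds the levels. Countability of the family bounds all of them by a countable ordinal. The
  second conjunct is carried along because \<open>H \<subseteq> Res G T H\<close> places
  \<open>H\<close> itself inside the residual of \<open>P\<close>.\<close>

lemma founded_height:
  assumes V: "COS V" and B: "res_founded G T {\<one>} B" "subgroup B G" "closedin T B" "normalizes G V B"
  shows "\<exists>\<alpha><omega1. \<forall>H\<in>cg_subgroups G T. H \<subseteq> B \<longrightarrow>
     (\<exists>\<beta>\<le>\<alpha>. res_class G T \<beta> H) \<and> (H \<subseteq> Res G T H \<longrightarrow> H = {\<one>})"
  using B
proof (induction rule: res_founded.induct)
  case base
  have "(\<exists>\<beta>\<le>0. res_class G T \<beta> H) \<and> (H \<subseteq> Res G T H \<longrightarrow> H = {\<one>})"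
    if "H \<in> cg_subgroups G T" "H \<subseteq> {\<one>}" for H
  proof -
    have "H = {\<one>}" using that subgroup.one_closed by (auto simp: cg_subgroups_iff)
    then show ?thesis using res_class.zero by blast
  qed
  then show ?case using zero_less_omega1 by blast
next
  case (step B)
  have Bc: "B \<subseteq> carrier G" using step.prems by (simp add: subgroup.subset)
  have Vs: "subgroup V G" and Vk: "compactin T V" using cosD[OF V] by auto
  define \<P> where "\<P> = {P. subgroup P G \<and> V \<inter> B \<subseteq> P \<and> P \<subseteq> B \<and> normalizes G V P \<and>
     (\<exists>C. compactin T C \<and> P = generate G (C \<union> {\<one>}))}"
  have Pf: "rel_open G T P B" "{\<one>} \<subseteq> P" "closedin T P" if "P \<in> \<P>" for P
  proof -
    show o: "rel_open G T P B" unfolding rel_open_def using V that by (auto simp: \<P>_def)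
    show "{\<one>} \<subseteq> P" using that by (simp add: \<P>_def subgroup.one_closed)
    show "closedin T P" by (rule rel_open_closedin[OF _ _ step.prems(1,2) o]) (use that in \<open>auto simp: \<P>_def\<close>)
  qed
  have "countable \<P>"
  proof -
    obtain D where D: "countable D" "D \<subseteq> B" "\<And>b. b \<in> B \<Longrightarrow> \<exists>d\<in>D. inv d \<otimes> b \<in> V"
      using countable_transversal[OF Bc V] by blast
    \<comment> \<open>As \<open>P\<close> contains \<open>V \<inter> B\<close>, a generator may be
      replaced by any element of its coset in \<open>B\<close>, in particular by one from the
      countable transversal \<open>D\<close>; finitely many cosets cover the compact set
      \<open>C\<close>.\<close>
    have "\<P> \<subseteq> (\<lambda>F. generate G (F \<union> (V \<inter> B))) ` {F. F \<subseteq> D \<and> finite F}"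
    proof
      fix P assume P: "P \<in> \<P>"
      then obtain C where C: "compactin T C" "P = generate G (C \<union> {\<one>})" by (auto simp: \<P>_def)
      have Ps: "subgroup P G" "P \<subseteq> B" "V \<inter> B \<subseteq> P" using P by (auto simp: \<P>_def)
      have CP: "C \<subseteq> P" using C by (auto intro: generate.incl)
      obtain F where F: "finite F" "F \<subseteq> C" "\<And>c. c \<in> C \<Longrightarrow> \<exists>f\<in>F. inv f \<otimes> c \<in> V"
        using compactin_cosets[OF C(1) V] by metis
      have "\<forall>f\<in>F. \<exists>d\<in>D. inv d \<otimes> f \<in> V" using D(3) F CP Ps by blast
      then obtain d where d: "\<And>f. f \<in> F \<Longrightarrow> d f \<in> D \<and> inv (d f) \<otimes> f \<in> V" by metis
      let ?E = "d ` F \<union> (V \<inter> B)"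
      have Ec: "?E \<subseteq> carrier G" using d D Bc by blast
      have E: "subgroup (generate G ?E) G" by (rule generate_is_subgroup[OF Ec])
      have dB: "d f \<in> B" "inv (d f) \<otimes> f \<in> V \<inter> B" if "f \<in> F" for f
      proof -
        show "d f \<in> B" using d[OF that] D by blast
        moreover have "f \<in> B" using that F CP Ps by blast
        ultimately have "inv (d f) \<otimes> f \<in> B"
          using step.prems(1) by (meson subgroup.m_closed subgroup.m_inv_closed)
        then show "inv (d f) \<otimes> f \<in> V \<inter> B" using d[OF that] by blast
      qed
      have "P = generate G ?E"
      proof
        have fE: "f \<in> generate G ?E" if "f \<in> F" for f
        proof -
          have "d f \<otimes> (inv (d f) \<otimes> f) \<in> generate G ?E"
            using dB(2)[OF that] that by (intro generate.eng generate.incl) auto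
          moreover have "f \<in> carrier G" using that F CP Ps Bc by blast
          ultimately show ?thesis using dB(1)[OF that] Bc by (simp add: word_simps subset_iff)
        qed
        show "P \<subseteq> generate G ?E" unfolding C(2)
        proof (rule generate_subgroup_incl[OF _ E])
          show "C \<union> {\<one>} \<subseteq> generate G ?E"
          proof
            fix c assume "c \<in> C \<union> {\<one>}"
            then consider "c \<in> C" | "c = \<one>" by blast
            then show "c \<in> generate G ?E"
            proof cases
              case 1
              then obtain f where f: "f \<in> F" "inv f \<otimes> c \<in> V" using F by blast
              have fc: "f \<in> B" "c \<in> B" using 1 f F CP Ps by auto
              then have "inv f \<otimes> c \<in> B" using step.prems(1) by (meson subgroup.m_closed subgroup.m_inv_closed)
              then have "f \<otimes> (inv f \<otimes> c) \<in> generate G ?E"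
                using f fE[OF f(1)] by (intro generate.eng[OF fE[OF f(1)]] generate.incl) auto
              then show ?thesis using fc Bc by (simp add: word_simps subset_iff)
            qed (simp add: generate.one)
          qed
        qed
        show "generate G ?E \<subseteq> P"
        proof (rule generate_subgroup_incl[OF _ Ps(1)])
          have "d f \<in> P" if f: "f \<in> F" for f
          proof -
            have fP: "f \<in> P" using f F CP by blast
            have "inv (d f) \<otimes> f \<in> P" using dB[OF f] Ps by blast
            then have "f \<otimes> inv (inv (d f) \<otimes> f) \<in> P" using fP Ps(1) by (meson subgroup.m_closed subgroup.m_inv_closed)
            then show ?thesis using dB(1)[OF f] Bc fP Ps by (simp add: word_simps subset_iff)
          qed
          then show "?E \<subseteq> P" using Ps by blast
        qed
      qed
      moreover have "d ` F \<in> {F. F \<subseteq> D \<and> finite F}" using d F by auto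
      ultimately show "P \<in> (\<lambda>F. generate G (F \<union> (V \<inter> B))) ` {F. F \<subseteq> D \<and> finite F}" by blast
    qed
    moreover have "countable {F. F \<subseteq> D \<and> finite F}"
      using countable_Collect_finite_subset[OF D(1)] by (simp add: conj_commute)
    ultimately show ?thesis by (meson countable_image countable_subset)
  qed
  have "\<exists>\<alpha><omega1. \<forall>H\<in>cg_subgroups G T. H \<subseteq> rel_residual G T {\<one>} P \<longrightarrow>
       (\<exists>\<beta>\<le>\<alpha>. res_class G T \<beta> H) \<and> (H \<subseteq> Res G T H \<longrightarrow> H = {\<one>})" if P: "P \<in> \<P>" for P
  proof -
    have Ps: "subgroup P G" "P \<subseteq> B" "normalizes G V P" using P by (auto simp: \<P>_def)
    obtain C where C: "compactin T C" "P = generate G (C \<union> {\<one>})" using P by (auto simp: \<P>_def)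
    have n1: "normalizes G V {\<one>}" using cosD(4)[OF V] by (auto simp: normalizes_def)
    show ?thesis
      by (rule step.IH[OF Ps(1) Pf(2)[OF P] Ps(2) Pf(1)[OF P] C
            rel_residual_subgroup[OF Ps(1) Pf(2)[OF P]]
            rel_residual_closedin[OF Ps(1) Pf(2)[OF P] Pf(3)[OF P]]
            rel_residual_normalizes_other[OF Vs Ps(1,3) n1 Pf(2)[OF P]]])
  qed
  then obtain a where a: "\<And>P. P \<in> \<P> \<Longrightarrow> a P < omega1"
    "\<And>P H. P \<in> \<P> \<Longrightarrow> H \<in> cg_subgroups G T \<Longrightarrow> H \<subseteq> rel_residual G T {\<one>} P \<Longrightarrow>
       (\<exists>\<beta>\<le>a P. res_class G T \<beta> H) \<and> (H \<subseteq> Res G T H \<longrightarrow> H = {\<one>})"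
    by metis
  \<comment> \<open>The maximum with 1 is taken because the rule \<open>succ\<close> starts at level
    1.\<close>
  define b where "b P = max (a P) 1" for P
  have b: "b P + 1 < omega1" if "P \<in> \<P>" for P
    using a(1)[OF that] by (auto simp: b_def max_def intro!: omega1_add)
  have "countable ((\<lambda>P. b P + 1) ` \<P>)" "\<And>\<alpha>. \<alpha> \<in> (\<lambda>P. b P + 1) ` \<P> \<Longrightarrow> \<alpha> < omega1"
    using \<open>countable \<P>\<close> b by auto
  from omega1_bounded[OF this]
  obtain \<sigma> where \<sigma>': "\<sigma> < omega1" "\<And>\<alpha>. \<alpha> \<in> (\<lambda>P. b P + 1) ` \<P> \<Longrightarrow> \<alpha> \<le> \<sigma>" by auto
  then have \<sigma>: "\<sigma> < omega1" "\<And>P. P \<in> \<P> \<Longrightarrow> b P + 1 \<le> \<sigma>" by blast+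
  have "(\<exists>\<beta>\<le>\<sigma>. res_class G T \<beta> H) \<and> (H \<subseteq> Res G T H \<longrightarrow> H = {\<one>})"
    if H: "H \<in> cg_subgroups G T" "H \<subseteq> B" for H
  proof -
    obtain C where C: "compactin T C" "C \<subseteq> H" "generate G C = H" using H by (auto simp: cg_subgroups_iff)
    obtain E where Ek: "compactin T E" and nVE: "normalizes G V E" and CE: "C \<subseteq> E" "V \<inter> B \<subseteq> E"
      and Emin: "\<And>S. normalizes G V S \<Longrightarrow> C \<subseteq> S \<Longrightarrow> V \<inter> B \<subseteq> S \<Longrightarrow> E \<subseteq> S"
      by (rule normalized_generators[OF Vs Vk C(1) step.prems(2,3)]) blast
    have Ec: "E \<subseteq> carrier G" by (rule compactin_carrier[OF Ek])
    define P where "P = generate G (E \<union> {\<one>})"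
    have P: "subgroup P G" "P = generate G E" unfolding P_def
      using generate_is_subgroup[of "E \<union> {\<one>}"] generate_Un_one[OF Ec] Ec by auto
    have EB: "E \<subseteq> B" using C H by (intro Emin step.prems) auto
    have nVP: "normalizes G V P" unfolding P(2) by (rule normalizes_generate_set[OF Vs Ec nVE])
    have EP: "E \<subseteq> P" unfolding P(2) by (auto intro: generate.incl)
    have P\<P>: "P \<in> \<P>" unfolding \<P>_def
    proof (intro CollectI conjI exI)
      show "P \<subseteq> B" unfolding P(2) by (rule generate_subgroup_incl[OF EB step.prems(1)])
      show "V \<inter> B \<subseteq> P" using EP CE by blast
    qed (rule P nVP Ek P_def)+
    have "C \<subseteq> P" using CE EP by blast
    then have HP: "H \<subseteq> P" using generate_subgroup_incl[OF _ P(1)] C by blast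
    have RH: "Res G T H \<subseteq> rel_residual G T {\<one>} P"
      using Res_mono[OF HP] Res_subset_rel_residual[OF P(1) Pf(3)[OF P\<P>] Ek P(2) V nVP] by blast
    have "res_class G T (b P + 1) H"
    proof (rule res_class.succ)
      show "1 \<le> b P" by (simp add: b_def)
      fix L assume "L \<in> cg_subgroups G T" "res_prec G T L H"
      then have "\<exists>\<beta>\<le>a P. res_class G T \<beta> L" using a(2)[OF P\<P>] RH by (auto simp: res_prec_def)
      then show "\<exists>\<beta>\<le>b P. res_class G T \<beta> L" by (auto simp: b_def max_def intro: order_trans)
    qed (rule H)
    moreover have "H = {\<one>}" if "H \<subseteq> Res G T H" using a(2)[OF P\<P> H(1)] that RH by blast
    ultimately show ?thesis using \<sigma>(2)[OF P\<P>] by blast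
  qed
  then show ?case using \<sigma>(1) by blast
qed

end

text \<open>A limit level is inherited from below, at level 1 the only candidate for
  \<open>M\<close> is the trivial group of level 0, and level 0 is excluded by the nontriviality of
  \<open>H\<close>.\<close>

lemma res_class_pred:
  assumes "res_class G T \<beta> H" "H \<noteq> {\<one>\<^bsub>G\<^esub>}" "group G" "M \<in> cg_subgroups G T" "res_prec G T M H"
  shows "\<exists>\<beta>'<\<beta>. res_class G T \<beta>' M"
  using assms
proof (induction rule: res_class.induct)
  case (one K)
  interpret group_monoid G using one by (simp add: group_monoid_def)
  have "M = {\<one>\<^bsub>G\<^esub>}" using one subgroup.one_closed by (auto simp: res_prec_def cg_subgroups_iff)
  then show ?case using res_class.zero by force
next
  case (succ \<gamma> K)
  then show ?case using ordinal_less_add_one_iff by blast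
next
  case (limit \<gamma> \<beta> K)
  then show ?case using order_less_trans by blast
qed simp

lemma res_class_zero: "res_class G T 0 H \<Longrightarrow> H = {\<one>\<^bsub>G\<^esub>}"
  by (erule res_class.cases) simp_all

section \<open>Residual height as an ordinal rank\<close>

locale founded_group = tdlc_grp +
  assumes founded: "res_founded G T {\<one>} (carrier G)"
begin

abbreviation "CG \<equiv> cg_subgroups G T"
abbreviation "ht \<equiv> residual_height G T"

lemma height_exists:
  obtains \<alpha> where "\<alpha> < omega1" "\<And>H. H \<in> CG \<Longrightarrow> \<exists>\<beta>\<le>\<alpha>. res_class G T \<beta> H"
    "\<And>H. H \<in> CG \<Longrightarrow> H \<subseteq> Res G T H \<Longrightarrow> H = {\<one>}"
proof -
  obtain V where V: "COS V" using cos_ex by blast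
  have n: "normalizes G V (carrier G)" using cosD(4)[OF V] by (auto simp: normalizes_def)
  show ?thesis
    using founded_height[OF V founded carrier_facts n] that
    by (metis cg_subgroups_iff subgroup.subset)
qed

lemma not_subset_Res: "H \<in> CG \<Longrightarrow> H \<subseteq> Res G T H \<Longrightarrow> H = {\<one>}"
  using height_exists by metis

lemma res_class_cg: "res_class G T \<alpha> H \<Longrightarrow> H \<in> CG"
  by (induction rule: res_class.induct) (auto intro: one_cg)

lemma height:
  assumes "H \<in> CG"
  shows "ht H < omega1" "res_class G T (ht H) H"
proof -
  have "\<exists>\<alpha>. \<alpha> < omega1 \<and> res_class G T \<alpha> H"
    using height_exists assms by (metis order_le_less_trans)
  then have "ht H < omega1 \<and> res_class G T (ht H) H"
    unfolding residual_height_def by (rule LeastI_ex)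
  then show "ht H < omega1" "res_class G T (ht H) H" by auto
qed

lemma height_le:
  assumes "res_class G T \<alpha> H"
  shows "ht H \<le> \<alpha>"
proof (cases "\<alpha> < omega1")
  case True
  then show ?thesis unfolding residual_height_def using assms by (intro Least_le) simp
next
  case False
  then show ?thesis using height(1)[OF res_class_cg[OF assms]] by simp
qed

lemma height_eq_0_iff:
  assumes "H \<in> CG"
  shows "ht H = 0 \<longleftrightarrow> H = {\<one>}"
proof
  show "ht H = 0 \<Longrightarrow> H = {\<one>}" using height(2)[OF assms] res_class_zero by metis
  show "H = {\<one>} \<Longrightarrow> ht H = 0" using height_le[OF res_class.zero] by (simp add: order_antisym)
qed

text \<open>Membership at a limit level comes from a smaller level, so a least level is never a
  limit.\<close>

lemma height_cases:
  assumes "H \<in> CG"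
  obtains "ht H = 0" | \<delta> where "ht H = \<delta> + 1"
  using height(2)[OF assms]
proof cases
  case one
  then show ?thesis using that(2)[of 0] by simp
next
  case (limit \<beta>)
  then have "ht H \<le> \<beta>" by (intro height_le)
  then show ?thesis using limit by simp
qed (use that in auto)

lemma Res_one: "Res G T {\<one>} = {\<one>}"
  by (rule Res_compact[OF triv_subgroup]) (simp add: topspace_eq)

text \<open>The relation \<open>res_prec\<close> also demands \<open>M \<noteq> H\<close>. This is
  automatic here, since \<open>M = H\<close> would give \<open>H \<subseteq> Res G T H\<close>,
  which \<open>not_subset_Res\<close> allows only for the trivial group.\<close>

lemma height_less:
  assumes H: "H \<in> CG" and M: "M \<in> CG" "M \<subseteq> Res G T H" "M \<noteq> {\<one>}"
  shows "ht M < ht H"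
proof -
  have "H \<noteq> {\<one>}"
  proof
    assume "H = {\<one>}"
    then have "M \<subseteq> {\<one>}" using M Res_one by simp
    then show False using M subgroup.one_closed by (auto simp: cg_subgroups_iff)
  qed
  moreover then have "M \<noteq> H" using not_subset_Res[OF H] M by blast
  ultimately obtain \<beta> where "\<beta> < ht H" "res_class G T \<beta> M"
    using res_class_pred[OF height(2)[OF H] _ is_group M(1)] M by (auto simp: res_prec_def)
  then show ?thesis using height_le by (metis order_le_less_trans)
qed

lemma Res_height_one:
  assumes H: "H \<in> CG" "ht H \<le> 1"
  shows "Res G T H = {\<one>}"
proof (cases "ht H = 0")
  case True
  then show ?thesis using height_eq_0_iff H Res_one by simp
next
  case False
  then have one: "ht H = 1" using H by (metis ordinal_less_one_iff order_le_less)
  have "res_class G T 1 H" using height(2)[OF H(1)] one by simp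
  then show ?thesis
  proof cases
    case (succ \<gamma>)
    then have "\<gamma> < 1" using ordinal_less_succ[of \<gamma>] by simp
    then show ?thesis using succ by (simp add: ordinal_one_le_iff)
  next
    case (limit \<beta>)
    then show ?thesis using not_is_limit_succ[of 0] by simp
  qed simp_all
qed

text \<open>Residuals are monotone, so a nontrivial \<open>L\<close> below \<open>H\<close> lies in
  the residual of \<open>H'\<close> and \<open>height_less\<close> puts its height below that of
  \<open>H'\<close>, even if \<open>L\<close> is \<open>H'\<close>. Height 1 is treated apart,
  because it is governed by the rule \<open>one\<close>.\<close>

lemma height_mono:
  assumes H: "H \<in> CG" "H' \<in> CG" "H \<subseteq> H'"
  shows "ht H \<le> ht H'"
  using H(2)
proof (cases rule: height_cases)
  case 1
  then have "H' = {\<one>}" using height_eq_0_iff H by simp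
  moreover have "\<one> \<in> H" using H(1) by (simp add: cg_subgroups_iff subgroup.one_closed)
  ultimately have "H = {\<one>}" using H(3) by blast
  then show ?thesis using height_eq_0_iff[OF H(1)] by simp
next
  case (2 \<delta>)
  have R: "Res G T H \<subseteq> Res G T H'" by (rule Res_mono[OF H(3)])
  show ?thesis
  proof (cases "\<delta> = 0")
    case True
    have "subgroup (Res G T H) G"
      by (rule Res_subgroup[OF openin_carrier_self]) (use H in \<open>auto simp: cg_subgroups_iff subgroup.mem_carrier\<close>)
    then have "\<one> \<in> Res G T H" by (rule subgroup.one_closed)
    moreover have "Res G T H' = {\<one>}" by (rule Res_height_one[OF H(2)]) (use True 2 in simp)
    ultimately have "Res G T H = {\<one>}" using R by blast
    then have "ht H \<le> 1" by (intro height_le res_class.one H(1))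
    then show ?thesis using True 2 by simp
  next
    case False
    have "res_class G T (\<delta> + 1) H"
    proof (rule res_class.succ[OF _ H(1)])
      show "1 \<le> \<delta>" using False by (simp add: ordinal_one_le_iff)
      fix L assume L: "L \<in> CG" "res_prec G T L H"
      have "ht L \<le> \<delta>"
      proof (cases "L = {\<one>}")
        case True
        then show ?thesis using height_eq_0_iff[OF L(1)] by simp
      next
        case False
        then have "ht L < ht H'" using height_less[OF H(2) L(1)] L R by (auto simp: res_prec_def)
        then show ?thesis using 2 by (simp add: ordinal_less_add_one_iff)
      qed
      then show "\<exists>\<beta>\<le>\<delta>. res_class G T \<beta> L" using height(2)[OF L(1)] by blast
    qed
    then show ?thesis using height_le 2 by simp
  qed
qed

lemma carrier_cg: "compactly_generated G T \<Longrightarrow> carrier G \<in> CG"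
  unfolding cg_subgroups_iff compactly_generated_def using compactin_carrier by auto

lemma rank_eq:
  assumes "compactly_generated G T"
  shows "residual_rank G T = ht (carrier G) + 1"
  unfolding residual_rank_def
proof (rule ord_sup_plus_max)
  show "ht (carrier G) + 1 \<in> (\<lambda>K. ht K + 1) ` CG" using carrier_cg[OF assms] by blast
  fix \<alpha> assume "\<alpha> \<in> (\<lambda>K. ht K + 1) ` CG"
  then obtain K where K: "K \<in> CG" "\<alpha> = ht K + 1" by blast
  then have "ht K \<le> ht (carrier G)"
    by (intro height_mono carrier_cg assms) (auto simp: cg_subgroups_iff subgroup.mem_carrier)
  then show "\<alpha> \<le> ht (carrier G) + 1" using K by (simp add: ordinal_succ_le_iff ordinal_less_add_one_iff)
qed

end

lemma elementary_founded_group: "elementary_group G T \<Longrightarrow> founded_group G T"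
  using elementary_group_founded by (auto simp: founded_tdlc_def founded_group_def founded_group_axioms_def)

section \<open>The wreath product\<close>

locale wreath =
  L: founded_group L TL + K: founded_group K TK + act: group_action K X \<phi>
  for L :: "'l monoid" and TL :: "'l topology" and K :: "'k monoid" and TK :: "'k topology"
    and X :: "'x set" and \<phi> :: "'k \<Rightarrow> 'x \<Rightarrow> 'x" +
  fixes U :: "'l set"
  assumes X_nonempty: "X \<noteq> {}"
    and stab_compact: "\<And>x. x \<in> X \<Longrightarrow> compactin TK (stabilizer K \<phi> x)"
    and stab_open: "\<And>x. x \<in> X \<Longrightarrow> openin TK (stabilizer K \<phi> x)"
    and U_subgroup: "subgroup U L" and U_compact: "compactin TL U" and U_open: "openin TL U"
begin

definition sumset :: "('x \<Rightarrow> 'l) set" where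
  "sumset = {f \<in> X \<rightarrow>\<^sub>E carrier L. finite {x \<in> X. f x \<notin> U}}"

abbreviation "W \<equiv> wreath_product L U K X \<phi>"
abbreviation "TW \<equiv> wreath_topology L TL U TK X"
abbreviation "TN \<equiv> restricted_sum_topology X L TL U"
abbreviation "TP \<equiv> product_topology (\<lambda>_. subtopology TL U) X"
abbreviation "unit_fun \<equiv> (\<lambda>x\<in>X. \<one>\<^bsub>L\<^esub>)"
definition delta :: "'x \<Rightarrow> 'l \<Rightarrow> 'x \<Rightarrow> 'l" where "delta y l = (\<lambda>x\<in>X. if x = y then l else \<one>\<^bsub>L\<^esub>)"
definition emb :: "'x \<Rightarrow> 'l \<Rightarrow> ('x \<Rightarrow> 'l) \<times> 'k" where "emb y l = (delta y l, \<one>\<^bsub>K\<^esub>)"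
definition top_emb :: "'k \<Rightarrow> ('x \<Rightarrow> 'l) \<times> 'k" where "top_emb k = (unit_fun, k)"

lemma U_carrier: "U \<subseteq> carrier L"
  using U_subgroup by (simp add: subgroup.subset)

lemma carrier_restricted_sum: "carrier (restricted_sum X L U) = sumset"
  by (auto simp: restricted_sum_def sumset_def)

lemma carrier_W: "carrier W = sumset \<times> carrier K"
  by (simp add: wreath_product_def semidirect_product_def carrier_restricted_sum)

lemma mem_carrier_W [simp]: "(f, k) \<in> carrier W \<longleftrightarrow> f \<in> sumset \<and> k \<in> carrier K"
  by (simp add: carrier_W)

lemma mult_W [simp]:
  "(f, k) \<otimes>\<^bsub>W\<^esub> (g, l) = (\<lambda>x\<in>X. f x \<otimes>\<^bsub>L\<^esub> g (\<phi> (inv\<^bsub>K\<^esub> k) x), k \<otimes>\<^bsub>K\<^esub> l)"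
  by (auto simp: wreath_product_def semidirect_product_def restricted_sum_def coordinate_action_def
      product_group_def)

lemma one_W: "\<one>\<^bsub>W\<^esub> = (unit_fun, \<one>\<^bsub>K\<^esub>)"
  by (simp add: wreath_product_def semidirect_product_def restricted_sum_def)

lemma act_closed [simp]: "k \<in> carrier K \<Longrightarrow> x \<in> X \<Longrightarrow> \<phi> k x \<in> X"
  using act.element_image by blast

lemma act_mult: "k \<in> carrier K \<Longrightarrow> l \<in> carrier K \<Longrightarrow> x \<in> X \<Longrightarrow> \<phi> (k \<otimes>\<^bsub>K\<^esub> l) x = \<phi> k (\<phi> l x)"
  using act.composition_rule by blast

lemma act_one [simp]: "x \<in> X \<Longrightarrow> \<phi> \<one>\<^bsub>K\<^esub> x = x"
  using act.id_eq_one by (metis restrict_apply')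

lemma act_inv [simp]:
  assumes "k \<in> carrier K" "x \<in> X"
  shows "\<phi> (inv\<^bsub>K\<^esub> k) (\<phi> k x) = x" "\<phi> k (\<phi> (inv\<^bsub>K\<^esub> k) x) = x"
  using act_mult[of "inv\<^bsub>K\<^esub> k" k x] act_mult[of k "inv\<^bsub>K\<^esub> k" x] assms by auto

lemma act_inv_eq_iff: "k \<in> carrier K \<Longrightarrow> x \<in> X \<Longrightarrow> y \<in> X \<Longrightarrow> \<phi> (inv\<^bsub>K\<^esub> k) x = y \<longleftrightarrow> x = \<phi> k y"
  using act_inv by metis

lemma sumsetD:
  assumes "f \<in> sumset"
  shows "\<And>x. x \<in> X \<Longrightarrow> f x \<in> carrier L" "f \<in> extensional X" "finite {x \<in> X. f x \<notin> U}"
  using assms by (auto simp: sumset_def PiE_def)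

lemma sumsetI:
  assumes "\<And>x. x \<in> X \<Longrightarrow> f x \<in> carrier L" "f \<in> extensional X" "finite F" "\<And>x. x \<in> X - F \<Longrightarrow> f x \<in> U"
  shows "f \<in> sumset"
proof -
  have "{x \<in> X. f x \<notin> U} \<subseteq> F" using assms by blast
  then show ?thesis using assms finite_subset by (auto simp: sumset_def PiE_def)
qed

lemma unit_fun_sumset [simp]: "unit_fun \<in> sumset"
  by (rule sumsetI[where F = "{}"]) (auto simp: subgroup.one_closed[OF U_subgroup])

lemma delta_sumset [simp]: "l \<in> carrier L \<Longrightarrow> delta y l \<in> sumset"
  by (rule sumsetI[where F = "{y}"]) (auto simp: delta_def subgroup.one_closed[OF U_subgroup])

lemma delta_apply: "x \<in> X \<Longrightarrow> delta y l x = (if x = y then l else \<one>\<^bsub>L\<^esub>)"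
  by (simp add: delta_def)

lemma PiE_U_sumset: "u \<in> X \<rightarrow>\<^sub>E U \<Longrightarrow> u \<in> sumset"
  using U_carrier by (intro sumsetI[where F = "{}"]) (auto simp: PiE_def)

lemma mult_sumset:
  assumes f: "f \<in> sumset" and g: "g \<in> sumset" and k: "k \<in> carrier K"
  shows "(\<lambda>x\<in>X. f x \<otimes>\<^bsub>L\<^esub> g (\<phi> k x)) \<in> sumset"
proof (rule sumsetI)
  show "finite ({x \<in> X. f x \<notin> U} \<union> \<phi> (inv\<^bsub>K\<^esub> k) ` {x \<in> X. g x \<notin> U})"
    using sumsetD(3)[OF f] sumsetD(3)[OF g] by simp
  fix x assume x: "x \<in> X - ({x \<in> X. f x \<notin> U} \<union> \<phi> (inv\<^bsub>K\<^esub> k) ` {x \<in> X. g x \<notin> U})"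
  then have "g (\<phi> k x) \<in> U" using k act_inv(1)[OF k, of x] by (metis (mono_tags, lifting) DiffE UnI2 act_closed image_eqI mem_Collect_eq)
  then show "(\<lambda>x\<in>X. f x \<otimes>\<^bsub>L\<^esub> g (\<phi> k x)) x \<in> U"
    using x by (auto intro: subgroup.m_closed[OF U_subgroup])
qed (use sumsetD[OF f] sumsetD[OF g] k in auto)

lemma inv_sumset:
  assumes f: "f \<in> sumset" and k: "k \<in> carrier K"
  shows "(\<lambda>x\<in>X. inv\<^bsub>L\<^esub> (f (\<phi> k x))) \<in> sumset"
proof (rule sumsetI)
  show "finite (\<phi> (inv\<^bsub>K\<^esub> k) ` {x \<in> X. f x \<notin> U})" using sumsetD(3)[OF f] by simp
  fix x assume x: "x \<in> X - \<phi> (inv\<^bsub>K\<^esub> k) ` {x \<in> X. f x \<notin> U}"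
  then have "f (\<phi> k x) \<in> U" using k act_inv(1)[OF k, of x] by (metis (mono_tags, lifting) DiffE act_closed image_eqI mem_Collect_eq)
  then show "(\<lambda>x\<in>X. inv\<^bsub>L\<^esub> (f (\<phi> k x))) x \<in> U"
    using x by (auto intro: subgroup.m_inv_closed[OF U_subgroup])
qed (use sumsetD[OF f] k in auto)

lemma inv_W_aux:
  assumes f: "f \<in> sumset" and k: "k \<in> carrier K"
  shows "(\<lambda>x\<in>X. inv\<^bsub>L\<^esub> (f (\<phi> k x)), inv\<^bsub>K\<^esub> k) \<otimes>\<^bsub>W\<^esub> (f, k) = \<one>\<^bsub>W\<^esub>"
  using sumsetD(1)[OF f] k by (auto simp: one_W restrict_def fun_eq_iff)

lemma group_W: "group W"
proof (rule groupI)
  fix p q r assume pqr: "p \<in> carrier W" "q \<in> carrier W" "r \<in> carrier W"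
  obtain f k g l h m where e: "p = (f, k)" "q = (g, l)" "r = (h, m)" by (metis surj_pair)
  have c: "f \<in> sumset" "g \<in> sumset" "h \<in> sumset" "k \<in> carrier K" "l \<in> carrier K" "m \<in> carrier K"
    using pqr e by auto
  show "p \<otimes>\<^bsub>W\<^esub> q \<otimes>\<^bsub>W\<^esub> r = p \<otimes>\<^bsub>W\<^esub> (q \<otimes>\<^bsub>W\<^esub> r)"
    using sumsetD(1)[OF c(1)] sumsetD(1)[OF c(2)] sumsetD(1)[OF c(3)] c(4-6)
    by (auto simp: e restrict_def fun_eq_iff L.m_assoc K.m_assoc K.inv_mult_group act_mult)
next
  fix p q assume pq: "p \<in> carrier W" "q \<in> carrier W"
  then show "p \<otimes>\<^bsub>W\<^esub> q \<in> carrier W" by (cases p, cases q) (auto intro: mult_sumset)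
next
  fix p assume p: "p \<in> carrier W"
  obtain f k where e: "p = (f, k)" by (metis surj_pair)
  have c: "f \<in> sumset" "k \<in> carrier K" using p e by auto
  have "(\<lambda>x\<in>X. unit_fun x \<otimes>\<^bsub>L\<^esub> f (\<phi> (inv\<^bsub>K\<^esub> \<one>\<^bsub>K\<^esub>) x)) = f"
  proof (rule extensionalityI[of _ X])
    show "f \<in> extensional X" using sumsetD(2)[OF c(1)] .
  qed (use sumsetD(1)[OF c(1)] in auto)
  then show "\<one>\<^bsub>W\<^esub> \<otimes>\<^bsub>W\<^esub> p = p" using c by (simp add: one_W e)
  show "\<exists>q\<in>carrier W. q \<otimes>\<^bsub>W\<^esub> p = \<one>\<^bsub>W\<^esub>"
    using inv_W_aux[OF c] inv_sumset[OF c] c e by (metis K.inv_closed mem_carrier_W)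
qed (simp add: one_W)

sublocale W: group_monoid W
  using group_W by (simp add: group_monoid_def)

lemma inv_W [simp]:
  assumes "f \<in> sumset" "k \<in> carrier K"
  shows "inv\<^bsub>W\<^esub> (f, k) = (\<lambda>x\<in>X. inv\<^bsub>L\<^esub> (f (\<phi> k x)), inv\<^bsub>K\<^esub> k)"
  using W.inv_equality[OF inv_W_aux[OF assms]] assms inv_sumset by simp

lemma snd_hom: "group_hom W K snd"
  by unfold_locales (auto simp: hom_def carrier_W)

lemma emb_hom: "y \<in> X \<Longrightarrow> group_hom L W (emb y)"
  by unfold_locales (auto simp: hom_def emb_def delta_def restrict_def fun_eq_iff delta_sumset[unfolded delta_def restrict_def])

lemma top_emb_hom: "group_hom K W top_emb"
  by unfold_locales (auto simp: hom_def top_emb_def restrict_def fun_eq_iff unit_fun_sumset[unfolded restrict_def])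

lemma emb_eq_one_iff: "y \<in> X \<Longrightarrow> emb y l = \<one>\<^bsub>W\<^esub> \<longleftrightarrow> l = \<one>\<^bsub>L\<^esub>"
  by (auto simp: emb_def one_W delta_def restrict_def fun_eq_iff)

lemma conj_emb:
  assumes "m \<in> carrier K" "y \<in> X" "l \<in> carrier L"
  shows "top_emb m \<otimes>\<^bsub>W\<^esub> emb y l \<otimes>\<^bsub>W\<^esub> inv\<^bsub>W\<^esub> (top_emb m) = emb (\<phi> m y) l"
  using assms by (auto simp: top_emb_def emb_def delta_def restrict_def fun_eq_iff act_inv_eq_iff
      unit_fun_sumset[unfolded restrict_def])

section \<open>Topology of the restricted sum\<close>

lemma topspace_TN: "topspace TN = sumset"
proof
  have "openin TN (topspace TN)" by (rule openin_topspace)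
  then show "topspace TN \<subseteq> sumset"
    unfolding openin_restricted_sum_topology carrier_restricted_sum by blast
  have eq: "{u \<in> topspace TP. f \<otimes>\<^bsub>restricted_sum X L U\<^esub> u \<in> sumset} = topspace TP" if f: "f \<in> sumset" for f
  proof -
    have "f \<otimes>\<^bsub>restricted_sum X L U\<^esub> u \<in> sumset" if u: "u \<in> topspace TP" for u
    proof -
      have "u \<in> sumset" using u U_carrier L.topspace_eq by (intro PiE_U_sumset) (auto simp: PiE_def)
      from mult_sumset[OF f this, of "\<one>\<^bsub>K\<^esub>"] show ?thesis
        by (simp add: restricted_sum_def product_group_def cong: restrict_cong)
    qed
    then show ?thesis by blast
  qed
  have "openin TN sumset"
    unfolding openin_restricted_sum_topology carrier_restricted_sum
  proof (intro conjI ballI order_refl)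
    fix f assume "f \<in> sumset"
    then show "openin TP {u \<in> topspace TP. f \<otimes>\<^bsub>restricted_sum X L U\<^esub> u \<in> sumset}"
      unfolding eq[OF \<open>f \<in> sumset\<close>] by (intro openin_topspace)
  qed
  then show "sumset \<subseteq> topspace TN" by (rule openin_subset)
qed

lemma topspace_TP: "topspace TP = X \<rightarrow>\<^sub>E U"
  using U_carrier L.topspace_eq by (simp add: Int_absorb1)

lemma openin_TN_iff:
  "openin TN S \<longleftrightarrow> S \<subseteq> sumset \<and>
     (\<forall>f\<in>sumset. openin TP {u \<in> X \<rightarrow>\<^sub>E U. (\<lambda>x\<in>X. f x \<otimes>\<^bsub>L\<^esub> u x) \<in> S})"
  unfolding openin_restricted_sum_topology carrier_restricted_sum topspace_TP
  by (simp add: restricted_sum_def product_group_def)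

lemma continuous_map_translate:
  assumes f: "f \<in> sumset"
  shows "continuous_map TP TN (\<lambda>u. \<lambda>x\<in>X. f x \<otimes>\<^bsub>L\<^esub> u x)"
  unfolding continuous_map_def
proof (intro conjI allI impI)
  show "(\<lambda>u. \<lambda>x\<in>X. f x \<otimes>\<^bsub>L\<^esub> u x) \<in> topspace TP \<rightarrow> topspace TN"
    unfolding topspace_TN topspace_TP
  proof
    fix u assume "u \<in> X \<rightarrow>\<^sub>E U"
    from mult_sumset[OF f PiE_U_sumset[OF this], of "\<one>\<^bsub>K\<^esub>"]
    show "(\<lambda>x\<in>X. f x \<otimes>\<^bsub>L\<^esub> u x) \<in> sumset" by (simp cong: restrict_cong)
  qed
  fix S assume "openin TN S"
  then show "openin TP {u \<in> topspace TP. (\<lambda>x\<in>X. f x \<otimes>\<^bsub>L\<^esub> u x) \<in> S}"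
    using f by (auto simp only: openin_TN_iff topspace_TP)
qed

lemma continuous_map_coordinate:
  assumes x: "x \<in> X"
  shows "continuous_map TN TL (\<lambda>f. f x)"
  unfolding continuous_map_def
proof (intro conjI allI impI)
  show "(\<lambda>f. f x) \<in> topspace TN \<rightarrow> topspace TL"
    using x sumsetD by (auto simp: topspace_TN L.topspace_eq)
  fix A assume A: "openin TL A"
  show "openin TN {f \<in> topspace TN. f x \<in> A}"
    unfolding openin_TN_iff topspace_TN
  proof (intro conjI ballI)
    fix f assume f: "f \<in> sumset"
    have "continuous_map TP (subtopology TL U) (\<lambda>u. u x)"
      using x by (rule continuous_map_product_projection)
    then have "continuous_map TP TL (\<lambda>u. u x)" by (rule continuous_map_into_fulltopology)
    then have "continuous_map TP TL (\<lambda>u. f x \<otimes>\<^bsub>L\<^esub> u x)"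
      by (intro L.continuous_map_mult) (use sumsetD(1)[OF f x] in \<open>auto simp: L.topspace_eq\<close>)
    then have o: "openin TP {u \<in> topspace TP. f x \<otimes>\<^bsub>L\<^esub> u x \<in> A}"
      using A by (rule openin_continuous_map_preimage)
    have "(\<lambda>x\<in>X. f x \<otimes>\<^bsub>L\<^esub> u x) \<in> sumset" if "u \<in> X \<rightarrow>\<^sub>E U" for u
      using continuous_map_translate[OF f] that unfolding continuous_map_def topspace_TN topspace_TP by blast
    then have "{u \<in> X \<rightarrow>\<^sub>E U. (\<lambda>x\<in>X. f x \<otimes>\<^bsub>L\<^esub> u x) \<in> {f \<in> sumset. f x \<in> A}}
        = {u \<in> topspace TP. f x \<otimes>\<^bsub>L\<^esub> u x \<in> A}"
      unfolding topspace_TP using x by auto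
    then show "openin TP {u \<in> X \<rightarrow>\<^sub>E U. (\<lambda>x\<in>X. f x \<otimes>\<^bsub>L\<^esub> u x) \<in> {f \<in> sumset. f x \<in> A}}"
      using o by simp
  qed auto
qed

lemma continuous_map_delta:
  assumes y: "y \<in> X"
  shows "continuous_map TL TN (delta y)"
  unfolding continuous_map_def
proof (intro conjI allI impI)
  show "delta y \<in> topspace TL \<rightarrow> topspace TN" by (auto simp: topspace_TN L.topspace_eq)
  fix S assume S: "openin TN S"
  show "openin TL {l \<in> topspace TL. delta y l \<in> S}"
  proof (subst openin_subopen, intro ballI)
    fix a assume "a \<in> {l \<in> topspace TL. delta y l \<in> S}"
    then have a: "a \<in> carrier L" "delta y a \<in> S" by (auto simp: L.topspace_eq)
    have one: "\<one>\<^bsub>L\<^esub> \<in> U" using U_subgroup by (simp add: subgroup.one_closed)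
    \<comment> \<open>Continuity is checked on the coset \<open>a U\<close>, where
      \<open>delta y (a \<otimes> l)\<close> is the product of the fixed \<open>delta y a\<close>
      and a function in the compact group \<open>X \<rightarrow>\<^sub>E U\<close>.\<close>
    have "continuous_map (subtopology TL U) TP (delta y)"
      unfolding continuous_map_componentwise
    proof (intro conjI ballI)
      show "delta y ` topspace (subtopology TL U) \<subseteq> extensional X" by (auto simp: delta_def)
      fix x assume x: "x \<in> X"
      have "continuous_map (subtopology TL U) (subtopology TL U) (\<lambda>l. if x = y then l else \<one>\<^bsub>L\<^esub>)"
        using one U_carrier by (auto simp: L.topspace_eq)
      then show "continuous_map (subtopology TL U) (subtopology TL U) (\<lambda>l. delta y l x)"
        using x by (simp add: delta_def)
    qed
    from continuous_map_compose[OF this continuous_map_translate[OF delta_sumset[OF a(1), of y]]]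
    have "continuous_map (subtopology TL U) TN (\<lambda>l. \<lambda>x\<in>X. delta y a x \<otimes>\<^bsub>L\<^esub> delta y l x)"
      by (simp add: o_def)
    then have "openin (subtopology TL U)
        {l \<in> topspace (subtopology TL U). (\<lambda>x\<in>X. delta y a x \<otimes>\<^bsub>L\<^esub> delta y l x) \<in> S}"
      using S by (rule openin_continuous_map_preimage)
    moreover have "(\<lambda>x\<in>X. delta y a x \<otimes>\<^bsub>L\<^esub> delta y l x) = delta y (a \<otimes>\<^bsub>L\<^esub> l)" for l
      by (auto simp: delta_def restrict_def fun_eq_iff)
    ultimately have o: "openin TL {l \<in> U. delta y (a \<otimes>\<^bsub>L\<^esub> l) \<in> S}"
      using U_open U_carrier by (simp add: openin_open_subtopology L.topspace_eq Int_absorb1)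
    show "\<exists>V. openin TL V \<and> a \<in> V \<and> V \<subseteq> {l \<in> topspace TL. delta y l \<in> S}"
    proof (intro exI conjI)
      show "openin TL {x \<in> carrier L. inv\<^bsub>L\<^esub> a \<otimes>\<^bsub>L\<^esub> x \<in> {l \<in> U. delta y (a \<otimes>\<^bsub>L\<^esub> l) \<in> S}}"
        by (rule L.openin_lcoset[OF o a(1)])
    qed (use a one L.topspace_eq in \<open>auto simp: L.mult_inv_cancel\<close>)
  qed
qed

text \<open>The set is a union of cosets of the open subgroup of functions with values in
  \<open>U\<close>, so its translated traces are everything or nothing.\<close>

lemma openin_TN_outside:
  "openin TN {f \<in> sumset. \<forall>z\<in>X - F. f z \<in> U}"
  unfolding openin_TN_iff
proof (intro conjI ballI)
  fix f assume f: "f \<in> sumset"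
  have iff: "(\<lambda>x\<in>X. f x \<otimes>\<^bsub>L\<^esub> u x) \<in> {f \<in> sumset. \<forall>z\<in>X - F. f z \<in> U} \<longleftrightarrow> (\<forall>z\<in>X - F. f z \<in> U)"
    if u: "u \<in> X \<rightarrow>\<^sub>E U" for u
  proof -
    have "(\<lambda>x\<in>X. f x \<otimes>\<^bsub>L\<^esub> u x) \<in> sumset"
      using continuous_map_translate[OF f] u unfolding continuous_map_def topspace_TN topspace_TP by blast
    moreover have "f z \<otimes>\<^bsub>L\<^esub> u z \<in> U \<longleftrightarrow> f z \<in> U" if z: "z \<in> X" for z
    proof -
      have uz: "u z \<in> U" "u z \<in> carrier L" using u z U_carrier by auto
      have fz: "f z \<in> carrier L" using sumsetD(1)[OF f z] .
      show ?thesis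
      proof
        assume "f z \<otimes>\<^bsub>L\<^esub> u z \<in> U"
        then have "f z \<otimes>\<^bsub>L\<^esub> u z \<otimes>\<^bsub>L\<^esub> inv\<^bsub>L\<^esub> (u z) \<in> U"
          using uz U_subgroup by (simp add: subgroup.m_closed subgroup.m_inv_closed)
        then show "f z \<in> U" using fz uz by (simp add: L.m_assoc)
      qed (use uz U_subgroup in \<open>simp add: subgroup.m_closed\<close>)
    qed
    ultimately show ?thesis by auto
  qed
  have eq: "{u \<in> X \<rightarrow>\<^sub>E U. (\<lambda>x\<in>X. f x \<otimes>\<^bsub>L\<^esub> u x) \<in> {f \<in> sumset. \<forall>z\<in>X - F. f z \<in> U}}
      = (if \<forall>z\<in>X - F. f z \<in> U then topspace TP else {})"
    unfolding topspace_TP using iff by auto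
  have "openin TP (if c then topspace TP else {})" for c
    using openin_topspace[of TP] by (cases c) (simp_all only: if_True if_False openin_empty)
  then show "openin TP {u \<in> X \<rightarrow>\<^sub>E U. (\<lambda>x\<in>X. f x \<otimes>\<^bsub>L\<^esub> u x) \<in> {f \<in> sumset. \<forall>z\<in>X - F. f z \<in> U}}"
    unfolding eq by blast
qed auto

lemma openin_TN_basic:
  assumes S: "openin TN S" "unit_fun \<in> S"
  obtains F where "finite F" "F \<subseteq> X" "\<And>u. u \<in> X \<rightarrow>\<^sub>E U \<Longrightarrow> (\<And>z. z \<in> F \<Longrightarrow> u z = \<one>\<^bsub>L\<^esub>) \<Longrightarrow> u \<in> S"
proof -
  have eq: "(\<lambda>x\<in>X. unit_fun x \<otimes>\<^bsub>L\<^esub> u x) = u" if u: "u \<in> X \<rightarrow>\<^sub>E U" for u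
    by (rule extensionalityI[of _ X]) (use u U_carrier in \<open>auto simp: PiE_def\<close>)
  have "openin TP {u \<in> X \<rightarrow>\<^sub>E U. (\<lambda>x\<in>X. unit_fun x \<otimes>\<^bsub>L\<^esub> u x) \<in> S}"
    using S unit_fun_sumset unfolding openin_TN_iff by blast
  moreover have "{u \<in> X \<rightarrow>\<^sub>E U. (\<lambda>x\<in>X. unit_fun x \<otimes>\<^bsub>L\<^esub> u x) \<in> S} = {u \<in> X \<rightarrow>\<^sub>E U. u \<in> S}"
    using eq by auto
  ultimately have "openin TP {u \<in> X \<rightarrow>\<^sub>E U. u \<in> S}" by simp
  moreover have one: "\<one>\<^bsub>L\<^esub> \<in> U" using U_subgroup by (simp add: subgroup.one_closed)
  then have "unit_fun \<in> {u \<in> X \<rightarrow>\<^sub>E U. u \<in> S}" using S by auto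
  ultimately obtain B where B: "finite {i \<in> X. B i \<noteq> topspace (subtopology TL U)}"
    "unit_fun \<in> Pi\<^sub>E X B" "Pi\<^sub>E X B \<subseteq> {u \<in> X \<rightarrow>\<^sub>E U. u \<in> S}"
    unfolding openin_product_topology_alt by meson
  have ts: "topspace (subtopology TL U) = U" using U_carrier L.topspace_eq by auto
  show ?thesis
  proof (rule that[OF B(1)])
    fix u assume u: "u \<in> X \<rightarrow>\<^sub>E U" "\<And>z. z \<in> {i \<in> X. B i \<noteq> topspace (subtopology TL U)} \<Longrightarrow> u z = \<one>\<^bsub>L\<^esub>"
    have "u \<in> Pi\<^sub>E X B"
    proof (rule PiE_I)
      fix x assume x: "x \<in> X"
      show "u x \<in> B x"
      proof (cases "B x = U")
        case True then show ?thesis using u x by auto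
      next
        case False
        then have "u x = \<one>\<^bsub>L\<^esub>" using u(2) x ts by simp
        moreover have "unit_fun x \<in> B x" using B(2) x by blast
        ultimately show ?thesis using x by simp
      qed
    qed (use u in \<open>auto simp: PiE_def extensional_def\<close>)
    then show "u \<in> S" using B by blast
  qed auto
qed

section \<open>Topology of the wreath product\<close>

lemma topspace_TW: "topspace TW = carrier W"
  by (simp add: wreath_topology_def topspace_TN K.topspace_eq carrier_W)

lemma openin_carrier_W: "openin TW (carrier W)"
  using openin_topspace[of TW] by (simp add: topspace_TW)

lemma continuous_map_snd_W: "continuous_map TW TK snd"
  unfolding wreath_topology_def by (rule continuous_map_snd)

lemma continuous_map_coordinate_W: "x \<in> X \<Longrightarrow> continuous_map TW TL (\<lambda>p. fst p x)"
  unfolding wreath_topology_def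
  using continuous_map_compose[OF continuous_map_fst continuous_map_coordinate] by (simp add: o_def)

lemma continuous_map_emb: "y \<in> X \<Longrightarrow> continuous_map TL TW (emb y)"
  unfolding wreath_topology_def emb_def
  by (intro continuous_map_pairedI continuous_map_delta) (auto simp: K.topspace_eq)

lemma continuous_map_top_emb: "continuous_map TK TW top_emb"
  unfolding wreath_topology_def top_emb_def
  by (intro continuous_map_pairedI) (auto simp: topspace_TN)

lemma continuous_map_base: "continuous_map TN TW (\<lambda>f. (f, \<one>\<^bsub>K\<^esub>))"
  unfolding wreath_topology_def
  by (intro continuous_map_pairedI) (auto simp: K.topspace_eq)

text \<open>A common shape for the trivial group, the copies of subgroups of \<open>L\<close> at one
  coordinate and the sub-wreath products, from which closedness can be read off factor by
  factor.\<close>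

definition coord_box :: "('x \<Rightarrow> 'l set) \<Rightarrow> 'k set \<Rightarrow> (('x \<Rightarrow> 'l) \<times> 'k) set" where
  "coord_box A M = {(f, k). f \<in> sumset \<and> (\<forall>x\<in>X. f x \<in> A x) \<and> k \<in> M}"

lemma closedin_coord_box:
  assumes A: "\<And>x. x \<in> X \<Longrightarrow> closedin TL (A x)" and M: "closedin TK M"
  shows "closedin TW (coord_box A M)"
proof -
  have "coord_box A M = {p \<in> topspace TW. snd p \<in> M} \<inter> (\<Inter>x\<in>X. {p \<in> topspace TW. fst p x \<in> A x})"
    using X_nonempty K.closedin_carrier[OF M] by (auto simp: coord_box_def topspace_TW carrier_W)
  moreover have "closedin TW {p \<in> topspace TW. snd p \<in> M}"
    using continuous_map_snd_W M by (rule closedin_continuous_map_preimage)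
  moreover have "closedin TW (\<Inter>x\<in>X. {p \<in> topspace TW. fst p x \<in> A x})"
    by (rule closedin_Inter)
      (use X_nonempty A closedin_continuous_map_preimage[OF continuous_map_coordinate_W] in auto)
  ultimately show ?thesis by (simp add: closedin_Int)
qed

lemma one_cg_W: "{\<one>\<^bsub>W\<^esub>} \<in> cg_subgroups W TW"
proof -
  have "{\<one>\<^bsub>W\<^esub>} = coord_box (\<lambda>_. {\<one>\<^bsub>L\<^esub>}) {\<one>\<^bsub>K\<^esub>}"
  proof (intro Set.equalityI subsetI)
    fix p assume "p \<in> coord_box (\<lambda>_. {\<one>\<^bsub>L\<^esub>}) {\<one>\<^bsub>K\<^esub>}"
    then obtain f where f: "p = (f, \<one>\<^bsub>K\<^esub>)" "f \<in> sumset" "\<And>x. x \<in> X \<Longrightarrow> f x = \<one>\<^bsub>L\<^esub>"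
      by (auto simp: coord_box_def)
    have "f = unit_fun" by (rule extensionalityI[OF sumsetD(2)[OF f(2)]]) (use f in auto)
    then show "p \<in> {\<one>\<^bsub>W\<^esub>}" by (simp add: one_W f)
  qed (auto simp: one_W coord_box_def)
  then have "closedin TW {\<one>\<^bsub>W\<^esub>}"
    using closedin_coord_box[of "\<lambda>_. {\<one>\<^bsub>L\<^esub>}" "{\<one>\<^bsub>K\<^esub>}"] L.closedin_one K.closedin_one by simp
  moreover have "generate W {\<one>\<^bsub>W\<^esub>} = {\<one>\<^bsub>W\<^esub>}" by (rule W.generate_one)
  ultimately show ?thesis
    unfolding W.cg_subgroups_iff using W.triv_subgroup topspace_TW
    by (intro conjI exI[of _ "{\<one>\<^bsub>W\<^esub>}"]) auto
qed

lemma res_class_cg_W: "res_class W TW \<alpha> H \<Longrightarrow> H \<in> cg_subgroups W TW"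
  by (induction rule: res_class.induct) (auto intro: one_cg_W)

lemma emb_image_cg:
  assumes y: "y \<in> X" and H: "H \<in> cg_subgroups L TL"
  shows "emb y ` H \<in> cg_subgroups W TW"
proof -
  interpret e: group_hom L W "emb y" by (rule emb_hom[OF y])
  obtain C where C: "subgroup H L" "closedin TL H" "compactin TL C" "C \<subseteq> H" "generate L C = H"
    using H by (auto simp: L.cg_subgroups_iff)
  have Hc: "H \<subseteq> carrier L" using C by (simp add: subgroup.subset)
  have "emb y ` H = coord_box (\<lambda>x. if x = y then H else {\<one>\<^bsub>L\<^esub>}) {\<one>\<^bsub>K\<^esub>}"
  proof (intro Set.equalityI subsetI)
    fix p assume "p \<in> coord_box (\<lambda>x. if x = y then H else {\<one>\<^bsub>L\<^esub>}) {\<one>\<^bsub>K\<^esub>}"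
    then obtain f where f: "p = (f, \<one>\<^bsub>K\<^esub>)" "f \<in> sumset" "\<And>x. x \<in> X \<Longrightarrow> f x \<in> (if x = y then H else {\<one>\<^bsub>L\<^esub>})"
      by (auto simp: coord_box_def)
    have "f = delta y (f y)"
    proof (rule extensionalityI[OF sumsetD(2)[OF f(2)]])
      fix x assume "x \<in> X"
      then show "f x = delta y (f y) x" using f(3)[of x] by (simp add: delta_def split: if_splits)
    qed (simp add: delta_def)
    moreover have "f y \<in> H" using f(3)[OF y] by simp
    ultimately show "p \<in> emb y ` H" by (auto simp: emb_def f)
  qed (use Hc in \<open>auto simp: emb_def coord_box_def delta_apply\<close>)
  moreover have "closedin TW (coord_box (\<lambda>x. if x = y then H else {\<one>\<^bsub>L\<^esub>}) {\<one>\<^bsub>K\<^esub>})"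
    by (rule closedin_coord_box) (use C L.closedin_one K.closedin_one in auto)
  moreover have "generate W (emb y ` C) = emb y ` H" using e.generate_img[of C] C Hc by auto
  ultimately show ?thesis
    unfolding W.cg_subgroups_iff
    using e.subgroup_img_is_subgroup[OF C(1)] image_compactin[OF C(3) continuous_map_emb[OF y]] C(4)
    by (metis image_mono)
qed

section \<open>Sub-wreath products over an orbit\<close>

definition orb :: "'x \<Rightarrow> 'k set \<Rightarrow> 'x set" where
  "orb y M = (\<lambda>m. \<phi> m y) ` M"

definition sub_wreath :: "'x \<Rightarrow> 'k set \<Rightarrow> (('x \<Rightarrow> 'l) \<times> 'k) set" where
  "sub_wreath y M = coord_box (\<lambda>x. if x \<in> orb y M then carrier L else {\<one>\<^bsub>L\<^esub>}) M"

lemma mem_sub_wreath: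
  "(f, k) \<in> sub_wreath y M \<longleftrightarrow> f \<in> sumset \<and> (\<forall>x\<in>X - orb y M. f x = \<one>\<^bsub>L\<^esub>) \<and> k \<in> M"
  using sumsetD(1) by (auto simp: sub_wreath_def coord_box_def)

lemma orb_act:
  assumes M: "subgroup M K" and y: "y \<in> X" and k: "k \<in> M" and x: "x \<in> X"
  shows "\<phi> k x \<in> orb y M \<longleftrightarrow> x \<in> orb y M"
proof
  have kc: "k \<in> carrier K" using M k by (simp add: subgroup.mem_carrier)
  assume "\<phi> k x \<in> orb y M"
  then obtain m where m: "m \<in> M" "\<phi> k x = \<phi> m y" by (auto simp: orb_def)
  then have mc: "m \<in> carrier K" using M by (simp add: subgroup.mem_carrier)
  have "x = \<phi> (inv\<^bsub>K\<^esub> k) (\<phi> m y)" using m(2) act_inv(1)[OF kc x] by simp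
  then have "x = \<phi> (inv\<^bsub>K\<^esub> k \<otimes>\<^bsub>K\<^esub> m) y" using kc mc y by (simp add: act_mult)
  moreover have "inv\<^bsub>K\<^esub> k \<otimes>\<^bsub>K\<^esub> m \<in> M" using M m k by (simp add: subgroup.m_closed subgroup.m_inv_closed)
  ultimately show "x \<in> orb y M" by (auto simp: orb_def)
next
  have kc: "k \<in> carrier K" using M k by (simp add: subgroup.mem_carrier)
  assume "x \<in> orb y M"
  then obtain m where m: "m \<in> M" "x = \<phi> m y" by (auto simp: orb_def)
  then have "\<phi> k x = \<phi> (k \<otimes>\<^bsub>K\<^esub> m) y" using M kc y by (simp add: act_mult subgroup.mem_carrier)
  then show "\<phi> k x \<in> orb y M" using M m k by (auto simp: orb_def subgroup.m_closed)
qed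

lemma orb_subset: "subgroup M K \<Longrightarrow> y \<in> X \<Longrightarrow> orb y M \<subseteq> X"
  by (auto simp: orb_def subgroup.mem_carrier)

lemma sub_wreath_subgroup:
  assumes M: "subgroup M K" and y: "y \<in> X"
  shows "subgroup (sub_wreath y M) W"
proof (rule W.subgroupI)
  show "sub_wreath y M \<subseteq> carrier W" using M by (auto simp: mem_sub_wreath carrier_W subgroup.mem_carrier)
  have "\<one>\<^bsub>W\<^esub> \<in> sub_wreath y M" using M by (simp add: one_W mem_sub_wreath subgroup.one_closed)
  then show "sub_wreath y M \<noteq> {}" by blast
  fix p assume p: "p \<in> sub_wreath y M"
  obtain f k where e: "p = (f, k)" by (metis surj_pair)
  have f: "f \<in> sumset" "\<And>x. x \<in> X \<Longrightarrow> x \<notin> orb y M \<Longrightarrow> f x = \<one>\<^bsub>L\<^esub>" "k \<in> M" "k \<in> carrier K" "inv\<^bsub>K\<^esub> k \<in> M"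
    using p M by (auto simp: e mem_sub_wreath subgroup.mem_carrier subgroup.m_inv_closed)
  show "inv\<^bsub>W\<^esub> p \<in> sub_wreath y M"
    using f inv_sumset[OF f(1,4)] orb_act[OF M y f(3)] by (auto simp: e mem_sub_wreath)
  fix q assume q: "q \<in> sub_wreath y M"
  obtain g l where e': "q = (g, l)" by (metis surj_pair)
  have g: "g \<in> sumset" "\<And>x. x \<in> X \<Longrightarrow> x \<notin> orb y M \<Longrightarrow> g x = \<one>\<^bsub>L\<^esub>" "l \<in> M"
    using q by (auto simp: e' mem_sub_wreath)
  show "p \<otimes>\<^bsub>W\<^esub> q \<in> sub_wreath y M"
    using f g mult_sumset[OF f(1) g(1), of "inv\<^bsub>K\<^esub> k"] orb_act[OF M y f(5)] M
    by (auto simp: e e' mem_sub_wreath subgroup.m_closed)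
qed

lemma emb_sub_wreath:
  assumes M: "subgroup M K" and y: "y \<in> X" and l: "l \<in> carrier L"
  shows "emb y l \<in> sub_wreath y M"
proof -
  have "\<phi> \<one>\<^bsub>K\<^esub> y \<in> orb y M" unfolding orb_def using subgroup.one_closed[OF M] by blast
  then have "y \<in> orb y M" using y by simp
  then show ?thesis using l M by (auto simp: emb_def mem_sub_wreath delta_apply subgroup.one_closed)
qed

lemma top_emb_sub_wreath: "top_emb m \<in> sub_wreath y M \<longleftrightarrow> m \<in> M"
  by (auto simp: top_emb_def mem_sub_wreath)

text \<open>Finitely many coordinates, those with value outside \<open>U\<close> and those in
  \<open>F\<close>, can be stripped off with conjugates of \<open>emb y\<close>. What is left takes
  values in \<open>U\<close> and is trivial on \<open>F\<close>, which \<open>base\<close> covers.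
  With \<open>F\<close> empty the lemma serves to find generators; with \<open>F\<close> coming from
  an open subgroup it serves to compute residuals.\<close>

lemma sub_wreath_least:
  assumes Q: "subgroup Q W" and M: "subgroup M K" and y: "y \<in> X"
    and emb: "\<And>l. l \<in> carrier L \<Longrightarrow> emb y l \<in> Q" and top_emb: "\<And>m. m \<in> M \<Longrightarrow> top_emb m \<in> Q"
    and F: "finite F" "F \<subseteq> X"
    and base: "\<And>u. u \<in> X \<rightarrow>\<^sub>E U \<Longrightarrow> (\<And>z. z \<in> F \<Longrightarrow> u z = \<one>\<^bsub>L\<^esub>) \<Longrightarrow>
      (\<And>z. z \<in> X - orb y M \<Longrightarrow> u z = \<one>\<^bsub>L\<^esub>) \<Longrightarrow> (u, \<one>\<^bsub>K\<^esub>) \<in> Q"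
  shows "sub_wreath y M \<subseteq> Q"
proof -
  have oneU: "\<one>\<^bsub>L\<^esub> \<in> U" using U_subgroup by (simp add: subgroup.one_closed)
  have embz: "emb z l \<in> Q" if z: "z \<in> orb y M" and l: "l \<in> carrier L" for z l
  proof -
    obtain m where m: "m \<in> M" "z = \<phi> m y" using z by (auto simp: orb_def)
    have mc: "m \<in> carrier K" using m M by (simp add: subgroup.mem_carrier)
    have "top_emb m \<otimes>\<^bsub>W\<^esub> emb y l \<otimes>\<^bsub>W\<^esub> inv\<^bsub>W\<^esub> (top_emb m) \<in> Q"
      using top_emb[OF m(1)] emb[OF l] Q by (simp add: subgroup.m_closed subgroup.m_inv_closed)
    then show ?thesis using conj_emb[OF mc y l] m by simp
  qed
  \<comment> \<open>The finite set \<open>A\<close> contains the coordinates that may still violate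
    the conditions on values in \<open>U\<close> and on \<open>F\<close>. Those outside the orbit
    need no treatment, as \<open>f\<close> is trivial there.\<close>
  have fin: "(f, \<one>\<^bsub>K\<^esub>) \<in> Q"
    if "finite A" "f \<in> sumset" "\<And>z. z \<in> X - orb y M \<Longrightarrow> f z = \<one>\<^bsub>L\<^esub>"
      "\<And>z. z \<in> X - A \<Longrightarrow> f z \<in> U \<and> (z \<in> F \<longrightarrow> f z = \<one>\<^bsub>L\<^esub>)" for A f
    using that
  proof (induction A arbitrary: f rule: finite_induct)
    case empty
    show ?case
      by (rule base) (use empty F sumsetD(2)[OF empty(1)] in \<open>auto simp: PiE_def\<close>)
  next
    case (insert a A)
    show ?case
    proof (cases "a \<in> orb y M")
      case False
      show ?thesis
      proof (rule insert.IH[OF insert.prems(1,2)])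
        fix z assume "z \<in> X - A"
        then show "f z \<in> U \<and> (z \<in> F \<longrightarrow> f z = \<one>\<^bsub>L\<^esub>)"
          using insert.prems(2)[of z] insert.prems(3)[of z] False oneU by (cases "z = a") auto
      qed
    next
      case True
      then have aX: "a \<in> X" using orb_subset[OF M y] by blast
      have fa: "f a \<in> carrier L" using sumsetD(1)[OF insert.prems(1) aX] .
      define g where "g = f(a := \<one>\<^bsub>L\<^esub>)"
      have gs: "g \<in> sumset"
      proof (rule sumsetI[where F = "{x \<in> X. f x \<notin> U}"])
        show "finite {x \<in> X. f x \<notin> U}" using sumsetD(3)[OF insert.prems(1)] .
        show "g \<in> extensional X" using sumsetD(2)[OF insert.prems(1)] aX by (auto simp: g_def extensional_def)
      qed (use sumsetD[OF insert.prems(1)] oneU in \<open>auto simp: g_def\<close>)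
      have "(g, \<one>\<^bsub>K\<^esub>) \<in> Q"
      proof (rule insert.IH[OF gs])
        fix z assume "z \<in> X - A"
        then show "g z \<in> U \<and> (z \<in> F \<longrightarrow> g z = \<one>\<^bsub>L\<^esub>)"
          using insert.prems(3)[of z] oneU by (auto simp: g_def)
      qed (use insert.prems(2) in \<open>auto simp: g_def\<close>)
      then have "emb a (f a) \<otimes>\<^bsub>W\<^esub> (g, \<one>\<^bsub>K\<^esub>) \<in> Q" using embz[OF True fa] Q by (simp add: subgroup.m_closed)
      moreover have "(\<lambda>x\<in>X. delta a (f a) x \<otimes>\<^bsub>L\<^esub> g x) = f"
        by (rule extensionalityI[of _ X])
          (use sumsetD[OF insert.prems(1)] fa in \<open>auto simp: delta_def g_def\<close>)
      then have "emb a (f a) \<otimes>\<^bsub>W\<^esub> (g, \<one>\<^bsub>K\<^esub>) = (f, \<one>\<^bsub>K\<^esub>)"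
        by (simp add: emb_def cong: restrict_cong)
      ultimately show ?thesis by simp
    qed
  qed
  show ?thesis
  proof
    fix p assume p: "p \<in> sub_wreath y M"
    obtain f k where e: "p = (f, k)" by (metis surj_pair)
    have f: "f \<in> sumset" "\<And>z. z \<in> X - orb y M \<Longrightarrow> f z = \<one>\<^bsub>L\<^esub>" "k \<in> M" using p by (auto simp: e mem_sub_wreath)
    have "(f, \<one>\<^bsub>K\<^esub>) \<in> Q"
      by (rule fin[of "{x \<in> X. f x \<notin> U} \<union> F"]) (use f sumsetD(3)[OF f(1)] F in auto)
    then have "(f, \<one>\<^bsub>K\<^esub>) \<otimes>\<^bsub>W\<^esub> top_emb k \<in> Q" using top_emb[OF f(3)] Q by (simp add: subgroup.m_closed)
    moreover have "(\<lambda>x\<in>X. f x \<otimes>\<^bsub>L\<^esub> unit_fun (\<phi> (inv\<^bsub>K\<^esub> \<one>\<^bsub>K\<^esub>) x)) = f"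
      by (rule extensionalityI[of _ X]) (use sumsetD[OF f(1)] in auto)
    then have "(f, \<one>\<^bsub>K\<^esub>) \<otimes>\<^bsub>W\<^esub> top_emb k = (f, k)"
      using f M by (simp add: top_emb_def subgroup.mem_carrier)
    ultimately show "p \<in> Q" by (simp add: e)
  qed
qed

end

section \<open>Residuals in the wreath product\<close>

context wreath
begin

lemma small_base_functions:
  assumes Q: "subgroup Q W" "openin TW Q"
  obtains F where "finite F" "F \<subseteq> X"
    "\<And>u. u \<in> X \<rightarrow>\<^sub>E U \<Longrightarrow> (\<And>z. z \<in> F \<Longrightarrow> u z = \<one>\<^bsub>L\<^esub>) \<Longrightarrow> (u, \<one>\<^bsub>K\<^esub>) \<in> Q"
proof -
  have "openin TN {f \<in> topspace TN. (f, \<one>\<^bsub>K\<^esub>) \<in> Q}"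
    using continuous_map_base Q(2) by (rule openin_continuous_map_preimage)
  moreover have "unit_fun \<in> {f \<in> topspace TN. (f, \<one>\<^bsub>K\<^esub>) \<in> Q}"
    using subgroup.one_closed[OF Q(1)] by (simp add: one_W topspace_TN)
  ultimately obtain F where "finite F" "F \<subseteq> X"
    "\<And>u. u \<in> X \<rightarrow>\<^sub>E U \<Longrightarrow> (\<And>z. z \<in> F \<Longrightarrow> u z = \<one>\<^bsub>L\<^esub>) \<Longrightarrow> u \<in> {f \<in> topspace TN. (f, \<one>\<^bsub>K\<^esub>) \<in> Q}"
    by (rule openin_TN_basic) blast
  then show ?thesis using that by blast
qed

text \<open>A compact generating set consists of the functions on the orbit with values in
  \<open>U\<close>, compact as a product of compact sets, together with compact generating sets of
  \<open>L\<close> at the coordinate \<open>y\<close> and of \<open>M\<close>.\<close>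

lemma sub_wreath_cg:
  assumes M: "M \<in> cg_subgroups K TK" and y: "y \<in> X" and Lc: "compactly_generated L TL"
  shows "sub_wreath y M \<in> cg_subgroups W TW"
proof -
  interpret t: group_hom K W top_emb by (rule top_emb_hom)
  interpret e: group_hom L W "emb y" by (rule emb_hom[OF y])
  obtain CK where CK: "subgroup M K" "closedin TK M" "compactin TK CK" "CK \<subseteq> M" "generate K CK = M"
    using M by (auto simp: K.cg_subgroups_iff)
  obtain CL where CL: "compactin TL CL" "generate L CL = carrier L"
    using Lc by (auto simp: compactly_generated_def)
  have Mc: "M \<subseteq> carrier K" using CK by (simp add: subgroup.subset)
  have oneU: "\<one>\<^bsub>L\<^esub> \<in> U" using U_subgroup by (simp add: subgroup.one_closed)
  define B where "B = Pi\<^sub>E X (\<lambda>x. if x \<in> orb y M then U else {\<one>\<^bsub>L\<^esub>})"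
  have BU: "B \<subseteq> X \<rightarrow>\<^sub>E U" unfolding B_def using oneU by (intro PiE_mono) auto
  have Bk: "compactin TP B"
    unfolding B_def compactin_PiE
    using U_compact oneU U_carrier by (auto simp: compactin_subtopology L.topspace_eq)
  have Bs: "B \<subseteq> sumset" using BU PiE_U_sumset by blast
  have "continuous_map TP TN (\<lambda>u. \<lambda>x\<in>X. unit_fun x \<otimes>\<^bsub>L\<^esub> u x)"
    by (rule continuous_map_translate[OF unit_fun_sumset])
  then have "compactin TN ((\<lambda>u. \<lambda>x\<in>X. unit_fun x \<otimes>\<^bsub>L\<^esub> u x) ` B)" using Bk by (rule image_compactin[rotated])
  moreover have "(\<lambda>x\<in>X. unit_fun x \<otimes>\<^bsub>L\<^esub> u x) = u" if u: "u \<in> B" for u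
  proof -
    have "u \<in> sumset" using u Bs by blast
    then show ?thesis by (intro extensionalityI[of _ X]) (auto dest: sumsetD)
  qed
  ultimately have BN: "compactin TN B" by simp
  define C where "C = (\<lambda>f. (f, \<one>\<^bsub>K\<^esub>)) ` B \<union> emb y ` CL \<union> top_emb ` CK"
  have Ck: "compactin TW C" unfolding C_def
    by (intro compactin_Un image_compactin[OF BN continuous_map_base]
        image_compactin[OF CL(1) continuous_map_emb[OF y]] image_compactin[OF CK(3) continuous_map_top_emb])
  have CS: "C \<subseteq> sub_wreath y M"
  proof -
    have "(f, \<one>\<^bsub>K\<^esub>) \<in> sub_wreath y M" if "f \<in> B" for f
    proof -
      have "f x \<in> (if x \<in> orb y M then U else {\<one>\<^bsub>L\<^esub>})" if "x \<in> X" for x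
        using \<open>f \<in> B\<close> that by (simp add: B_def PiE_iff)
      then have "f x = \<one>\<^bsub>L\<^esub>" if "x \<in> X - orb y M" for x
        using that by (metis DiffD1 DiffD2 singletonD)
      then show ?thesis using that Bs CK by (auto simp: mem_sub_wreath subgroup.one_closed)
    qed
    moreover have "emb y l \<in> sub_wreath y M" if "l \<in> CL" for l
      using emb_sub_wreath[OF CK(1) y] that L.compactin_carrier[OF CL(1)] by blast
    ultimately show ?thesis unfolding C_def using CK(4) by (auto simp: top_emb_sub_wreath)
  qed
  have S: "subgroup (sub_wreath y M) W" by (rule sub_wreath_subgroup[OF CK(1) y])
  have Cc: "C \<subseteq> carrier W" using CS S subgroup.subset by blast
  have gen: "generate W C = sub_wreath y M"
  proof
    show "generate W C \<subseteq> sub_wreath y M" by (rule W.generate_subgroup_incl[OF CS S])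
    show "sub_wreath y M \<subseteq> generate W C"
    proof (rule sub_wreath_least[OF W.generate_is_subgroup[OF Cc] CK(1) y, where F = "{}"])
      fix l assume "l \<in> carrier L"
      then have "emb y l \<in> generate W (emb y ` CL)"
        using e.generate_img[OF L.compactin_carrier[OF CL(1)]] CL(2) by blast
      then show "emb y l \<in> generate W C" using W.mono_generate[of "emb y ` CL" C] by (auto simp: C_def)
    next
      fix m assume "m \<in> M"
      then have "top_emb m \<in> generate W (top_emb ` CK)"
        using t.generate_img[of CK] CK Mc by blast
      then show "top_emb m \<in> generate W C" using W.mono_generate[of "top_emb ` CK" C] by (auto simp: C_def)
    next
      fix u assume u: "u \<in> X \<rightarrow>\<^sub>E U" "\<And>z. z \<in> X - orb y M \<Longrightarrow> u z = \<one>\<^bsub>L\<^esub>"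
      then have "u \<in> B" by (auto simp: B_def PiE_iff)
      then show "(u, \<one>\<^bsub>K\<^esub>) \<in> generate W C" by (auto simp: C_def intro: generate.incl)
    qed auto
  qed
  have "closedin TW (sub_wreath y M)" unfolding sub_wreath_def
    by (rule closedin_coord_box) (use CK L.closedin_one in auto)
  then show ?thesis using S Ck CS gen by (auto simp: W.cg_subgroups_iff)
qed

lemma emb_Res_sub_wreath:
  assumes M: "subgroup M K" and y: "y \<in> X" and inf: "infinite (orb y M)"
    and nc: "normal_closure L U = carrier L" and l: "l \<in> carrier L"
  shows "emb y l \<in> Res W TW (sub_wreath y M)"
proof (rule W.mem_ResI)
  fix Q assume Q: "subgroup Q W" "openin TW Q" "normalizes W (sub_wreath y M) Q"
  interpret e: group_hom L W "emb y" by (rule emb_hom[OF y])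
  obtain F where F: "finite F" "F \<subseteq> X"
    "\<And>u. u \<in> X \<rightarrow>\<^sub>E U \<Longrightarrow> (\<And>z. z \<in> F \<Longrightarrow> u z = \<one>\<^bsub>L\<^esub>) \<Longrightarrow> (u, \<one>\<^bsub>K\<^esub>) \<in> Q"
    using small_base_functions[OF Q(1,2)] by blast
  obtain z where "z \<in> orb y M" "z \<notin> F" using inf F(1) by (meson finite_subset subsetI)
  then obtain m where m: "m \<in> M" "\<phi> m y \<notin> F" by (auto simp: orb_def)
  have mc: "m \<in> carrier K" using m M by (simp add: subgroup.mem_carrier)
  have oneU: "\<one>\<^bsub>L\<^esub> \<in> U" using U_subgroup by (simp add: subgroup.one_closed)
  \<comment> \<open>At the coordinate \<open>\<phi> m y\<close>, which avoids \<open>F\<close>, the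
    group \<open>Q\<close> contains \<open>U\<close>, and conjugation by
    \<open>top_emb (inv m)\<close> carries this to \<open>y\<close>. Conjugation by
    \<open>emb y\<close> then shows that \<open>J\<close> is normal in \<open>L\<close>.\<close>
  define J where "J = {l \<in> carrier L. emb y l \<in> Q}"
  have "U \<subseteq> J"
  proof
    fix u assume u: "u \<in> U"
    then have uc: "u \<in> carrier L" using U_carrier by blast
    have "(delta (\<phi> m y) u, \<one>\<^bsub>K\<^esub>) \<in> Q"
      by (rule F(3)) (use u oneU m F(2) in \<open>auto simp: delta_def\<close>)
    then have 1: "emb (\<phi> m y) u \<in> Q" by (simp add: emb_def)
    have "inv\<^bsub>K\<^esub> m \<in> M" using M m by (simp add: subgroup.m_inv_closed)
    then have "top_emb (inv\<^bsub>K\<^esub> m) \<in> sub_wreath y M" by (simp add: top_emb_sub_wreath)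
    then have "top_emb (inv\<^bsub>K\<^esub> m) \<otimes>\<^bsub>W\<^esub> emb (\<phi> m y) u \<otimes>\<^bsub>W\<^esub> inv\<^bsub>W\<^esub> (top_emb (inv\<^bsub>K\<^esub> m)) \<in> Q"
      by (rule normalizesD[OF Q(3) _ 1])
    then have "emb y u \<in> Q" using conj_emb[of "inv\<^bsub>K\<^esub> m" "\<phi> m y" u] mc y uc by simp
    then show "u \<in> J" using uc by (simp add: J_def)
  qed
  moreover have "J \<lhd> L"
  proof (rule L.normal_invI)
    show "subgroup J L" unfolding J_def by (rule e.subgroup_preimage[OF Q(1)])
    fix a j assume a: "a \<in> carrier L" and j: "j \<in> J"
    have "emb y a \<otimes>\<^bsub>W\<^esub> emb y j \<otimes>\<^bsub>W\<^esub> inv\<^bsub>W\<^esub> (emb y a) \<in> Q"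
      by (rule normalizesD[OF Q(3) emb_sub_wreath[OF M y a]]) (use j in \<open>simp add: J_def\<close>)
    then show "a \<otimes>\<^bsub>L\<^esub> j \<otimes>\<^bsub>L\<^esub> inv\<^bsub>L\<^esub> a \<in> J" using a j by (simp add: J_def)
  qed
  ultimately have "normal_closure L U \<subseteq> J" by (auto simp: normal_closure_def)
  then show "emb y l \<in> Q" using nc l by (auto simp: J_def)
qed

text \<open>Each admissible open \<open>Q\<close> satisfies the hypotheses of
  \<open>sub_wreath_least\<close>: it contains \<open>L\<close> at \<open>y\<close> by
  \<open>emb_Res_sub_wreath\<close>, the copy of \<open>M'\<close> because \<open>top_emb\<close>
  respects residuals, and the functions trivial on a finite set because it is open. The infinite
  orbit concerns the larger group \<open>M\<close>; that of \<open>M'\<close> may be finite.\<close>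

lemma sub_wreath_Res_sub_wreath:
  assumes M: "subgroup M K" and M': "subgroup M' K" "M' \<subseteq> Res K TK M"
    and y: "y \<in> X" and inf: "infinite (orb y M)" and nc: "normal_closure L U = carrier L"
  shows "sub_wreath y M' \<subseteq> Res W TW (sub_wreath y M)"
proof
  fix p assume p: "p \<in> sub_wreath y M'"
  show "p \<in> Res W TW (sub_wreath y M)"
  proof (rule W.mem_ResI)
    fix Q assume Q: "subgroup Q W" "openin TW Q" "normalizes W (sub_wreath y M) Q"
    have RQ: "Res W TW (sub_wreath y M) \<subseteq> Q"
      by (rule W.Res_least[OF sub_wreath_subgroup[OF M y] Q])
    obtain F where F: "finite F" "F \<subseteq> X"
      "\<And>u. u \<in> X \<rightarrow>\<^sub>E U \<Longrightarrow> (\<And>z. z \<in> F \<Longrightarrow> u z = \<one>\<^bsub>L\<^esub>) \<Longrightarrow> (u, \<one>\<^bsub>K\<^esub>) \<in> Q"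
      using small_base_functions[OF Q(1,2)] by blast
    have "sub_wreath y M' \<subseteq> Q"
    proof (rule sub_wreath_least[OF Q(1) M'(1) y])
      show "emb y l \<in> Q" if "l \<in> carrier L" for l
        using emb_Res_sub_wreath[OF M y inf nc that] RQ by blast
      have "top_emb ` M \<subseteq> sub_wreath y M" by (auto simp: top_emb_sub_wreath)
      then show "top_emb m \<in> Q" if "m \<in> M'" for m
        using continuous_hom_Res[OF top_emb_hom continuous_map_top_emb K.topspace_eq M, of "sub_wreath y M" m]
          that M' RQ by (auto simp: top_emb_sub_wreath)
    qed (use F in auto)
    then show "p \<in> Q" using p by blast
  qed
qed

text \<open>With a finite orbit, \<open>M\<close> would be a finite union of translates of its
  intersection with the compact stabilizer of \<open>y\<close>, hence compact, and compact groups
  have trivial residual.\<close>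

lemma infinite_orb:
  assumes M: "M \<in> cg_subgroups K TK" "Res K TK M \<noteq> {\<one>\<^bsub>K\<^esub>}" and y: "y \<in> X"
  shows "infinite (orb y M)"
proof
  assume fin: "finite (orb y M)"
  have Ms: "subgroup M K" "closedin TK M" using M by (auto simp: K.cg_subgroups_iff)
  have Mc: "M \<subseteq> carrier K" using Ms by (simp add: subgroup.subset)
  let ?S = "stabilizer K \<phi> y \<inter> M"
  have Sk: "compactin TK ?S" using K.compactin_Int_closedin[OF stab_compact[OF y] Ms(2)] .
  obtain r where r: "\<And>z. z \<in> orb y M \<Longrightarrow> r z \<in> M \<and> z = \<phi> (r z) y"
    unfolding orb_def by (metis imageE)
  have "M = (\<Union>z\<in>orb y M. (\<lambda>x. r z \<otimes>\<^bsub>K\<^esub> x) ` ?S)"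
  proof (intro Set.equalityI subsetI)
    fix m assume m: "m \<in> M"
    let ?z = "\<phi> m y"
    have z: "?z \<in> orb y M" using m by (auto simp: orb_def)
    have c: "m \<in> carrier K" "r ?z \<in> carrier K" "?z \<in> X" using m r[OF z] Mc y by auto
    have "\<phi> (inv\<^bsub>K\<^esub> (r ?z) \<otimes>\<^bsub>K\<^esub> m) y = \<phi> (inv\<^bsub>K\<^esub> (r ?z)) ?z"
      using c y by (simp add: act_mult)
    moreover have "\<phi> (inv\<^bsub>K\<^esub> (r ?z)) ?z = y" using act_inv(1)[OF c(2) y] r[OF z] by metis
    ultimately have "inv\<^bsub>K\<^esub> (r ?z) \<otimes>\<^bsub>K\<^esub> m \<in> ?S"
      using c y m r[OF z] Ms by (simp add: stabilizer_def subgroup.m_closed subgroup.m_inv_closed)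
    moreover have "m = r ?z \<otimes>\<^bsub>K\<^esub> (inv\<^bsub>K\<^esub> (r ?z) \<otimes>\<^bsub>K\<^esub> m)" using c by (simp add: K.mult_inv_cancel)
    ultimately show "m \<in> (\<Union>z\<in>orb y M. (\<lambda>x. r z \<otimes>\<^bsub>K\<^esub> x) ` ?S)" using z by blast
  next
    fix m assume "m \<in> (\<Union>z\<in>orb y M. (\<lambda>x. r z \<otimes>\<^bsub>K\<^esub> x) ` ?S)"
    then show "m \<in> M" using r Ms by (auto simp: subgroup.m_closed)
  qed
  moreover have "compactin TK (\<Union>z\<in>orb y M. (\<lambda>x. r z \<otimes>\<^bsub>K\<^esub> x) ` ?S)"
  proof (rule compactin_Union)
    fix A assume "A \<in> (\<lambda>z. (\<lambda>x. r z \<otimes>\<^bsub>K\<^esub> x) ` ?S) ` orb y M"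
    then obtain z where z: "z \<in> orb y M" "A = (\<lambda>x. r z \<otimes>\<^bsub>K\<^esub> x) ` ?S" by blast
    have "r z \<in> carrier K" using r[OF z(1)] Mc by blast
    then show "compactin TK A" unfolding z(2) by (intro image_compactin[OF Sk] K.continuous_map_lmult)
  qed (use fin in simp)
  ultimately have "compactin TK M" by simp
  then show False using K.Res_compact[OF Ms(1)] M by simp
qed

section \<open>Projections of a subgroup to the top group and to the coordinates\<close>

definition top_closure :: "(('x \<Rightarrow> 'l) \<times> 'k) set \<Rightarrow> 'k set" where
  "top_closure H = K.cl (snd ` H)"

definition coord_closure :: "'x \<Rightarrow> (('x \<Rightarrow> 'l) \<times> 'k) set \<Rightarrow> 'l set" where
  "coord_closure x H = L.cl ((\<lambda>p. fst p x) ` H)"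

lemma snd_image_subset_top_closure:
  assumes "H \<subseteq> carrier W" shows "snd ` H \<subseteq> top_closure H"
  unfolding top_closure_def
  by (rule closure_of_subset) (use assms in \<open>auto simp: K.topspace_eq carrier_W\<close>)

lemma coord_image_subset_coord_closure:
  assumes "H \<subseteq> carrier W" "x \<in> X" shows "(\<lambda>p. fst p x) ` H \<subseteq> coord_closure x H"
  unfolding coord_closure_def
  by (rule closure_of_subset) (use assms sumsetD(1) in \<open>auto simp: L.topspace_eq carrier_W\<close>)

text \<open>The projection of \<open>H\<close> need not be closed, so closures are taken; a compact
  generating set of the image still leads to one of the closure.\<close>

lemma top_closure_cg:
  assumes H: "H \<in> cg_subgroups W TW"
  shows "top_closure H \<in> cg_subgroups K TK"
proof -
  interpret s: group_hom W K snd by (rule snd_hom)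
  obtain C where C: "subgroup H W" "compactin TW C" "C \<subseteq> H" "generate W C = H"
    using H by (auto simp: W.cg_subgroups_iff)
  have "generate K (snd ` C) = snd ` H"
    using s.generate_img[of C] C by (auto dest: subgroup.subset)
  then show ?thesis
    unfolding top_closure_def
    using K.closure_generate_cg[OF image_compactin[OF C(2) continuous_map_snd_W]] by simp
qed

lemma top_closure_Res:
  assumes H: "H \<in> cg_subgroups W TW" and M: "M \<subseteq> Res W TW H"
  shows "top_closure M \<subseteq> Res K TK (top_closure H)"
proof -
  have Hs: "subgroup H W" using H by (simp add: W.cg_subgroups_iff)
  have Hc: "H \<subseteq> carrier W" using Hs by (simp add: subgroup.subset)
  have TH: "subgroup (top_closure H) K" using top_closure_cg[OF H] by (simp add: K.cg_subgroups_iff)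
  have "snd ` M \<subseteq> Res K TK (top_closure H)"
    using continuous_hom_Res[OF snd_hom continuous_map_snd_W topspace_TW Hs snd_image_subset_top_closure[OF Hc]] M
    by blast
  moreover have "closedin TK (Res K TK (top_closure H))"
    by (rule K.Res_closedin) (use TH in \<open>simp add: subgroup.subset\<close>)
  ultimately show ?thesis unfolding top_closure_def[of M] by (rule closure_of_minimal)
qed

text \<open>Every element has only finitely many coordinates outside \<open>U\<close>, and the
  elements with a given exceptional set form an open set. By compactness one finite \<open>F\<close>
  serves for all generators, and the condition attached to it defines a subgroup of the
  base.\<close>

lemma base_subgroup_support:
  assumes H: "H \<in> cg_subgroups W TW" and base: "\<And>p. p \<in> H \<Longrightarrow> snd p = \<one>\<^bsub>K\<^esub>"
  obtains F where "finite F" "F \<subseteq> X" "\<And>p x. p \<in> H \<Longrightarrow> x \<in> X - F \<Longrightarrow> fst p x \<in> U"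
proof -
  obtain C where C: "subgroup H W" "compactin TW C" "C \<subseteq> H" "generate W C = H"
    using H by (auto simp: W.cg_subgroups_iff)
  have Hc: "H \<subseteq> carrier W" using C by (simp add: subgroup.subset)
  let ?E = "\<lambda>F. {p \<in> topspace TW. fst p \<in> {f \<in> sumset. \<forall>z\<in>X - F. f z \<in> U}}"
  have o: "openin TW (?E F)" for F
    using continuous_map_fst openin_TN_outside unfolding wreath_topology_def
    by (rule openin_continuous_map_preimage)
  have "C \<subseteq> \<Union>(?E ` {F. finite F \<and> F \<subseteq> X})"
  proof
    fix p assume p: "p \<in> C"
    then have pc: "p \<in> carrier W" using C Hc by blast
    then have "fst p \<in> sumset" by (auto simp: carrier_W)
    then have "p \<in> ?E {x \<in> X. fst p x \<notin> U}" using pc by (auto simp: topspace_TW)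
    moreover have "finite {x \<in> X. fst p x \<notin> U}" using sumsetD(3)[OF \<open>fst p \<in> sumset\<close>] .
    ultimately show "p \<in> \<Union>(?E ` {F. finite F \<and> F \<subseteq> X})" by blast
  qed
  moreover have "\<forall>V\<in>?E ` {F. finite F \<and> F \<subseteq> X}. openin TW V" using o by blast
  ultimately obtain \<F> where \<F>: "finite \<F>" "\<F> \<subseteq> ?E ` {F. finite F \<and> F \<subseteq> X}" "C \<subseteq> \<Union>\<F>"
    using C(2) unfolding compactin_def by meson
  obtain I where I: "I \<subseteq> {F. finite F \<and> F \<subseteq> X}" "finite I" "\<F> = ?E ` I"
    using finite_subset_image[OF \<F>(1,2)] by blast
  define F where "F = \<Union>I"
  have F: "finite F" "F \<subseteq> X" using I by (auto simp: F_def)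
  define E where "E = coord_box (\<lambda>x. if x \<in> F then carrier L else U) {\<one>\<^bsub>K\<^esub>}"
  have memE: "(f, k) \<in> E \<longleftrightarrow> f \<in> sumset \<and> (\<forall>x\<in>X - F. f x \<in> U) \<and> k = \<one>\<^bsub>K\<^esub>" for f k
    using sumsetD(1) by (auto simp: E_def coord_box_def)
  have "subgroup E W"
  proof (rule W.subgroupI)
    show "E \<subseteq> carrier W" by (auto simp: memE carrier_W)
    have "\<one>\<^bsub>W\<^esub> \<in> E" using U_subgroup by (simp add: one_W memE subgroup.one_closed)
    then show "E \<noteq> {}" by blast
    fix p assume p: "p \<in> E"
    obtain f k where e: "p = (f, k)" by (metis surj_pair)
    have f: "f \<in> sumset" "\<And>x. x \<in> X \<Longrightarrow> x \<notin> F \<Longrightarrow> f x \<in> U" "k = \<one>\<^bsub>K\<^esub>" using p by (auto simp: e memE)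
    show "inv\<^bsub>W\<^esub> p \<in> E"
      using f inv_sumset[OF f(1), of "\<one>\<^bsub>K\<^esub>"] U_subgroup by (auto simp: e memE subgroup.m_inv_closed)
    fix q assume q: "q \<in> E"
    obtain g l where e': "q = (g, l)" by (metis surj_pair)
    have g: "g \<in> sumset" "\<And>x. x \<in> X \<Longrightarrow> x \<notin> F \<Longrightarrow> g x \<in> U" "l = \<one>\<^bsub>K\<^esub>" using q by (auto simp: e' memE)
    show "p \<otimes>\<^bsub>W\<^esub> q \<in> E"
      using f g mult_sumset[OF f(1) g(1), of "\<one>\<^bsub>K\<^esub>"] U_subgroup by (auto simp: e e' memE subgroup.m_closed)
  qed
  moreover have "C \<subseteq> E"
  proof
    fix p assume p: "p \<in> C"
    obtain f k where e: "p = (f, k)" by (metis surj_pair)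
    have "(f, k) \<in> carrier W" "k = \<one>\<^bsub>K\<^esub>" using p C(3) Hc base[of p] by (auto simp: e)
    moreover obtain F' where "F' \<in> I" "p \<in> ?E F'" using p \<F>(3) unfolding I(3) by blast
    then have "\<forall>x\<in>X - F. f x \<in> U" by (auto simp: e F_def)
    ultimately show "p \<in> E" by (simp add: e memE)
  qed
  ultimately have "H \<subseteq> E" using W.generate_subgroup_incl C(4) by blast
  moreover have "fst p x \<in> U" if "p \<in> E" "x \<in> X - F" for p x
    using that by (cases p) (auto simp: memE)
  ultimately show ?thesis using that[OF F] by blast
qed

lemma coord_generate:
  assumes H: "H \<in> cg_subgroups W TW" and base: "\<And>p. p \<in> H \<Longrightarrow> snd p = \<one>\<^bsub>K\<^esub>" and x: "x \<in> X"
  obtains C where "compactin TL C" "generate L C = (\<lambda>p. fst p x) ` H"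
proof -
  obtain C where C: "subgroup H W" "compactin TW C" "C \<subseteq> H" "generate W C = H"
    using H by (auto simp: W.cg_subgroups_iff)
  have Hc: "H \<subseteq> carrier W" using C by (simp add: subgroup.subset)
  \<comment> \<open>Evaluation at \<open>x\<close> is multiplicative on elements of the base but not
    on all of \<open>W\<close>, so its domain is restricted to \<open>H\<close>.\<close>
  interpret H: group "W\<lparr>carrier := H\<rparr>" by (rule W.subgroup_imp_group[OF C(1)])
  interpret h: group_hom "W\<lparr>carrier := H\<rparr>" L "\<lambda>p. fst p x"
  proof
    show "(\<lambda>p. fst p x) \<in> hom (W\<lparr>carrier := H\<rparr>) L"
    proof (rule homI)
      fix p assume "p \<in> carrier (W\<lparr>carrier := H\<rparr>)"
      then show "fst p x \<in> carrier L" using Hc sumsetD(1) x by (auto simp: carrier_W)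
      fix q assume q: "q \<in> carrier (W\<lparr>carrier := H\<rparr>)"
      obtain f g where e: "p = (f, \<one>\<^bsub>K\<^esub>)" "q = (g, \<one>\<^bsub>K\<^esub>)"
        using base[of p] base[of q] q \<open>p \<in> carrier (W\<lparr>carrier := H\<rparr>)\<close> by (cases p, cases q) auto
      show "fst (p \<otimes>\<^bsub>W\<lparr>carrier := H\<rparr>\<^esub> q) x = fst p x \<otimes>\<^bsub>L\<^esub> fst q x" using x by (simp add: e)
    qed
  qed
  have "generate (W\<lparr>carrier := H\<rparr>) C = H" using W.generate_consistent[OF C(3,1)] C by simp
  then have "generate L ((\<lambda>p. fst p x) ` C) = (\<lambda>p. fst p x) ` H"
    using h.generate_img[of C] C by simp
  then show ?thesis using that image_compactin[OF C(2) continuous_map_coordinate_W[OF x]] by blast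
qed

lemma coord_closure_cg:
  assumes H: "H \<in> cg_subgroups W TW" and base: "\<And>p. p \<in> H \<Longrightarrow> snd p = \<one>\<^bsub>K\<^esub>" and x: "x \<in> X"
  shows "coord_closure x H \<in> cg_subgroups L TL"
  using coord_generate[OF H base x] L.closure_generate_cg unfolding coord_closure_def by metis

text \<open>The test subgroups \<open>Q\<close> prescribe \<open>A\<close> at \<open>x\<close>,
  \<open>U\<close> off a finite set, nothing at the remaining points of \<open>F\<close>, and a top
  part \<open>S\<close> fixing these finitely many points. \<open>H\<close> normalizes
  \<open>Q\<close>, since its coordinates lie in \<open>U\<close> off \<open>F\<close> and its
  coordinate at \<open>x\<close> normalizes \<open>A\<close>. Varying \<open>A\<close> gives the
  statement on coordinates; shrinking \<open>S\<close> forces the top component to be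
  trivial.\<close>

lemma Res_base:
  assumes H: "H \<in> cg_subgroups W TW" and base: "\<And>p. p \<in> H \<Longrightarrow> snd p = \<one>\<^bsub>K\<^esub>" and x: "x \<in> X"
    and p: "p \<in> Res W TW H"
  shows "snd p = \<one>\<^bsub>K\<^esub>" "fst p x \<in> Res L TL (coord_closure x H)"
proof -
  obtain F where F: "finite F" "F \<subseteq> X" "\<And>p x. p \<in> H \<Longrightarrow> x \<in> X - F \<Longrightarrow> fst p x \<in> U"
    using base_subgroup_support[OF H base] by blast
  have Hs: "subgroup H W" using H by (simp add: W.cg_subgroups_iff)
  have Hc: "H \<subseteq> carrier W" using Hs by (simp add: subgroup.subset)
  let ?F = "insert x F"
  have FX: "?F \<subseteq> X" using F x by simp
  have key: "fst p x \<in> A \<and> snd p \<in> S"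
    if A: "subgroup A L" "openin TL A" "normalizes L (coord_closure x H) A"
      and S: "subgroup S K" "openin TK S" "\<And>s z. s \<in> S \<Longrightarrow> z \<in> ?F \<Longrightarrow> \<phi> s z = z" for A S
  proof -
    define Q where "Q = {(f, k). f \<in> sumset \<and> f x \<in> A \<and> (\<forall>z\<in>X - ?F. f z \<in> U) \<and> k \<in> S}"
    have Sc: "S \<subseteq> carrier K" using S by (simp add: subgroup.subset)
    have out: "\<phi> s z \<in> X - ?F" if s: "s \<in> S" and z: "z \<in> X - ?F" for s z
    proof -
      have sc: "s \<in> carrier K" using s Sc by blast
      have "\<phi> s z \<notin> ?F"
      proof
        assume "\<phi> s z \<in> ?F"
        moreover have "inv\<^bsub>K\<^esub> s \<in> S" using s S by (simp add: subgroup.m_inv_closed)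
        ultimately have "\<phi> (inv\<^bsub>K\<^esub> s) (\<phi> s z) = \<phi> s z" using S(3) by blast
        then have "z = \<phi> s z" using act_inv(1)[OF sc] z by simp
        then show False using z \<open>\<phi> s z \<in> ?F\<close> by simp
      qed
      then show ?thesis using sc z by simp
    qed
    have fixed_x: "\<phi> s x = x" if "s \<in> S" for s using S(3)[OF that] by simp
    have Qs: "subgroup Q W"
    proof (rule W.subgroupI)
      show "Q \<subseteq> carrier W" using Sc by (auto simp: Q_def carrier_W)
      have "\<one>\<^bsub>W\<^esub> \<in> Q" using A S U_subgroup x by (auto simp: Q_def one_W subgroup.one_closed)
      then show "Q \<noteq> {}" by blast
      fix p assume "p \<in> Q"
      then obtain f k where e: "p = (f, k)" "f \<in> sumset" "f x \<in> A" "\<And>z. z \<in> X - ?F \<Longrightarrow> f z \<in> U" "k \<in> S"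
        by (auto simp: Q_def)
      have kc: "k \<in> carrier K" using e Sc by blast
      have ik: "inv\<^bsub>K\<^esub> k \<in> S" using e S by (simp add: subgroup.m_inv_closed)
      have "inv\<^bsub>L\<^esub> (f (\<phi> k z)) \<in> U" if "z \<in> X - ?F" for z
        using e(4)[OF out[OF e(5) that]] U_subgroup by (simp add: subgroup.m_inv_closed)
      then show "inv\<^bsub>W\<^esub> p \<in> Q"
        using e kc inv_sumset[OF e(2) kc] fixed_x[OF e(5)] ik A x by (auto simp: Q_def subgroup.m_inv_closed)
      fix q assume "q \<in> Q"
      then obtain g l where e': "q = (g, l)" "g \<in> sumset" "g x \<in> A" "\<And>z. z \<in> X - ?F \<Longrightarrow> g z \<in> U" "l \<in> S"
        by (auto simp: Q_def)
      have "f z \<otimes>\<^bsub>L\<^esub> g (\<phi> (inv\<^bsub>K\<^esub> k) z) \<in> U" if "z \<in> X - ?F" for z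
        using e(4)[OF that] e'(4)[OF out[OF ik that]] U_subgroup by (simp add: subgroup.m_closed)
      then show "p \<otimes>\<^bsub>W\<^esub> q \<in> Q"
        using e e' mult_sumset[OF e(2) e'(2), of "inv\<^bsub>K\<^esub> k"] kc fixed_x[OF ik] A S x
        by (auto simp: Q_def subgroup.m_closed)
    qed
    have "Q = ({f \<in> topspace TN. f x \<in> A} \<inter> {f \<in> sumset. \<forall>z\<in>X - ?F. f z \<in> U}) \<times> S"
      by (auto simp: Q_def topspace_TN)
    moreover have "openin TN ({f \<in> topspace TN. f x \<in> A} \<inter> {f \<in> sumset. \<forall>z\<in>X - ?F. f z \<in> U})"
      by (intro openin_Int openin_TN_outside openin_continuous_map_preimage[OF continuous_map_coordinate[OF x] A(2)])
    ultimately have Qo: "openin TW Q" using S(2) by (simp add: wreath_topology_def openin_prod_Times_iff)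
    have "normalizes W H Q"
      unfolding normalizes_def
    proof (intro ballI)
      fix h q assume h: "h \<in> H" and "q \<in> Q"
      then obtain f k where e: "q = (f, k)" "f \<in> sumset" "f x \<in> A" "\<And>z. z \<in> X - ?F \<Longrightarrow> f z \<in> U" "k \<in> S"
        by (auto simp: Q_def)
      obtain a where a: "h = (a, \<one>\<^bsub>K\<^esub>)" "a \<in> sumset" using base[OF h] h Hc by (cases h) auto
      have kc: "k \<in> carrier K" "inv\<^bsub>K\<^esub> k \<in> S" using e S Sc by (auto simp: subgroup.m_inv_closed)
      have hq: "h \<otimes>\<^bsub>W\<^esub> q \<otimes>\<^bsub>W\<^esub> inv\<^bsub>W\<^esub> h \<in> carrier W"
        using h Hc e kc(1) by (intro W.m_closed W.inv_closed) auto
      have eq: "h \<otimes>\<^bsub>W\<^esub> q \<otimes>\<^bsub>W\<^esub> inv\<^bsub>W\<^esub> h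
          = (\<lambda>z\<in>X. a z \<otimes>\<^bsub>L\<^esub> f z \<otimes>\<^bsub>L\<^esub> inv\<^bsub>L\<^esub> (a (\<phi> (inv\<^bsub>K\<^esub> k) z)), k)"
        using a e kc(1) by (auto simp: restrict_def fun_eq_iff)
      have aU: "a z \<in> U" if "z \<in> X - ?F" for z using F(3)[OF h, of z] that a by simp
      have "a z \<otimes>\<^bsub>L\<^esub> f z \<otimes>\<^bsub>L\<^esub> inv\<^bsub>L\<^esub> (a (\<phi> (inv\<^bsub>K\<^esub> k) z)) \<in> U" if z: "z \<in> X - ?F" for z
        using aU[OF z] aU[OF out[OF kc(2) z]] e(4)[OF z] U_subgroup
        by (simp add: subgroup.m_closed subgroup.m_inv_closed)
      moreover have "a x \<otimes>\<^bsub>L\<^esub> f x \<otimes>\<^bsub>L\<^esub> inv\<^bsub>L\<^esub> (a x) \<in> A"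
      proof (rule normalizesD[OF A(3) _ e(3)])
        show "a x \<in> coord_closure x H" using coord_image_subset_coord_closure[OF Hc x] h a by force
      qed
      ultimately show "h \<otimes>\<^bsub>W\<^esub> q \<otimes>\<^bsub>W\<^esub> inv\<^bsub>W\<^esub> h \<in> Q"
        using hq x fixed_x[OF kc(2)] e(5) unfolding eq by (auto simp: Q_def)
    qed
    then have "Res W TW H \<subseteq> Q" by (rule W.Res_least[OF Hs Qs Qo])
    then show ?thesis using p by (auto simp: Q_def)
  qed
  define S0 where "S0 = (\<Inter>z\<in>?F. stabilizer K \<phi> z)"
  have S0: "subgroup S0 K" "openin TK S0" "\<And>s z. s \<in> S0 \<Longrightarrow> z \<in> ?F \<Longrightarrow> \<phi> s z = z"
  proof -
    show "subgroup S0 K" unfolding S0_def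
      by (rule K.subgroups_Inter) (use act.stabilizer_subgroup FX in auto)
    show "openin TK S0" unfolding S0_def
      by (rule openin_INT2) (use F stab_open FX in auto)
  qed (auto simp: S0_def stabilizer_def)
  show "fst p x \<in> Res L TL (coord_closure x H)"
    by (rule L.mem_ResI) (use key[OF _ _ _ S0] in blast)
  have Lall: "subgroup (carrier L) L" "openin TL (carrier L)" "normalizes L (coord_closure x H) (carrier L)"
    using L.openin_carrier_self L.subgroup_self coord_closure_cg[OF H base x]
    by (auto simp: L.cg_subgroups_iff normalizes_def subgroup.mem_carrier)
  show "snd p = \<one>\<^bsub>K\<^esub>"
  proof (rule K.mem_all_cos)
    show "snd p \<in> carrier K" using key[OF Lall S0] S0(1) by (auto simp: subgroup.mem_carrier)
    fix V assume V: "K.COS V"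
    have "snd p \<in> S0 \<inter> V"
      using key[OF Lall, of "S0 \<inter> V"] S0 K.cosD[OF V] by (auto simp: K.subgroups_Inter_pair openin_Int)
    then show "snd p \<in> V" by blast
  qed
qed

lemma coord_closure_Res:
  assumes H: "H \<in> cg_subgroups W TW" and base: "\<And>p. p \<in> H \<Longrightarrow> snd p = \<one>\<^bsub>K\<^esub>" and x: "x \<in> X"
    and M: "M \<subseteq> Res W TW H"
  shows "coord_closure x M \<subseteq> Res L TL (coord_closure x H)"
proof -
  have "(\<lambda>p. fst p x) ` M \<subseteq> Res L TL (coord_closure x H)"
    using Res_base(2)[OF H base x] M by blast
  moreover have "closedin TL (Res L TL (coord_closure x H))"
    by (rule L.Res_closedin) (use coord_closure_cg[OF H base x] in \<open>simp add: L.cg_subgroups_iff subgroup.subset\<close>)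
  ultimately show ?thesis unfolding coord_closure_def[of x M] by (rule closure_of_minimal)
qed

text \<open>The closure is a closed subset of the compact group \<open>U\<close>, so its residual is
  trivial.\<close>

lemma height_coord_closure_outside:
  assumes H: "H \<in> cg_subgroups W TW" and base: "\<And>p. p \<in> H \<Longrightarrow> snd p = \<one>\<^bsub>K\<^esub>" and x: "x \<in> X"
    and U: "\<And>p. p \<in> H \<Longrightarrow> fst p x \<in> U"
  shows "L.ht (coord_closure x H) \<le> 1"
proof -
  have cg: "coord_closure x H \<in> cg_subgroups L TL" by (rule coord_closure_cg[OF H base x])
  have "coord_closure x H \<subseteq> U"
    unfolding coord_closure_def
    by (rule closure_of_minimal) (use U L.compactin_closedin[OF U_compact] in auto)
  then have "compactin TL (coord_closure x H)"
    using closed_compactin[OF U_compact] cg by (auto simp: L.cg_subgroups_iff)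
  then have "Res L TL (coord_closure x H) = {\<one>\<^bsub>L\<^esub>}"
    using L.Res_compact cg by (auto simp: L.cg_subgroups_iff)
  then show ?thesis using L.height_le[OF res_class.one[OF cg]] by simp
qed

section \<open>Upper bound for levels in the wreath product\<close>

lemma eq_one_W_if_trivial:
  assumes p: "p \<in> carrier W" "snd p = \<one>\<^bsub>K\<^esub>" "\<And>x. x \<in> X \<Longrightarrow> fst p x = \<one>\<^bsub>L\<^esub>"
  shows "p = \<one>\<^bsub>W\<^esub>"
proof -
  obtain f where f: "p = (f, \<one>\<^bsub>K\<^esub>)" "f \<in> sumset" using p by (cases p) auto
  have "f = unit_fun" by (rule extensionalityI[OF sumsetD(2)[OF f(2)]]) (use p f in auto)
  then show ?thesis by (simp add: one_W f)
qed

lemma Res_W_subgroup: "H \<subseteq> carrier W \<Longrightarrow> subgroup (Res W TW H) W"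
  by (rule W.Res_subgroup[OF openin_carrier_W])

text \<open>The supremum of the coordinate heights is attained up to the value 1, since only
  finitely many coordinates are not inside \<open>U\<close>. The resulting maximum is a successor
  \<open>\<delta> + 1\<close>, as heights are never limits, and all coordinate heights drop to at
  most \<open>\<delta>\<close> when passing into \<open>Res W TW H\<close>.\<close>

lemma base_height_bound:
  assumes "H \<in> cg_subgroups W TW" "\<And>p. p \<in> H \<Longrightarrow> snd p = \<one>\<^bsub>K\<^esub>"
    "\<And>x. x \<in> X \<Longrightarrow> L.ht (coord_closure x H) \<le> \<alpha>"
  shows "\<exists>\<beta>\<le>\<alpha>. res_class W TW \<beta> H"
  using assms
proof (induction \<alpha> arbitrary: H rule: less_induct)
  case (less \<alpha>)
  note H = less.prems(1) and base = less.prems(2) and bound = less.prems(3)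
  have Hs: "subgroup H W" using H by (simp add: W.cg_subgroups_iff)
  have Hc: "H \<subseteq> carrier W" using Hs by (simp add: subgroup.subset)
  have cg: "coord_closure x H \<in> cg_subgroups L TL" if "x \<in> X" for x
    by (rule coord_closure_cg[OF H base that])
  obtain F where F: "finite F" "F \<subseteq> X" "\<And>p x. p \<in> H \<Longrightarrow> x \<in> X - F \<Longrightarrow> fst p x \<in> U"
    using base_subgroup_support[OF H base] by blast
  show ?case
  proof (cases "\<alpha> = 0")
    case True
    have "p = \<one>\<^bsub>W\<^esub>" if p: "p \<in> H" for p
    proof (rule eq_one_W_if_trivial)
      show "p \<in> carrier W" using p Hc by blast
      show "snd p = \<one>\<^bsub>K\<^esub>" using base[OF p] .
      fix x assume x: "x \<in> X"
      have "L.ht (coord_closure x H) = 0" using bound[OF x] True by (simp add: order_antisym)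
      then have "coord_closure x H = {\<one>\<^bsub>L\<^esub>}" using L.height_eq_0_iff[OF cg[OF x]] by simp
      then show "fst p x = \<one>\<^bsub>L\<^esub>" using coord_image_subset_coord_closure[OF Hc x] p by blast
    qed
    then have "H = {\<one>\<^bsub>W\<^esub>}" using subgroup.one_closed[OF Hs] by blast
    then show ?thesis using res_class.zero[of W TW] by (intro exI[of _ 0]) simp
  next
    case False
    \<comment> \<open>The inserted 1 accounts for the coordinates outside \<open>F\<close>, whose
      closures have height at most 1, and it keeps the maximum nonzero.\<close>
    define \<alpha>' where "\<alpha>' = Max (insert 1 ((\<lambda>x. L.ht (coord_closure x H)) ` F))"
    have fin: "finite (insert 1 ((\<lambda>x. L.ht (coord_closure x H)) ` F))" using F by simp
    have "\<alpha>' \<in> insert 1 ((\<lambda>x. L.ht (coord_closure x H)) ` F)"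
      unfolding \<alpha>'_def by (rule Max_in[OF fin]) simp
    then consider "\<alpha>' = 1" | x where "x \<in> X" "\<alpha>' = L.ht (coord_closure x H)" using F by blast
    then obtain \<delta> where \<delta>: "\<alpha>' = \<delta> + 1"
    proof cases
      case 1 then show ?thesis using that[of 0] by simp
    next
      case (2 x)
      have "1 \<le> \<alpha>'" unfolding \<alpha>'_def by (rule Max_ge[OF fin]) simp
      then have "\<alpha>' \<noteq> 0" by (simp add: ordinal_one_le_iff)
      from cg[OF 2(1)] show ?thesis
        by (cases rule: L.height_cases) (use 2 that \<open>\<alpha>' \<noteq> 0\<close> in auto)
    qed
    have "\<alpha>' \<le> \<alpha>" unfolding \<alpha>'_def
      using fin bound F False by (auto simp: ordinal_one_le_iff)
    have hb: "L.ht (coord_closure x H) \<le> \<delta> + 1" if x: "x \<in> X" for x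
    proof (cases "x \<in> F")
      case True
      then show ?thesis unfolding \<delta>[symmetric] \<alpha>'_def using fin by (intro Max_ge) auto
    next
      case False
      have "L.ht (coord_closure x H) \<le> 1"
        by (rule height_coord_closure_outside[OF H base x]) (use F False x in auto)
      also have "1 \<le> \<alpha>'" unfolding \<alpha>'_def by (rule Max_ge[OF fin]) simp
      finally show ?thesis using \<delta> by simp
    qed
    have "res_class W TW (\<delta> + 1) H"
    proof (cases "\<delta> = 0")
      case True
      have "p = \<one>\<^bsub>W\<^esub>" if p: "p \<in> Res W TW H" for p
      proof (rule eq_one_W_if_trivial)
        show "p \<in> carrier W" using p Res_W_subgroup[OF Hc] by (simp add: subgroup.mem_carrier)
        show "snd p = \<one>\<^bsub>K\<^esub>" using Res_base(1)[OF H base _ p] X_nonempty by blast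
        fix x assume x: "x \<in> X"
        have "Res L TL (coord_closure x H) = {\<one>\<^bsub>L\<^esub>}"
          by (rule L.Res_height_one[OF cg[OF x]]) (use hb[OF x] True in simp)
        then show "fst p x = \<one>\<^bsub>L\<^esub>" using Res_base(2)[OF H base x p] by simp
      qed
      then have "Res W TW H = {\<one>\<^bsub>W\<^esub>}"
        using subgroup.one_closed[OF Res_W_subgroup[OF Hc]] by blast
      then show ?thesis using True res_class.one[OF H] by simp
    next
      case False
      show ?thesis
      proof (rule res_class.succ[OF _ H])
        show "1 \<le> \<delta>" using False by (simp add: ordinal_one_le_iff)
        fix M assume M: "M \<in> cg_subgroups W TW" "res_prec W TW M H"
        then have MR: "M \<subseteq> Res W TW H" by (simp add: res_prec_def)
        have "\<delta> < \<alpha>" using \<open>\<alpha>' \<le> \<alpha>\<close> \<delta> by (simp add: ordinal_succ_le_iff)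
        then show "\<exists>\<beta>\<le>\<delta>. res_class W TW \<beta> M"
        proof (rule less.IH[OF _ M(1)])
          show base': "snd p = \<one>\<^bsub>K\<^esub>" if "p \<in> M" for p
            using Res_base(1)[OF H base, of _ p] X_nonempty MR that by blast
          fix x assume x: "x \<in> X"
          have cgM: "coord_closure x M \<in> cg_subgroups L TL" by (rule coord_closure_cg[OF M(1) base' x])
          show "L.ht (coord_closure x M) \<le> \<delta>"
          proof (cases "coord_closure x M = {\<one>\<^bsub>L\<^esub>}")
            case True
            then show ?thesis using L.height_eq_0_iff[OF cgM] by simp
          next
            case False
            have "L.ht (coord_closure x M) < L.ht (coord_closure x H)"
              by (rule L.height_less[OF cg[OF x] cgM coord_closure_Res[OF H base x MR] False])
            then show ?thesis using hb[OF x] by (metis order_less_le_trans ordinal_less_add_one_iff)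
          qed
        qed
      qed
    qed
    then show ?thesis using \<open>\<alpha>' \<le> \<alpha>\<close> \<delta> by blast
  qed
qed

text \<open>Each passage into a residual lowers the height of the projection to \<open>K\<close>,
  unless it is already trivial. In that case the subgroup lies in the base, where the height of
  \<open>L\<close> bounds its level.\<close>

lemma height_bound:
  assumes Lc: "compactly_generated L TL" and Lne: "carrier L \<noteq> {\<one>\<^bsub>L\<^esub>}"
    and H: "H \<in> cg_subgroups W TW"
  shows "\<exists>\<beta>\<le>L.ht (carrier L) + K.ht (top_closure H). res_class W TW \<beta> H"
  using H
proof (induction "K.ht (top_closure H)" arbitrary: H rule: less_induct)
  case (less H)
  note H = less.prems
  let ?l = "L.ht (carrier L)"
  have Lcg: "carrier L \<in> cg_subgroups L TL" by (rule L.carrier_cg[OF Lc])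
  have Hc: "H \<subseteq> carrier W" using H by (simp add: W.cg_subgroups_iff subgroup.subset)
  have cg: "top_closure H \<in> cg_subgroups K TK" by (rule top_closure_cg[OF H])
  from cg show ?case
  proof (cases rule: K.height_cases)
    case 1
    then have "top_closure H = {\<one>\<^bsub>K\<^esub>}" using K.height_eq_0_iff[OF cg] by simp
    then have base: "snd p = \<one>\<^bsub>K\<^esub>" if "p \<in> H" for p
      using snd_image_subset_top_closure[OF Hc] that by blast
    have "\<exists>\<beta>\<le>?l. res_class W TW \<beta> H"
    proof (rule base_height_bound[OF H base])
      fix x assume x: "x \<in> X"
      have c: "coord_closure x H \<in> cg_subgroups L TL" by (rule coord_closure_cg[OF H base x])
      then show "L.ht (coord_closure x H) \<le> ?l"
        by (intro L.height_mono Lcg) (simp_all add: L.cg_subgroups_iff subgroup.subset)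
    qed auto
    then show ?thesis using 1 by simp
  next
    case (2 \<delta>)
    have "res_class W TW ((?l + \<delta>) + 1) H"
    proof (rule res_class.succ[OF _ H])
      \<comment> \<open>Nontriviality of \<open>L\<close> guarantees that the level
        \<open>?l + \<delta>\<close> is at least 1, where the rule \<open>succ\<close> begins, even
        for \<open>\<delta> = 0\<close>.\<close>
      have "?l \<noteq> 0" using L.height_eq_0_iff[OF Lcg] Lne by simp
      then have "1 \<le> ?l" by (simp add: ordinal_one_le_iff)
      then show "1 \<le> ?l + \<delta>" using ordinal_le_add order_trans by blast
      fix M assume M: "M \<in> cg_subgroups W TW" "res_prec W TW M H"
      then have MR: "M \<subseteq> Res W TW H" by (simp add: res_prec_def)
      have cgM: "top_closure M \<in> cg_subgroups K TK" by (rule top_closure_cg[OF M(1)])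
      have "K.ht (top_closure M) < K.ht (top_closure H)"
      proof (cases "top_closure M = {\<one>\<^bsub>K\<^esub>}")
        case True
        then show ?thesis using K.height_eq_0_iff[OF cgM] 2 by (metis ordinal_succ_neq_zero(1) ordinal_zero_le order_le_less)
      next
        case False
        then show ?thesis by (rule K.height_less[OF cg cgM top_closure_Res[OF H MR]])
      qed
      then have "\<exists>\<beta>\<le>?l + K.ht (top_closure M). res_class W TW \<beta> M" "K.ht (top_closure M) \<le> \<delta>"
        using less.hyps M(1) 2 by (auto simp: ordinal_less_add_one_iff)
      then show "\<exists>\<beta>\<le>?l + \<delta>. res_class W TW \<beta> M"
        by (meson ordinal_add_le_cancel order_trans)
    qed
    then show ?thesis using 2 by (auto simp: ordinal_add_assoc)
  qed
qed

section \<open>Lower bound from chains of sub-wreath products\<close>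

lemma emb_inj: "y \<in> X \<Longrightarrow> inj (emb y)"
  by (rule injI) (auto simp: emb_def delta_def restrict_def fun_eq_iff dest!: spec[of _ y])

text \<open>\<open>emb y\<close> carries residuals in \<open>L\<close> into residuals in
  \<open>W\<close>, so everything below \<open>H\<close> is seen below its image; hence the copy in
  \<open>W\<close> cannot have a smaller level than \<open>H\<close> in \<open>L\<close>.\<close>

lemma res_class_emb:
  assumes "res_class W TW \<alpha> H'" "H' = emb y ` H" "y \<in> X" "H \<in> cg_subgroups L TL"
  shows "\<exists>\<beta>\<le>\<alpha>. res_class L TL \<beta> H"
  using assms
proof (induction arbitrary: H rule: res_class.induct)
  case zero
  have "H \<noteq> {}" using zero.prems(3) by (auto simp: L.cg_subgroups_iff dest: subgroup.one_closed)
  moreover have "h = \<one>\<^bsub>L\<^esub>" if "h \<in> H" for h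
    using zero.prems(1) that emb_eq_one_iff[OF zero.prems(2)] by blast
  ultimately have "H = {\<one>\<^bsub>L\<^esub>}" by blast
  then show ?case using res_class.zero[of L TL] by (intro exI[of _ 0]) simp
next
  case (one H')
  have Hs: "subgroup H L" using one.prems by (simp add: L.cg_subgroups_iff)
  have "Res L TL H \<subseteq> {\<one>\<^bsub>L\<^esub>}"
    using continuous_hom_Res[OF emb_hom continuous_map_emb L.topspace_eq Hs order_refl] one emb_eq_one_iff[OF one.prems(2)] by blast
  moreover have "\<one>\<^bsub>L\<^esub> \<in> Res L TL H"
    using L.Res_subgroup[OF L.openin_carrier_self] Hs by (simp add: subgroup.one_closed subgroup.subset)
  ultimately have "Res L TL H = {\<one>\<^bsub>L\<^esub>}" by blast
  then show ?case using res_class.one[OF one.prems(3)] by blast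
next
  case (succ \<gamma> H')
  have Hs: "subgroup H L" using succ.prems by (simp add: L.cg_subgroups_iff)
  have "res_class L TL (\<gamma> + 1) H"
  proof (rule res_class.succ[OF succ.hyps(1) succ.prems(3)])
    fix M assume M: "M \<in> cg_subgroups L TL" "res_prec L TL M H"
    have "res_prec W TW (emb y ` M) H'"
      using M emb_inj[OF succ.prems(2)] succ.prems(1)
        continuous_hom_Res[OF emb_hom continuous_map_emb L.topspace_eq Hs order_refl, OF succ.prems(2,2)]
      by (auto simp: res_prec_def inj_image_eq_iff)
    then obtain \<beta> where "\<beta> \<le> \<gamma>" "\<exists>\<beta>'\<le>\<beta>. res_class L TL \<beta>' M"
      using succ.IH[OF emb_image_cg[OF succ.prems(2) M(1)]] succ.prems(2) M(1) by blast
    then show "\<exists>\<beta>\<le>\<gamma>. res_class L TL \<beta> M" using order_trans by blast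
  qed
  then show ?case by blast
next
  case (limit \<gamma> \<beta> H')
  then obtain \<beta>' where "\<beta>' \<le> \<beta>" "res_class L TL \<beta>' H" by blast
  then show ?case using limit by (meson order_less_imp_le order_trans)
qed

end

text \<open>The counterpart of \<open>height_cases\<close> for an arbitrary given level: a limit
  level is descended until it becomes 0 or a successor.\<close>

lemma res_class_nonlimit:
  assumes "res_class G T \<beta> H"
  shows "\<exists>\<beta>'\<le>\<beta>. res_class G T \<beta>' H \<and> (\<beta>' = 0 \<or> (\<exists>\<delta>. \<beta>' = \<delta> + 1))"
  using assms
proof (induction rule: res_class.induct)
  case zero
  show ?case using res_class.zero by blast
next
  case (one K)
  have "(1::ordinal) = 0 + 1" by simp
  then show ?case using res_class.one[OF one] by blast
next
  case (succ \<gamma> K)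
  have "res_class G T (\<gamma> + 1) K" by (rule res_class.succ) (use succ in blast)+
  then show ?case by blast
next
  case (limit \<gamma> \<beta> K)
  then obtain \<beta>' where "\<beta>' \<le> \<beta>" "res_class G T \<beta>' K \<and> (\<beta>' = 0 \<or> (\<exists>\<delta>. \<beta>' = \<delta> + 1))" by blast
  moreover then have "\<beta>' \<le> \<gamma>" using limit.hyps by simp
  ultimately show ?case by blast
qed

context wreath
begin

text \<open>Some level \<open>\<delta> + 1\<close> at most \<open>\<beta>\<close> contains the
  sub-wreath product. Strictly below it lie the copy of \<open>L\<close>, forcing
  \<open>?l \<le> \<delta>\<close>, and all earlier sub-wreath products, forcing
  \<open>?l + \<gamma> < \<delta>\<close>. The family need only be increasing for
  \<open>res_prec\<close> with infinite orbits, so a collection of witnesses may be reindexed before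
  use.\<close>

lemma lower_bound:
  assumes Lc: "compactly_generated L TL" and Lne: "carrier L \<noteq> {\<one>\<^bsub>L\<^esub>}"
    and nc: "normal_closure L U = carrier L" and y: "y \<in> X"
    and M: "\<And>\<alpha>. \<alpha> < \<mu> \<Longrightarrow> M \<alpha> \<in> cg_subgroups K TK" "\<And>\<alpha>. \<alpha> < \<mu> \<Longrightarrow> infinite (orb y (M \<alpha>))"
      "\<And>\<alpha> \<gamma>. \<gamma> < \<alpha> \<Longrightarrow> \<alpha> < \<mu> \<Longrightarrow> res_prec K TK (M \<gamma>) (M \<alpha>)"
    and \<alpha>: "\<alpha> < \<mu>" and r: "res_class W TW \<beta> (sub_wreath y (M \<alpha>))"
  shows "L.ht (carrier L) + \<alpha> + 1 \<le> \<beta>"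
  using \<alpha> r
proof (induction \<alpha> arbitrary: \<beta> rule: less_induct)
  case (less \<alpha>)
  let ?S = "sub_wreath y (M \<alpha>)"
  let ?l = "L.ht (carrier L)"
  have Ms: "subgroup (M \<alpha>) K" using M(1)[OF less.prems(1)] by (simp add: K.cg_subgroups_iff)
  have inf: "infinite (orb y (M \<alpha>))" by (rule M(2)[OF less.prems(1)])
  have Lcg: "carrier L \<in> cg_subgroups L TL" by (rule L.carrier_cg[OF Lc])
  have embS: "emb y ` carrier L \<subseteq> ?S" using emb_sub_wreath[OF Ms y] by blast
  obtain l where l: "l \<in> carrier L" "l \<noteq> \<one>\<^bsub>L\<^esub>" using Lne L.one_closed by blast
  have S1: "?S \<noteq> {\<one>\<^bsub>W\<^esub>}" using embS l emb_eq_one_iff[OF y, of l] by blast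
  obtain \<beta>' where \<beta>': "\<beta>' \<le> \<beta>" "res_class W TW \<beta>' ?S" "\<beta>' = 0 \<or> (\<exists>\<delta>. \<beta>' = \<delta> + 1)"
    using res_class_nonlimit[OF less.prems(2)] by blast
  moreover have "\<beta>' \<noteq> 0" using \<beta>'(2) res_class_zero S1 by blast
  ultimately obtain \<delta> where \<delta>: "\<beta>' = \<delta> + 1" by blast
  have below: "\<exists>\<epsilon>\<le>\<delta>. res_class W TW \<epsilon> H"
    if "H \<in> cg_subgroups W TW" "res_prec W TW H ?S" for H
    using res_class_pred[OF \<beta>'(2) S1 group_W that] \<delta> by (auto simp: ordinal_less_add_one_iff)
  have "?l \<le> \<delta>"
  proof -
    have "emb y ` carrier L \<noteq> ?S"
    proof
      assume eq: "emb y ` carrier L = ?S"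
      have "M \<alpha> \<subseteq> {\<one>\<^bsub>K\<^esub>}"
      proof
        fix m assume "m \<in> M \<alpha>"
        then have "top_emb m \<in> emb y ` carrier L" by (simp add: eq top_emb_sub_wreath)
        then show "m \<in> {\<one>\<^bsub>K\<^esub>}" by (auto simp: top_emb_def emb_def)
      qed
      then have "finite (orb y (M \<alpha>))" unfolding orb_def by (meson finite.intros finite_imageI finite_subset)
      then show False using inf by simp
    qed
    moreover have "emb y ` carrier L \<subseteq> Res W TW ?S"
      using emb_Res_sub_wreath[OF Ms y inf nc] by blast
    ultimately obtain \<epsilon> where \<epsilon>: "\<epsilon> \<le> \<delta>" "res_class W TW \<epsilon> (emb y ` carrier L)"
      using below[OF emb_image_cg[OF y Lcg]] by (auto simp: res_prec_def)
    then obtain \<epsilon>' where "\<epsilon>' \<le> \<epsilon>" "res_class L TL \<epsilon>' (carrier L)"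
      using res_class_emb[OF \<epsilon>(2) refl y Lcg] by blast
    then have "?l \<le> \<epsilon>'" by (intro L.height_le)
    then show ?thesis using \<open>\<epsilon>' \<le> \<epsilon>\<close> \<epsilon>(1) by simp
  qed
  moreover have "?l + \<gamma> < \<delta>" if \<gamma>: "\<gamma> < \<alpha>" for \<gamma>
  proof -
    have \<gamma>\<mu>: "\<gamma> < \<mu>" using \<gamma> less.prems(1) by simp
    have p: "M \<gamma> \<subseteq> Res K TK (M \<alpha>)" "M \<gamma> \<noteq> M \<alpha>" using M(3)[OF \<gamma> less.prems(1)] by (auto simp: res_prec_def)
    have Ms': "subgroup (M \<gamma>) K" using M(1)[OF \<gamma>\<mu>] by (simp add: K.cg_subgroups_iff)
    have "sub_wreath y (M \<gamma>) \<noteq> ?S" using p(2) top_emb_sub_wreath by blast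
    moreover have "sub_wreath y (M \<gamma>) \<subseteq> Res W TW ?S"
      by (rule sub_wreath_Res_sub_wreath[OF Ms Ms' p(1) y inf nc])
    ultimately obtain \<epsilon> where \<epsilon>: "\<epsilon> \<le> \<delta>" "res_class W TW \<epsilon> (sub_wreath y (M \<gamma>))"
      using below[OF sub_wreath_cg[OF M(1)[OF \<gamma>\<mu>] y Lc]] by (auto simp: res_prec_def)
    have "?l + \<gamma> + 1 \<le> \<epsilon>" by (rule less.IH[OF \<gamma> \<gamma>\<mu> \<epsilon>(2)])
    then show ?thesis using \<epsilon>(1) by (simp add: ordinal_succ_le_iff)
  qed
  \<comment> \<open>By the recursion for addition, anything below \<open>?l + \<alpha>\<close> is
    below \<open>?l\<close> or equal to some \<open>?l + \<gamma>\<close> with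
    \<open>\<gamma> < \<alpha>\<close>, so \<open>\<delta>\<close> cannot be below it.\<close>
  ultimately have "?l + \<alpha> \<le> \<delta>"
    by (metis not_less ordinal_less_add_iff order_less_irrefl)
  then have "?l + \<alpha> < \<beta>'" by (simp add: \<delta> ordinal_less_add_one_iff)
  then have "?l + \<alpha> + 1 \<le> \<beta>'" by (simp add: ordinal_succ_le_iff)
  then show ?case using \<beta>'(1) by simp
qed

lemma wreath_rank:
  assumes Lc: "compactly_generated L TL" and Lne: "carrier L \<noteq> {\<one>\<^bsub>L\<^esub>}"
    and Kc: "compactly_generated K TK" and Kne: "carrier K \<noteq> {\<one>\<^bsub>K\<^esub>}"
    and nc: "normal_closure L U = carrier L" and y: "y \<in> X"
    and M: "\<And>\<alpha>. \<alpha> < K.ht (carrier K) \<Longrightarrow> M \<alpha> \<in> cg_subgroups K TK"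
      "\<And>\<alpha>. \<alpha> < K.ht (carrier K) \<Longrightarrow> infinite (orb y (M \<alpha>))"
      "\<And>\<alpha> \<gamma>. \<gamma> < \<alpha> \<Longrightarrow> \<alpha> < K.ht (carrier K) \<Longrightarrow> res_prec K TK (M \<gamma>) (M \<alpha>)"
  shows "residual_rank_well_defined W TW \<and>
    residual_rank W TW = ord_pred (residual_rank L TL) + residual_rank K TK"
proof
  let ?l = "L.ht (carrier L)" and ?k = "K.ht (carrier K)"
  have Lcg: "carrier L \<in> cg_subgroups L TL" by (rule L.carrier_cg[OF Lc])
  have Kcg: "carrier K \<in> cg_subgroups K TK" by (rule K.carrier_cg[OF Kc])
  have lt: "?l + ?k < omega1" using L.height(1)[OF Lcg] K.height(1)[OF Kcg] by (rule omega1_add)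
  have ub: "\<exists>\<beta>\<le>?l + ?k. res_class W TW \<beta> H" if H: "H \<in> cg_subgroups W TW" for H
  proof -
    have c: "top_closure H \<in> cg_subgroups K TK" by (rule top_closure_cg[OF H])
    then have "K.ht (top_closure H) \<le> ?k"
      by (intro K.height_mono Kcg) (simp_all add: K.cg_subgroups_iff subgroup.subset)
    then have "?l + K.ht (top_closure H) \<le> ?l + ?k" by (simp add: ordinal_add_le_cancel)
    then show ?thesis using height_bound[OF Lc Lne H] order_trans by blast
  qed
  show "residual_rank_well_defined W TW"
    unfolding residual_rank_well_defined_def using ub lt res_class_cg_W by (blast intro: order_le_less_trans)
  have ht: "residual_height W TW H \<le> ?l + ?k" "res_class W TW (residual_height W TW H) H"
    if H: "H \<in> cg_subgroups W TW" for H
  proof -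
    obtain \<beta> where \<beta>: "\<beta> \<le> ?l + ?k" "res_class W TW \<beta> H" using ub[OF H] by blast
    then have 1: "\<beta> < omega1 \<and> res_class W TW \<beta> H" using lt by simp
    show "residual_height W TW H \<le> ?l + ?k"
      unfolding residual_height_def[of W]
      using Least_le[where P = "\<lambda>\<beta>. \<beta> < omega1 \<and> res_class W TW \<beta> H", OF 1] \<beta>(1) by simp
    show "res_class W TW (residual_height W TW H) H"
      unfolding residual_height_def[of W]
      using LeastI[where P = "\<lambda>\<beta>. \<beta> < omega1 \<and> res_class W TW \<beta> H", OF 1] by blast
  qed
  have "?k \<noteq> 0" using K.height_eq_0_iff[OF Kcg] Kne by simp
  \<comment> \<open>The chain has a last index because a nonzero height is a successor. Its
    sub-wreath product attains the upper bound, as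
    \<open>?l + \<delta> + 1 = ?l + ?k\<close>.\<close>
  then obtain \<delta> where \<delta>: "?k = \<delta> + 1" using Kcg by (rule_tac K.height_cases[of "carrier K"]) auto
  then have d: "\<delta> < ?k" by simp
  let ?S = "sub_wreath y (M \<delta>)"
  have S: "?S \<in> cg_subgroups W TW" by (rule sub_wreath_cg[OF M(1)[OF d] y Lc])
  have "?l + \<delta> + 1 \<le> residual_height W TW ?S"
    by (rule lower_bound[where M = M and \<alpha> = \<delta>, OF Lc Lne nc y M d ht(2)[OF S]])
  then have hS: "residual_height W TW ?S = ?l + ?k"
    using ht(1)[OF S] \<delta> by (simp add: ordinal_add_assoc order_antisym)
  have "residual_rank W TW = ?l + ?k + 1"
    unfolding residual_rank_def
  proof (rule ord_sup_plus_max)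
    show "?l + ?k + 1 \<in> (\<lambda>H. residual_height W TW H + 1) ` cg_subgroups W TW"
      by (rule image_eqI[OF _ S]) (simp add: hS)
    fix \<alpha> assume "\<alpha> \<in> (\<lambda>H. residual_height W TW H + 1) ` cg_subgroups W TW"
    then show "\<alpha> \<le> ?l + ?k + 1"
      using ht(1) by (auto simp: ordinal_succ_le_iff ordinal_less_add_one_iff)
  qed
  then show "residual_rank W TW = ord_pred (residual_rank L TL) + residual_rank K TK"
    by (simp add: L.rank_eq[OF Lc] K.rank_eq[OF Kc] ordinal_add_assoc)
qed

end

theorem theorem5p2:
  fixes L :: "'l monoid" and TL :: "'l topology" and U :: "'l set"
    and K :: "'k monoid" and TK :: "'k topology"
    and X :: "'x set" and \<phi> :: "'k \<Rightarrow> 'x \<Rightarrow> 'x"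
  assumes "elementary_group L TL" "compactly_generated L TL" "carrier L \<noteq> {\<one>\<^bsub>L\<^esub>}"
    and "elementary_group K TK" "compactly_generated K TK" "carrier K \<noteq> {\<one>\<^bsub>K\<^esub>}"
    and "group_action K X \<phi>" "X \<noteq> {}" "countable X"
    and "\<And>x. x \<in> X \<Longrightarrow> compactin TK (stabilizer K \<phi> x)"
    and "\<And>x. x \<in> X \<Longrightarrow> openin TK (stabilizer K \<phi> x)"
    and "subgroup U L" "compactin TL U" "openin TL U" "normal_closure L U = carrier L"
  shows
    "((\<exists>F. witnesses_rank K TK (residual_height K TK (carrier K)) F \<and>
           (\<exists>x\<in>X. infinite (orbit (K\<lparr>carrier := F 0\<rparr>) \<phi> x))) \<longrightarrow>
        residual_rank_well_defined (wreath_product L U K X \<phi>) (wreath_topology L TL U TK X) \<and>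
        residual_rank (wreath_product L U K X \<phi>) (wreath_topology L TL U TK X)
          = ord_pred (residual_rank L TL) + residual_rank K TK) \<and>
     (omega < residual_rank K TK \<and> (\<exists>\<alpha> F. witnesses_rank K TK \<alpha> F) \<longrightarrow>
        residual_rank_well_defined (wreath_product L U K X \<phi>) (wreath_topology L TL U TK X) \<and>
        residual_rank (wreath_product L U K X \<phi>) (wreath_topology L TL U TK X)
          = ord_pred (residual_rank L TL) + residual_rank K TK)"
proof -
  interpret L: founded_group L TL by (rule elementary_founded_group) fact
  interpret K: founded_group K TK by (rule elementary_founded_group) fact
  interpret wreath L TL K TK X \<phi> U
    by (rule wreath.intro[OF L.founded_group_axioms K.founded_group_axioms assms(7) wreath_axioms.intro]) fact+
  let ?k = "residual_height K TK (carrier K)"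
  have rank: "residual_rank K TK = ?k + 1" by (rule K.rank_eq) fact
  have Kcg: "carrier K \<in> cg_subgroups K TK" by (rule K.carrier_cg) fact
  have k0: "0 < ?k" using K.height_eq_0_iff[OF Kcg] assms(6) by (metis ordinal_zero_le order_le_less)
  have w: "F 0 \<noteq> {\<one>\<^bsub>K\<^esub>}" "\<And>\<beta>. \<beta> < ?k \<Longrightarrow> F \<beta> \<in> cg_subgroups K TK"
    "\<And>\<beta> \<beta>'. \<beta> < \<beta>' \<Longrightarrow> \<beta>' < ?k \<Longrightarrow> res_prec K TK (F \<beta>) (F \<beta>')"
    if "witnesses_rank K TK ?k F" for F
    using that k0 by (auto simp: witnesses_rank_def witnesses_rank_ge_def)
  \<comment> \<open>For \<open>\<beta> > 0\<close> the residual of \<open>F \<beta>\<close> contains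
    the nontrivial group \<open>F 0\<close>.\<close>
  have inf: "infinite (orb y (F \<beta>))" if F: "witnesses_rank K TK ?k F" and \<beta>: "0 < \<beta>" "\<beta> < ?k" and y: "y \<in> X"
    for F \<beta> y
  proof (rule infinite_orb[OF w(2)[OF F \<beta>(2)] _ y])
    have "F 0 \<subseteq> Res K TK (F \<beta>)" using w(3)[OF F \<beta>] by (simp add: res_prec_def)
    moreover have "\<one>\<^bsub>K\<^esub> \<in> F 0" using w(2)[OF F k0] by (simp add: K.cg_subgroups_iff subgroup.one_closed)
    ultimately show "Res K TK (F \<beta>) \<noteq> {\<one>\<^bsub>K\<^esub>}" using w(1)[OF F] by blast
  qed
  show ?thesis
  proof (intro conjI[of "_ \<longrightarrow> _"] impI; elim exE conjE bexE)
    fix F x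
    assume F: "witnesses_rank K TK ?k F" and x: "x \<in> X" and orb0: "infinite (orbit (K\<lparr>carrier := F 0\<rparr>) \<phi> x)"
    have "orbit (K\<lparr>carrier := F 0\<rparr>) \<phi> x = orb x (F 0)" by (auto simp: orbit_def orb_def)
    \<comment> \<open>Index 0 is the hypothesis on the orbit; larger indices are covered by
      \<open>inf\<close>.\<close>
    then have "infinite (orb x (F \<beta>))" if "\<beta> < ?k" for \<beta>
      using orb0 inf[OF F _ that x] by (metis ordinal_zero_le order_le_less)
    then show "residual_rank_well_defined W TW \<and>
        residual_rank W TW = ord_pred (residual_rank L TL) + residual_rank K TK"
      using w[OF F] by (intro wreath_rank[OF assms(2,3,5,6,15) x]) auto
  next
    fix \<alpha> F
    assume om: "omega < residual_rank K TK" and F': "witnesses_rank K TK \<alpha> F"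
    have "\<alpha> = ?k" using F' rank by (simp add: witnesses_rank_def)
    then have F: "witnesses_rank K TK ?k F" using F' by simp
    \<comment> \<open>The rank is \<open>?k + 1\<close>, so its exceeding \<open>omega\<close> means
      \<open>omega \<le> ?k\<close>. Hence the shifted indices \<open>1 + \<beta>\<close> remain
      below \<open>?k\<close> while avoiding 0.\<close>
    have "omega \<le> ?k" using om rank by (simp add: ordinal_less_add_one_iff)
    then have one_add: "1 + ?k = ?k" by (rule one_add_omega_le)
    have lt: "1 + \<beta> < ?k" if "\<beta> < ?k" for \<beta>
      using that one_add by (metis ordinal_add_less_cancel)
    have pos: "0 < 1 + \<beta>" for \<beta> :: ordinal
      using ordinal_le_add[of 1 \<beta>] by (metis ordinal_less_one_iff order_less_le_trans)
    obtain y where y: "y \<in> X" using assms(8) by blast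
    show "residual_rank_well_defined W TW \<and>
        residual_rank W TW = ord_pred (residual_rank L TL) + residual_rank K TK"
    proof (rule wreath_rank[OF assms(2,3,5,6,15) y, where M = "\<lambda>\<beta>. F (1 + \<beta>)"])
      fix \<beta> assume \<beta>: "\<beta> < ?k"
      show "F (1 + \<beta>) \<in> cg_subgroups K TK" by (rule w(2)[OF F lt[OF \<beta>]])
      show "infinite (orb y (F (1 + \<beta>)))" by (rule inf[OF F pos lt[OF \<beta>] y])
      fix \<gamma> assume "\<gamma> < \<beta>"
      then show "res_prec K TK (F (1 + \<gamma>)) (F (1 + \<beta>))"
        by (intro w(3)[OF F _ lt[OF \<beta>]]) (simp add: ordinal_add_less_cancel)
    qed
  qed
qed

end
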